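(* (Random bipolar theorem) Let $\langle X,Y\rangle$ be a random duality pair over $K$ with base $(\Omega,\mathcal F,P)$ such that $X$ has the countable concatenation property. Then, for any subset $A$ of $X$ and for each random compatible locally $L^0$-convex topology $\mathcal T$ on $X$ with $Y$, $$A^{00}=[H_{cc}(\Gamma(A))]^-_{\mathcal T},$$ where $\Gamma(A)$ denotes the $L^0$-balanced and $L^0$-convex hull of $A$ and $[H_{cc}(\Gamma(A))]^-_{\mathcal T}$ the $\mathcal T$-closure of the countable concatenation hull $H_{cc}(\Gamma(A))$.
   Context: $(\Omega,\mathcal F,P)$ is a probability space and $K=\mathbb R$ or $\mathbb C$. $L^0(\mathcal F,K)$ is the algebra of (a.s.-equality) equivalence classes of $K$-valued $\mathcal F$-measurable random variables; $L^0(\mathcal F)=L^0(\mathcal F,\mathbb R)$ with the a.s. order; $L^0_+(\mathcal F)$ and $L^0_{++}(\mathcal F)$ are its elements that are $\ge0$, respectively $>0$, a.s. on $\Omega$. $\tilde I_A$ is the class of the indicator of $A\in\mathcal F$. Two $L^0(\mathcal F,K)$-modules $X,Y$ form a random duality pair $\langle X,Y\rangle$ with respect to an $L^0(\mathcal F,K)$-bilinear map $\langle\cdot,\cdot\rangle:X\times Y\to L^0(\mathcal F,K)$ if: $\langle x,y\rangle=0$ for all $y\in Y$ iff $x=\theta$; and $\langle x,y\rangle=0$ for all $x\in X$ iff $y=\theta$. For $A\subset X$, the polar is $A^0=\{y\in Y:|\langle a,y\rangle|\le1\ \forall a\in A\}$; polars in $X$ of subsets of $Y$ are defined similarly, and $A^{00}=(A^0)^0\subset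 X$. An $L^0$-seminorm on an $L^0(\mathcal F,K)$-module $X$ is a map $\|\cdot\|:X\to L^0_+(\mathcal F)$ with $\|\xi x\|=|\xi|\|x\|$, $\|x+y\|\le\|x\|+\|y\|$. $(X,\mathcal P)$ is a random locally convex module if $\mathcal P$ is a family of $L^0$-seminorms with $\bigvee\{\|x\|:\|\cdot\|\in\mathcal P\}=0$ iff $x=\theta$. The locally $L^0$-convex topology $\mathcal T_c$ induced by $\mathcal P$ has local base at $\theta$ consisting of $\{x:\bigvee_{\|\cdot\|\in\mathcal Q}\|x\|\le\varepsilon\}$, $\mathcal Q\subset\mathcal P$ finite, $\varepsilon\in L^0_{++}(\mathcal F)$; $L^0(\mathcal F,K)$ carries the one induced by $|\cdot|$. $(X,\mathcal P)^*_c$ is the module of continuous module homomorphisms from $(X,\mathcal T_c)$ to $(L^0(\mathcal F,K),\mathcal T_c)$. A locally $L^0$-convex topology $\mathcal T$ on $X$ is called random compatible with $Y$ if it is the topology induced by a family $\mathcal P$ of $L^0$-seminorms on $X$ such that $(X,\mathcal P)$ is a random locally convex module and $(X,\mathcal P)^*_c=Y$ (where $y\in Y$ is identified with $\langle\cdot,y\rangle$). A set $B$ is $L^0$-convex if $\xi x+(1-\xi)y\in B$ for $x,y\in B$, $\xi\in L^0_+(\mathcal F)$, $0\le\xi\le1$; $L^0$-balanced if $\eta B\subset B$ for all $\eta\in L^0(\mathcal F,K)$ with $|\eta|\le1$. $X$ has the countable concatenation property if for every sequence $\{x_n\}$ in $X$ and countable partition $\{A_n\}$ of $\Omega$ into sets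 of $\mathcal F$ there is $x=:\sum_n\tilde I_{A_n}x_n\in X$ (necessarily unique here) with $\tilde I_{A_n}x=\tilde I_{A_n}x_n$ for all $n$. For $G\subset X$, $H_{cc}(G)$ is the set of all $\sum_n\tilde I_{A_n}g_n$ with $\{g_n\}$ a sequence in $G$ and $\{A_n\}$ such a partition. *)

theory Defs
  imports "HOL-Probability.Probability_Measure" "HOL-Algebra.Module" "HOL-Algebra.AbelCoset"
begin

section \<open>The scalar field\<close>

text \<open>
  Up to isometric field isomorphism, the members of this class are exactly the reals and the
  complex numbers. In the first case the norm is necessarily the absolute value.
\<close>

class real_or_complex = real_normed_field + second_countable_topology +
  assumes real_or_complex:
    "(\<forall>z. \<exists>a. z = a *\<^sub>R 1) \<or>
     (\<exists>i. i * i = - 1 \<and>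
       (\<forall>z. \<exists>a b. z = a *\<^sub>R 1 + b *\<^sub>R i \<and> norm z = sqrt (a\<^sup>2 + b\<^sup>2)))"

instance real :: real_or_complex
  by standard auto

instance complex :: real_or_complex
proof
  have "z = Re z *\<^sub>R 1 + Im z *\<^sub>R \<i> \<and> norm z = sqrt ((Re z)\<^sup>2 + (Im z)\<^sup>2)" for z
    by (simp add: complex_eq_iff cmod_def)
  then show "(\<forall>z::complex. \<exists>a. z = a *\<^sub>R 1) \<or>
     (\<exists>i::complex. i * i = - 1 \<and>
       (\<forall>z. \<exists>a b. z = a *\<^sub>R 1 + b *\<^sub>R i \<and> norm z = sqrt (a\<^sup>2 + b\<^sup>2)))"
    by (intro disjI2 exI[of _ \<i>]) (auto simp del: norm_ii)
qed


section \<open>The algebra of equivalence classes of random variables\<close>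

definition AE_rel :: "'w measure \<Rightarrow> (('w \<Rightarrow> 'k::topological_space) \<times> ('w \<Rightarrow> 'k)) set" where
  "AE_rel M = {(f, g). f \<in> borel_measurable M \<and> g \<in> borel_measurable M \<and> (AE w in M. f w = g w)}"

definition AE_class :: "'w measure \<Rightarrow> ('w \<Rightarrow> 'k::topological_space) \<Rightarrow> ('w \<Rightarrow> 'k) set" where
  "AE_class M f = AE_rel M `` {f}"

definition L0_lift ::
  "'w measure \<Rightarrow> ('a \<Rightarrow> 'b::topological_space) \<Rightarrow> ('w \<Rightarrow> 'a) set \<Rightarrow> ('w \<Rightarrow> 'b) set" where
  "L0_lift M h \<xi> = (\<Union>f\<in>\<xi>. AE_class M (\<lambda>w. h (f w)))"

definition L0_lift2 ::
  "'w measure \<Rightarrow> ('a \<Rightarrow> 'b \<Rightarrow> 'c::topological_space) \<Rightarrow>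
     ('w \<Rightarrow> 'a) set \<Rightarrow> ('w \<Rightarrow> 'b) set \<Rightarrow> ('w \<Rightarrow> 'c) set" where
  "L0_lift2 M h \<xi> \<eta> = (\<Union>f\<in>\<xi>. \<Union>g\<in>\<eta>. AE_class M (\<lambda>w. h (f w) (g w)))"

text \<open>The record type \<^type>\<open>module\<close> extends \<^type>\<open>ring\<close>, so this is both the ring of scalars and the
  ring regarded as a module over itself.\<close>

definition L0 :: "'w measure \<Rightarrow> (('w \<Rightarrow> 'k::real_normed_field) set, ('w \<Rightarrow> 'k) set) module" where
  "L0 M = \<lparr>carrier = borel_measurable M // AE_rel M,
           mult = L0_lift2 M (*), one = AE_class M (\<lambda>_. 1),
           zero = AE_class M (\<lambda>_. 0), add = L0_lift2 M (+),
           smult = L0_lift2 M (*)\<rparr>"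

definition L0_abs :: "'w measure \<Rightarrow> ('w \<Rightarrow> 'k::real_normed_field) set \<Rightarrow> ('w \<Rightarrow> real) set" where
  "L0_abs M = L0_lift M norm"

definition L0_of_real :: "'w measure \<Rightarrow> ('w \<Rightarrow> real) set \<Rightarrow> ('w \<Rightarrow> 'k::real_normed_field) set" where
  "L0_of_real M = L0_lift M of_real"

definition L0_indicator :: "'w measure \<Rightarrow> 'w set \<Rightarrow> ('w \<Rightarrow> 'k::real_normed_field) set" where
  "L0_indicator M A = AE_class M (indicator A)"

definition L0_le :: "'w measure \<Rightarrow> ('w \<Rightarrow> real) set \<Rightarrow> ('w \<Rightarrow> real) set \<Rightarrow> bool" where
  "L0_le M \<xi> \<eta> \<longleftrightarrow> (\<exists>f\<in>\<xi>. \<exists>g\<in>\<eta>. AE w in M. f w \<le> g w)"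

definition L0_plus :: "'w measure \<Rightarrow> ('w \<Rightarrow> real) set set" where
  "L0_plus M = {\<xi> \<in> carrier (L0 M). L0_le M \<zero>\<^bsub>L0 M\<^esub> \<xi>}"

definition L0_plusplus :: "'w measure \<Rightarrow> ('w \<Rightarrow> real) set set" where
  "L0_plusplus M = {\<xi> \<in> carrier (L0 M). \<exists>f\<in>\<xi>. AE w in M. 0 < f w}"

definition L0_plus_order :: "'w measure \<Rightarrow> ('w \<Rightarrow> real) set gorder" where
  "L0_plus_order M = \<lparr>carrier = L0_plus M, eq = (=), le = L0_le M\<rparr>"

text \<open>
  \<open>L0_is_Sup M S s\<close>: \<open>s\<close> is the supremum of \<open>S\<close> in the lattice of nonnegative elements. The supremum
  of the empty set is \<open>0\<close>. It is a relation because an infinite family can fail to have a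
  finite-valued supremum.
\<close>

definition L0_is_Sup :: "'w measure \<Rightarrow> ('w \<Rightarrow> real) set set \<Rightarrow> ('w \<Rightarrow> real) set \<Rightarrow> bool" where
  "L0_is_Sup M S s \<longleftrightarrow> least (L0_plus_order M) s (Upper (L0_plus_order M) S)"


section \<open>Module homomorphisms and random duality pairs\<close>

definition module_homs ::
  "('r, 's) ring_scheme \<Rightarrow> ('r, 'x, 'm) module_scheme \<Rightarrow> ('r, 'y, 'n) module_scheme \<Rightarrow> ('x \<Rightarrow> 'y) set"
  where
  "module_homs R X Y = {f \<in> carrier X \<rightarrow> carrier Y.
     (\<forall>x\<in>carrier X. \<forall>y\<in>carrier X. f (x \<oplus>\<^bsub>X\<^esub> y) = f x \<oplus>\<^bsub>Y\<^esub> f y) \<and>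
     (\<forall>r\<in>carrier R. \<forall>x\<in>carrier X. f (r \<odot>\<^bsub>X\<^esub> x) = r \<odot>\<^bsub>Y\<^esub> f x)}"

definition random_duality_pair ::
  "'w measure \<Rightarrow> (('w \<Rightarrow> 'k::real_normed_field) set, 'x, 'm) module_scheme \<Rightarrow>
     (('w \<Rightarrow> 'k) set, 'y, 'n) module_scheme \<Rightarrow> ('x \<Rightarrow> 'y \<Rightarrow> ('w \<Rightarrow> 'k) set) \<Rightarrow> bool" where
  "random_duality_pair M X Y pairing \<longleftrightarrow>
     Module.module (L0 M) X \<and> Module.module (L0 M) Y \<and>
     (\<forall>y\<in>carrier Y. (\<lambda>x. pairing x y) \<in> module_homs (L0 M) X (L0 M)) \<and>
     (\<forall>x\<in>carrier X. (\<lambda>y. pairing x y) \<in> module_homs (L0 M) Y (L0 M)) \<and>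
     (\<forall>x\<in>carrier X. (\<forall>y\<in>carrier Y. pairing x y = \<zero>\<^bsub>L0 M\<^esub>) \<longleftrightarrow> x = \<zero>\<^bsub>X\<^esub>) \<and>
     (\<forall>y\<in>carrier Y. (\<forall>x\<in>carrier X. pairing x y = \<zero>\<^bsub>L0 M\<^esub>) \<longleftrightarrow> y = \<zero>\<^bsub>Y\<^esub>)"

definition polar ::
  "'w measure \<Rightarrow> (('w \<Rightarrow> 'k::real_normed_field) set, 'y, 'n) module_scheme \<Rightarrow>
     ('x \<Rightarrow> 'y \<Rightarrow> ('w \<Rightarrow> 'k) set) \<Rightarrow> 'x set \<Rightarrow> 'y set" where
  "polar M Y pairing A =
     {y \<in> carrier Y. \<forall>a\<in>A. L0_le M (L0_abs M (pairing a y)) \<one>\<^bsub>L0 M\<^esub>}"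

definition bipolar ::
  "'w measure \<Rightarrow> (('w \<Rightarrow> 'k::real_normed_field) set, 'x, 'm) module_scheme \<Rightarrow>
     (('w \<Rightarrow> 'k) set, 'y, 'n) module_scheme \<Rightarrow> ('x \<Rightarrow> 'y \<Rightarrow> ('w \<Rightarrow> 'k) set) \<Rightarrow> 'x set \<Rightarrow> 'x set" where
  "bipolar M X Y pairing A = polar M X (\<lambda>y x. pairing x y) (polar M Y pairing A)"


section \<open>Random locally convex modules\<close>

definition L0_seminorm ::
  "'w measure \<Rightarrow> (('w \<Rightarrow> 'k::real_normed_field) set, 'x, 'm) module_scheme \<Rightarrow>
     ('x \<Rightarrow> ('w \<Rightarrow> real) set) \<Rightarrow> bool" where
  "L0_seminorm M X p \<longleftrightarrow>
     p \<in> carrier X \<rightarrow> L0_plus M \<and>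
     (\<forall>\<xi>\<in>carrier (L0 M). \<forall>x\<in>carrier X. p (\<xi> \<odot>\<^bsub>X\<^esub> x) = L0_abs M \<xi> \<otimes>\<^bsub>L0 M\<^esub> p x) \<and>
     (\<forall>x\<in>carrier X. \<forall>y\<in>carrier X. L0_le M (p (x \<oplus>\<^bsub>X\<^esub> y)) (p x \<oplus>\<^bsub>L0 M\<^esub> p y))"

definition random_locally_convex_module ::
  "'w measure \<Rightarrow> (('w \<Rightarrow> 'k::real_normed_field) set, 'x, 'm) module_scheme \<Rightarrow>
     ('x \<Rightarrow> ('w \<Rightarrow> real) set) set \<Rightarrow> bool" where
  "random_locally_convex_module M X P \<longleftrightarrow>
     Module.module (L0 M) X \<and> (\<forall>p\<in>P. L0_seminorm M X p) \<and>
     (\<forall>x\<in>carrier X. L0_is_Sup M ((\<lambda>p. p x) ` P) \<zero>\<^bsub>L0 M\<^esub> \<longleftrightarrow> x = \<zero>\<^bsub>X\<^esub>)"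

definition L0_ball ::
  "'w measure \<Rightarrow> (('w \<Rightarrow> 'k::real_normed_field) set, 'x, 'm) module_scheme \<Rightarrow>
     ('x \<Rightarrow> ('w \<Rightarrow> real) set) set \<Rightarrow> ('w \<Rightarrow> real) set \<Rightarrow> 'x set" where
  "L0_ball M X Q \<epsilon> = {x \<in> carrier X. \<exists>s. L0_is_Sup M ((\<lambda>p. p x) ` Q) s \<and> L0_le M s \<epsilon>}"

text \<open>Open means containing, with each point, a translate of one of the basic neighbourhoods of
  zero. The basic neighbourhoods themselves need not be open.\<close>

definition Tc ::
  "'w measure \<Rightarrow> (('w \<Rightarrow> 'k::real_normed_field) set, 'x, 'm) module_scheme \<Rightarrow>
     ('x \<Rightarrow> ('w \<Rightarrow> real) set) set \<Rightarrow> 'x topology" where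
  "Tc M X P = topology (\<lambda>U. U \<subseteq> carrier X \<and>
     (\<forall>x\<in>U. \<exists>Q \<epsilon>. finite Q \<and> Q \<subseteq> P \<and> \<epsilon> \<in> L0_plusplus M \<and> x <+\<^bsub>X\<^esub> L0_ball M X Q \<epsilon> \<subseteq> U))"

definition dual_c ::
  "'w measure \<Rightarrow> (('w \<Rightarrow> 'k::real_normed_field) set, 'x, 'm) module_scheme \<Rightarrow>
     ('x \<Rightarrow> ('w \<Rightarrow> real) set) set \<Rightarrow> ('x \<Rightarrow> ('w \<Rightarrow> 'k) set) set" where
  "dual_c M X P = {f \<in> extensional (carrier X).
     f \<in> module_homs (L0 M) X (L0 M) \<and> continuous_map (Tc M X P) (Tc M (L0 M) {L0_abs M}) f}"

definition random_compatible ::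
  "'w measure \<Rightarrow> (('w \<Rightarrow> 'k::real_normed_field) set, 'x, 'm) module_scheme \<Rightarrow>
     (('w \<Rightarrow> 'k) set, 'y, 'n) module_scheme \<Rightarrow> ('x \<Rightarrow> 'y \<Rightarrow> ('w \<Rightarrow> 'k) set) \<Rightarrow> 'x topology \<Rightarrow> bool"
  where
  "random_compatible M X Y pairing T \<longleftrightarrow>
     (\<exists>P. random_locally_convex_module M X P \<and> T = Tc M X P \<and>
          dual_c M X P = (\<lambda>y. \<lambda>x\<in>carrier X. pairing x y) ` carrier Y)"


section \<open>Hulls and countable concatenation\<close>

definition L0_convex ::
  "'w measure \<Rightarrow> (('w \<Rightarrow> 'k::real_normed_field) set, 'x, 'm) module_scheme \<Rightarrow> 'x set \<Rightarrow> bool" where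
  "L0_convex M X B \<longleftrightarrow>
     (\<forall>x\<in>B. \<forall>y\<in>B. \<forall>\<xi>\<in>L0_plus M. L0_le M \<xi> \<one>\<^bsub>L0 M\<^esub> \<longrightarrow>
        L0_of_real M \<xi> \<odot>\<^bsub>X\<^esub> x \<oplus>\<^bsub>X\<^esub> L0_of_real M (\<one>\<^bsub>L0 M\<^esub> \<ominus>\<^bsub>L0 M\<^esub> \<xi>) \<odot>\<^bsub>X\<^esub> y \<in> B)"

definition L0_balanced ::
  "'w measure \<Rightarrow> (('w \<Rightarrow> 'k::real_normed_field) set, 'x, 'm) module_scheme \<Rightarrow> 'x set \<Rightarrow> bool" where
  "L0_balanced M X B \<longleftrightarrow>
     (\<forall>x\<in>B. \<forall>\<eta>\<in>carrier (L0 M). L0_le M (L0_abs M \<eta>) \<one>\<^bsub>L0 M\<^esub> \<longrightarrow> \<eta> \<odot>\<^bsub>X\<^esub> x \<in> B)"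

text \<open>
  The hull ranges over nonempty balanced convex sets, all of which contain zero. Hence the hull of
  the empty set is \<open>{0}\<close> (the empty combination), which is what the bipolar theorem needs;
  for nonempty sets the condition \<open>B \<noteq> {}\<close> is redundant.
\<close>

definition L0_Gamma ::
  "'w measure \<Rightarrow> (('w \<Rightarrow> 'k::real_normed_field) set, 'x, 'm) module_scheme \<Rightarrow> 'x set \<Rightarrow> 'x set" where
  "L0_Gamma M X A =
     (\<lambda>B. B \<subseteq> carrier X \<and> B \<noteq> {} \<and> L0_balanced M X B \<and> L0_convex M X B) hull A"

text \<open>Pieces may be empty, so finite partitions are included.\<close>

definition countable_partition :: "'w measure \<Rightarrow> (nat \<Rightarrow> 'w set) \<Rightarrow> bool" where
  "countable_partition M A \<longleftrightarrow> range A \<subseteq> sets M \<and> disjoint_family A \<and> (\<Union>n. A n) = space M"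

definition is_concatenation ::
  "'w measure \<Rightarrow> (('w \<Rightarrow> 'k::real_normed_field) set, 'x, 'm) module_scheme \<Rightarrow>
     (nat \<Rightarrow> 'w set) \<Rightarrow> (nat \<Rightarrow> 'x) \<Rightarrow> 'x \<Rightarrow> bool" where
  "is_concatenation M X A g x \<longleftrightarrow> x \<in> carrier X \<and>
     (\<forall>n. L0_indicator M (A n) \<odot>\<^bsub>X\<^esub> x = L0_indicator M (A n) \<odot>\<^bsub>X\<^esub> g n)"

definition countable_concatenation_property ::
  "'w measure \<Rightarrow> (('w \<Rightarrow> 'k::real_normed_field) set, 'x, 'm) module_scheme \<Rightarrow> bool" where
  "countable_concatenation_property M X \<longleftrightarrow>
     (\<forall>g A. range g \<subseteq> carrier X \<and> countable_partition M A \<longrightarrow> (\<exists>x. is_concatenation M X A g x))"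

definition Hcc ::
  "'w measure \<Rightarrow> (('w \<Rightarrow> 'k::real_normed_field) set, 'x, 'm) module_scheme \<Rightarrow> 'x set \<Rightarrow> 'x set" where
  "Hcc M X G =
     {x. \<exists>g A. range g \<subseteq> G \<and> countable_partition M A \<and> is_concatenation M X A g x}"


section \<open>Well-definedness of the lifted operations and of the topology\<close>

lemma equiv_AE_rel: "equiv (borel_measurable M) (AE_rel M)"
proof (rule equivI)
  show "trans (AE_rel M)"
  proof (rule transI)
    fix f g h assume fg: "(f, g) \<in> AE_rel M" and gh: "(g, h) \<in> AE_rel M"
    then have "AE w in M. f w = g w" "AE w in M. g w = h w" by (auto simp: AE_rel_def)
    then have "AE w in M. f w = h w" by eventually_elim simp
    then show "(f, h) \<in> AE_rel M" using fg gh by (auto simp: AE_rel_def)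
  qed
qed (auto simp: AE_rel_def refl_on_def sym_def eq_commute)

lemma L0_carrier_iff: "\<xi> \<in> carrier (L0 M) \<longleftrightarrow> (\<exists>f\<in>borel_measurable M. \<xi> = AE_class M f)"
  by (auto simp: L0_def AE_class_def quotient_def)

lemma AE_class_eq_iff:
  "f \<in> borel_measurable M \<Longrightarrow> g \<in> borel_measurable M \<Longrightarrow>
    AE_class M f = AE_class M g \<longleftrightarrow> (AE w in M. f w = g w)"
  unfolding AE_class_def
  by (subst eq_equiv_class_iff[OF equiv_AE_rel]) (auto simp: AE_rel_def)

lemma AE_class_mem:
  "f \<in> borel_measurable M \<Longrightarrow> 
    g \<in> AE_class M f \<longleftrightarrow> g \<in> borel_measurable M \<and> (AE w in M. f w = g w)"
  by (auto simp: AE_class_def AE_rel_def)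

lemma L0_lift_class:
  assumes "f \<in> borel_measurable M" "\<And>f. f \<in> borel_measurable M \<Longrightarrow> (\<lambda>w. h (f w)) \<in> borel_measurable M"
  shows "L0_lift M h (AE_class M f) = AE_class M (\<lambda>w. h (f w))"
proof -
  have "AE_class M (\<lambda>w. h (g w)) = AE_class M (\<lambda>w. h (f w))" if "g \<in> AE_class M f" for g
  proof (subst AE_class_eq_iff)
    have "AE w in M. f w = g w" using that assms by (simp add: AE_class_mem)
    then show "AE w in M. h (g w) = h (f w)" by eventually_elim simp
  qed (use that assms in \<open>auto simp: AE_class_mem\<close>)
  moreover have "f \<in> AE_class M f" using assms by (simp add: AE_class_mem)
  ultimately show ?thesis unfolding L0_lift_def by blast
qed

lemma L0_lift2_class:
  assumes "f \<in> borel_measurable M" "g \<in> borel_measurable M"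
    "\<And>f g. f \<in> borel_measurable M \<Longrightarrow> g \<in> borel_measurable M \<Longrightarrow> (\<lambda>w. h (f w) (g w)) \<in> borel_measurable M"
  shows "L0_lift2 M h (AE_class M f) (AE_class M g) = AE_class M (\<lambda>w. h (f w) (g w))"
proof -
  have "AE_class M (\<lambda>w. h (f' w) (g' w)) = AE_class M (\<lambda>w. h (f w) (g w))"
    if f': "f' \<in> AE_class M f" and g': "g' \<in> AE_class M g" for f' g'
  proof (subst AE_class_eq_iff)
    have "AE w in M. f w = f' w" "AE w in M. g w = g' w"
      using f' g' assms by (auto simp: AE_class_mem)
    then show "AE w in M. h (f' w) (g' w) = h (f w) (g w)" by eventually_elim simp
  qed (use f' g' assms in \<open>auto simp: AE_class_mem\<close>)
  moreover have "f \<in> AE_class M f" "g \<in> AE_class M g" using assms by (simp_all add: AE_class_mem)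
  ultimately show ?thesis unfolding L0_lift2_def by blast
qed

lemma L0_add_class:
  fixes f g :: "'w \<Rightarrow> 'k::{real_normed_field,second_countable_topology}"
  assumes "f \<in> borel_measurable M" "g \<in> borel_measurable M"
  shows "AE_class M f \<oplus>\<^bsub>L0 M\<^esub> AE_class M g = AE_class M (\<lambda>w. f w + g w)"
  using assms by (simp add: L0_def L0_lift2_class)

lemma L0_mult_class:
  fixes f g :: "'w \<Rightarrow> 'k::{real_normed_field,second_countable_topology}"
  assumes "f \<in> borel_measurable M" "g \<in> borel_measurable M"
  shows "AE_class M f \<otimes>\<^bsub>L0 M\<^esub> AE_class M g = AE_class M (\<lambda>w. f w * g w)"
  using assms by (simp add: L0_def L0_lift2_class)

lemma L0_zero: "\<zero>\<^bsub>L0 M\<^esub> = AE_class M (\<lambda>_. 0)" and L0_one: "\<one>\<^bsub>L0 M\<^esub> = AE_class M (\<lambda>_. 1)"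
  by (simp_all add: L0_def)

lemma L0_cring: "cring (L0 M :: (('w \<Rightarrow> 'k::{real_normed_field,second_countable_topology}) set, _) module)"
proof (rule cringI)
  show "abelian_group (L0 M :: (('w \<Rightarrow> 'k) set, _) module)"
  proof (rule abelian_groupI)
    fix x :: "('w \<Rightarrow> 'k) set" assume "x \<in> carrier (L0 M)"
    then obtain f where f: "f \<in> borel_measurable M" "x = AE_class M f" by (auto simp: L0_carrier_iff)
    then show "\<exists>y\<in>carrier (L0 M). y \<oplus>\<^bsub>L0 M\<^esub> x = \<zero>\<^bsub>L0 M\<^esub>"
      by (intro bexI[of _ "AE_class M (\<lambda>w. - f w)"]) (auto simp: L0_add_class L0_carrier_iff L0_zero)
  qed (auto simp: L0_carrier_iff L0_add_class L0_zero add_ac)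
  show "Group.comm_monoid (L0 M :: (('w \<Rightarrow> 'k) set, _) module)"
    by (rule comm_monoidI) (auto simp: L0_carrier_iff L0_mult_class L0_one mult_ac)
qed (auto simp: L0_carrier_iff L0_mult_class L0_add_class distrib_right)

lemma L0_module: "Module.module (L0 M) (L0 M :: (('w \<Rightarrow> 'k::{real_normed_field,second_countable_topology}) set, _) module)"
proof -
  interpret cring "L0 M :: (('w \<Rightarrow> 'k) set, _) module" by (rule L0_cring)
  have e: "a \<odot>\<^bsub>L0 M\<^esub> b = a \<otimes>\<^bsub>L0 M\<^esub> b" for a b :: "('w \<Rightarrow> 'k) set" by (simp add: L0_def)
  show ?thesis by (rule moduleI) (auto simp: e L0_cring abelian_group_axioms l_distr r_distr m_assoc)
qed

lemma L0_le_class: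
  assumes "f \<in> borel_measurable M" "g \<in> borel_measurable M"
  shows "L0_le M (AE_class M f) (AE_class M g) \<longleftrightarrow> (AE w in M. f w \<le> g w)"
proof
  assume "L0_le M (AE_class M f) (AE_class M g)"
  then obtain f' g' where
      "AE w in M. f w = f' w" "AE w in M. g w = g' w" "AE w in M. f' w \<le> g' w"
    using assms by (auto simp: L0_le_def AE_class_mem)
  then show "AE w in M. f w \<le> g w" by eventually_elim simp
next
  assume "AE w in M. f w \<le> g w"
  moreover have "f \<in> AE_class M f" "g \<in> AE_class M g" using assms by (simp_all add: AE_class_mem)
  ultimately show "L0_le M (AE_class M f) (AE_class M g)" by (auto simp: L0_le_def)
qed

lemma L0_plus_iff: "\<xi> \<in> L0_plus M \<longleftrightarrow> (\<exists>f\<in>borel_measurable M. \<xi> = AE_class M f \<and> (AE w in M. 0 \<le> f w))"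
  by (auto simp: L0_plus_def L0_carrier_iff L0_zero L0_le_class)

lemma L0_le_trans:
  assumes "L0_le M a b" "L0_le M b c" "b \<in> carrier (L0 M)" shows "L0_le M a c"
proof -
  obtain f where f: "f \<in> borel_measurable M" "b = AE_class M f" using assms by (auto simp: L0_carrier_iff)
  obtain g g' h h' where "g \<in> a" "g' \<in> b" "h \<in> b" "h' \<in> c" and
     w: "AE w in M. g w \<le> g' w" "AE w in M. h w \<le> h' w" using assms by (auto simp: L0_le_def)
  then have "AE w in M. f w = g' w" "AE w in M. f w = h w" using f by (auto simp: AE_class_mem)
  with w have "AE w in M. g w \<le> h' w" by eventually_elim auto
  with \<open>g \<in> a\<close> \<open>h' \<in> c\<close> show ?thesis by (auto simp: L0_le_def)
qed

lemma L0_is_Sup_iff: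
  "L0_is_Sup M S s \<longleftrightarrow> s \<in> L0_plus M \<and> (\<forall>x\<in>S \<inter> L0_plus M. L0_le M x s) \<and>
    (\<forall>u\<in>L0_plus M. (\<forall>x\<in>S \<inter> L0_plus M. L0_le M x u) \<longrightarrow> L0_le M s u)"
  by (auto simp: L0_is_Sup_def least_def Upper_def L0_plus_order_def)

lemma L0_finite_Sup: "finite S \<Longrightarrow> \<exists>s. L0_is_Sup M S s"
proof (induction S rule: finite_induct)
  case empty
  show ?case by (rule exI[of _ "\<zero>\<^bsub>L0 M\<^esub>"]) (auto simp: L0_is_Sup_iff L0_plus_iff L0_zero L0_le_class)
next
  case (insert x S)
  then obtain s where s: "L0_is_Sup M S s" by blast
  show ?case
  proof (cases "x \<in> L0_plus M")
    case False
    then show ?thesis using s by (auto simp: L0_is_Sup_iff)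
  next
    case True
    then obtain f where f: "f \<in> borel_measurable M" "x = AE_class M f" "AE w in M. 0 \<le> f w"
      by (auto simp: L0_plus_iff)
    obtain g where g: "g \<in> borel_measurable M" "s = AE_class M g" "AE w in M. 0 \<le> g w"
      using s by (auto simp: L0_plus_iff L0_is_Sup_iff)
    let ?h = "\<lambda>w. max (f w) (g w)"
    let ?m = "AE_class M ?h"
    have h: "?h \<in> borel_measurable M" using f(1) g(1) by simp
    have 1: "L0_le M x ?m" "L0_le M s ?m"
      unfolding f(2) g(2) using f(1) g(1) h by (simp_all add: L0_le_class)
    have "AE w in M. 0 \<le> ?h w" using f(3) by eventually_elim simp
    then have 2: "?m \<in> L0_plus M" using h unfolding L0_plus_iff by blast
    have 3: "L0_le M ?m u" if "L0_le M x u" "L0_le M s u" and u: "u \<in> L0_plus M" for u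
    proof -
      obtain k where k: "k \<in> borel_measurable M" "u = AE_class M k" using u by (auto simp: L0_plus_iff)
      have "AE w in M. f w \<le> k w" "AE w in M. g w \<le> k w" 
        using that(1,2) f(1) g(1) k(1) unfolding f(2) g(2) k(2) by (simp_all add: L0_le_class)
      then have "AE w in M. ?h w \<le> k w" by eventually_elim auto
      then show ?thesis using k h by (simp add: L0_le_class)
    qed
    have "s \<in> carrier (L0 M)" using s by (auto simp: L0_is_Sup_iff L0_plus_def)
    then have "L0_is_Sup M (insert x S) ?m"
      using s 1 2 3 True unfolding L0_is_Sup_iff by (auto intro: L0_le_trans)
    then show ?thesis by blast
  qed
qed

lemma L0_ball_mono:
  assumes "finite Q'" "Q \<subseteq> Q'" "L0_le M e' e" "e' \<in> carrier (L0 M)"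
  shows "L0_ball M X Q' e' \<subseteq> L0_ball M X Q e"
proof
  fix x assume "x \<in> L0_ball M X Q' e'"
  then obtain s where x: "x \<in> carrier X" and s: "L0_is_Sup M ((\<lambda>p. p x) ` Q') s" "L0_le M s e'"
    by (auto simp: L0_ball_def)
  obtain t where t: "L0_is_Sup M ((\<lambda>p. p x) ` Q) t"
    using L0_finite_Sup assms by (meson finite_imageI finite_subset)
  have "L0_le M y s" if "y \<in> (\<lambda>p. p x) ` Q \<inter> L0_plus M" for y
    using s(1) that assms(2) unfolding L0_is_Sup_iff by blast
  moreover have "s \<in> L0_plus M" using s(1) by (simp add: L0_is_Sup_iff)
  ultimately have "L0_le M t s" using t by (simp add: L0_is_Sup_iff)
  moreover have "s \<in> carrier (L0 M)" using s(1) by (simp add: L0_is_Sup_iff L0_plus_def)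
  ultimately have "L0_le M t e" using s(2) assms(3,4) by (meson L0_le_trans)
  then show "x \<in> L0_ball M X Q e" using x t by (auto simp: L0_ball_def)
qed

lemma L0_plusplus_iff: "\<xi> \<in> L0_plusplus M \<longleftrightarrow> (\<exists>f\<in>borel_measurable M. \<xi> = AE_class M f \<and> (AE w in M. 0 < f w))"
proof -
  have "(\<exists>g\<in>AE_class M f. AE w in M. 0 < g w) \<longleftrightarrow> (AE w in M. 0 < f w)"
    if f: "f \<in> borel_measurable M" for f :: "'a \<Rightarrow> real"
  proof
    assume "\<exists>g\<in>AE_class M f. AE w in M. 0 < g w"
    then obtain g where "AE w in M. f w = g w" "AE w in M. 0 < g w"
      using f by (auto simp: AE_class_mem)
    then show "AE w in M. 0 < f w" by eventually_elim simp
  next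
    assume "AE w in M. 0 < f w"
    then show "\<exists>g\<in>AE_class M f. AE w in M. 0 < g w"
      using f by (intro bexI[of _ f]) (simp_all add: AE_class_mem)
  qed
  then show ?thesis 
    unfolding L0_plusplus_def L0_carrier_iff by fast
qed

lemma openin_Tc:
  "openin (Tc M X P) U \<longleftrightarrow> U \<subseteq> carrier X \<and>
     (\<forall>x\<in>U. \<exists>Q \<epsilon>. finite Q \<and> Q \<subseteq> P \<and> \<epsilon> \<in> L0_plusplus M \<and> x <+\<^bsub>X\<^esub> L0_ball M X Q \<epsilon> \<subseteq> U)"
proof -
  have mono: "x <+\<^bsub>X\<^esub> B \<subseteq> x <+\<^bsub>X\<^esub> C" if "B \<subseteq> C" for x B C
    using that by (auto simp: a_l_coset_def l_coset_def)
  have "istopology (\<lambda>U. U \<subseteq> carrier X \<and>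
     (\<forall>x\<in>U. \<exists>Q \<epsilon>. finite Q \<and> Q \<subseteq> P \<and> \<epsilon> \<in> L0_plusplus M \<and> x <+\<^bsub>X\<^esub> L0_ball M X Q \<epsilon> \<subseteq> U))"
    (is "istopology (\<lambda>U. ?op U)")
    unfolding istopology_def
  proof (intro conjI allI impI)
    fix S T assume S: "?op S" and T: "?op T"
    show "S \<inter> T \<subseteq> carrier X" using S by blast
    show "\<forall>x\<in>S \<inter> T. \<exists>Q \<epsilon>. finite Q \<and> Q \<subseteq> P \<and> \<epsilon> \<in> L0_plusplus M \<and> x <+\<^bsub>X\<^esub> L0_ball M X Q \<epsilon> \<subseteq> S \<inter> T"
    proof
      fix x assume x: "x \<in> S \<inter> T"
      obtain Q1 e1 where 1: "finite Q1" "Q1 \<subseteq> P" "e1 \<in> L0_plusplus M" "x <+\<^bsub>X\<^esub> L0_ball M X Q1 e1 \<subseteq> S"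
        using S x by blast
      obtain Q2 e2 where 2: "finite Q2" "Q2 \<subseteq> P" "e2 \<in> L0_plusplus M" "x <+\<^bsub>X\<^esub> L0_ball M X Q2 e2 \<subseteq> T"
        using T x by blast
      obtain f where f: "f \<in> borel_measurable M" "e1 = AE_class M f" "AE w in M. 0 < f w"
        using 1 by (auto simp: L0_plusplus_iff)
      obtain g where g: "g \<in> borel_measurable M" "e2 = AE_class M g" "AE w in M. 0 < g w"
        using 2 by (auto simp: L0_plusplus_iff)
      let ?h = "\<lambda>w. min (f w) (g w)"
      let ?e = "AE_class M ?h"
      have h: "?h \<in> borel_measurable M" using f(1) g(1) by simp
      have "AE w in M. 0 < ?h w" using f(3) g(3) by eventually_elim auto
      then have e: "?e \<in> L0_plusplus M" "?e \<in> carrier (L0 M)"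
        using h unfolding L0_plusplus_iff L0_carrier_iff by blast+
      have le: "L0_le M ?e e1" "L0_le M ?e e2"
        unfolding f(2) g(2) using f(1) g(1) h by (simp_all add: L0_le_class)
      have "L0_ball M X (Q1 \<union> Q2) ?e \<subseteq> L0_ball M X Q1 e1" "L0_ball M X (Q1 \<union> Q2) ?e \<subseteq> L0_ball M X Q2 e2"
        by (rule L0_ball_mono; use 1 2 e le in blast)+
      then have "x <+\<^bsub>X\<^esub> L0_ball M X (Q1 \<union> Q2) ?e \<subseteq> S \<inter> T" 
        using order_trans[OF mono 1(4)] order_trans[OF mono 2(4)] by (metis Int_greatest)
      then show "\<exists>Q \<epsilon>. finite Q \<and> Q \<subseteq> P \<and> \<epsilon> \<in> L0_plusplus M \<and> x <+\<^bsub>X\<^esub> L0_ball M X Q \<epsilon> \<subseteq> S \<inter> T"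
        using 1 2 e by (intro exI[of _ "Q1 \<union> Q2"] exI[of _ ?e]) auto
    qed
  next
    fix \<K> assume K: "\<forall>K\<in>\<K>. ?op K"
    then show "\<Union>\<K> \<subseteq> carrier X" by blast
    show "\<forall>x\<in>\<Union>\<K>. \<exists>Q \<epsilon>. finite Q \<and> Q \<subseteq> P \<and> \<epsilon> \<in> L0_plusplus M \<and> x <+\<^bsub>X\<^esub> L0_ball M X Q \<epsilon> \<subseteq> \<Union>\<K>"
    proof
      fix x assume "x \<in> \<Union>\<K>"
      then obtain S where S: "S \<in> \<K>" "x \<in> S" by blast
      have "\<exists>Q \<epsilon>. finite Q \<and> Q \<subseteq> P \<and> \<epsilon> \<in> L0_plusplus M \<and> x <+\<^bsub>X\<^esub> L0_ball M X Q \<epsilon> \<subseteq> S"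
        using bspec[OF conjunct2[OF bspec[OF K S(1)]] S(2)] .
      then obtain Q e where Q: "finite Q" "Q \<subseteq> P" "e \<in> L0_plusplus M"
        "x <+\<^bsub>X\<^esub> L0_ball M X Q e \<subseteq> S"
        by (elim exE conjE)
      moreover have "x <+\<^bsub>X\<^esub> L0_ball M X Q e \<subseteq> \<Union>\<K>" using Q(4) Union_upper[OF S(1)] by (rule order_trans)
      ultimately show "\<exists>Q \<epsilon>. finite Q \<and> Q \<subseteq> P \<and> \<epsilon> \<in> L0_plusplus M \<and> x <+\<^bsub>X\<^esub> L0_ball M X Q \<epsilon> \<subseteq> \<Union>\<K>"
        by (intro exI conjI)
    qed
  qed
  then show ?thesis unfolding Tc_def by (subst topology_inverse') auto
qed

end

theory Submission
  imports Defs
begin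

text \<open>
  The inclusion of the closure in the bipolar holds because the sets \<open>{x. \<bar>\<langle>x, y\<rangle>\<bar> \<le> 1}\<close> are closed,
  balanced, convex and stable under countable concatenation. Conversely, if \<open>x\<close> is not in the
  closure, then concatenation shows that, for the seminorm \<open>p\<close> and the radius \<open>\<epsilon>\<close> of some basic
  neighbourhood, \<open>p (x - h) \<ge> \<epsilon>\<close> holds for all \<open>h \<in> \<Gamma>(A)\<close> on one common event \<open>D\<close> of positive
  probability. The infimal convolution \<open>q\<close> of the Minkowski functional of \<open>\<Gamma>(A)\<close> with \<open>(2 / \<epsilon>) p\<close>
  satisfies \<open>q \<le> 1\<close> on \<open>\<Gamma>(A)\<close> and \<open>q x > 1\<close> on \<open>D\<close>. A module homomorphism that is dominated by \<open>q\<close>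
  and attains \<open>q x\<close> at \<open>x\<close> is continuous, hence given by some \<open>y \<in> Y\<close>, and this \<open>y\<close> separates \<open>x\<close> from \<open>A\<close>.
  It exists because a minimal sublinear functional over the random variables is linear, which avoids
  extending functionals from submodules.
\<close>

section \<open>Essential infima\<close>

text \<open>The order of random variables is only partial, and this shapes the argument: the failure
  of a lower bound \<open>e\<close> gives values below \<open>e\<close> on some event only, so
  estimates have to be localized and local choices glued. Countable concatenation does the gluing.
  Uncountable families have no usable pointwise infimum; essential infima, realized by countable
  subfamilies, replace it. Extending functionals one vector at a time would meet a vector whose
  multiples lie in the submodule on one event and not on another. The comparison functional
  \<open>directional\<close> is instead defined on all of \<open>X\<close> at once by an essential
  infimum. A bare Minkowski functional need be neither finite nor continuous; convolving it with a
  multiple of \<open>p\<close> repairs both. The factor 2 in \<open>2 / e\<close> leaves room for a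
  strict gap: beside a multiple \<open>\<xi> \<ge> 1\<close>, a remaining distance of
  \<open>e / 2\<close> already costs 1, and a smaller one forces \<open>\<xi>\<close> above 1 by a
  definite random amount. Such a uniform amount is needed because essential infima preserve only
  weak inequalities.\<close>

lemma (in prob_space) ess_inf_sequence:
  fixes S :: "('a \<Rightarrow> real) set"
  assumes ne: "S \<noteq> {}" and S: "S \<subseteq> borel_measurable M"
  obtains F :: "nat \<Rightarrow> 'a \<Rightarrow> real" where "range F \<subseteq> S"
    "\<And>f. f \<in> S \<Longrightarrow> AE w in M. \<forall>u. (\<forall>n. u \<le> F n w) \<longrightarrow> u \<le> f w"
proof -
  \<comment> \<open>\<open>arctan\<close> is strictly increasing and bounded: it makes every infimum
    exist and be integrable, so that a countable subfamily with the least possible infimum can be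
    found by minimizing an integral. Order statements are translated back at the end, in terms of
    lower bounds \<open>u\<close>, since the untransformed infimum may be infinite.\<close>
  define h where "h F w = (INF n. arctan (F n w))" for F :: "nat \<Rightarrow> 'a \<Rightarrow> real" and w
  define J where "J F = (\<integral>w. h F w \<partial>M)" for F
  define c where "c = (INF F\<in>{F. range F \<subseteq> S}. J F)"
  have bdd: "bdd_below (range (\<lambda>n. arctan (F n w)))" for F :: "nat \<Rightarrow> 'a \<Rightarrow> real" and w
    using arctan_lbound by (intro bdd_belowI[of _ "- (pi / 2)"]) (auto intro: less_imp_le)
  have h_le: "h F w \<le> arctan (F n w)" for F w n
    unfolding h_def using bdd by (rule cINF_lower) simp
  have h_ge: "u \<le> h F w" if "\<And>n. u \<le> arctan (F n w)" for u F w
    unfolding h_def using that by (intro cINF_greatest) auto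
  have h_bound: "\<bar>h F w\<bar> \<le> pi / 2" for F w
  proof -
    have "- (pi / 2) \<le> h F w" using arctan_lbound by (intro h_ge) (auto intro: less_imp_le)
    moreover have "h F w \<le> pi / 2" using h_le[of F w 0] arctan_ubound[of "F 0 w"] by linarith
    ultimately show ?thesis by linarith
  qed
  have h_meas: "h F \<in> borel_measurable M" if "range F \<subseteq> S" for F
  proof -
    have [measurable]: "F n \<in> borel_measurable M" for n using that S by auto
    show ?thesis unfolding h_def by measurable
  qed
  have h_int: "integrable M (h F)" if "range F \<subseteq> S" for F
    using h_bound h_meas[OF that] by (intro integrable_const_bound[of _ "pi / 2"]) auto
  have "- (pi / 2) \<le> J F" if "range F \<subseteq> S" for F
  proof -
    have "(\<integral>w. - (pi / 2) \<partial>M) \<le> J F"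
      unfolding J_def
    proof (rule integral_mono)
      show "- (pi / 2) \<le> h F w" for w using h_bound[of F w] by linarith
    qed (use h_int[OF that] in simp_all)
    then show ?thesis by (simp add: prob_space)
  qed
  then have bddJ: "bdd_below (J ` {F. range F \<subseteq> S})"
    by (intro bdd_belowI[of _ "- (pi / 2)"]) auto
  have c_le: "c \<le> J F" if "range F \<subseteq> S" for F
    unfolding c_def using bddJ that by (intro cINF_lower) auto
  have neF: "{F::nat \<Rightarrow> 'a \<Rightarrow> real. range F \<subseteq> S} \<noteq> {}"
    using ne by (auto intro!: exI[of _ "\<lambda>_. SOME f. f \<in> S"] some_in_eq[THEN iffD2])
  have "\<exists>F. range F \<subseteq> S \<and> J F < c + 1 / real (Suc k)" for k
    using cINF_less_iff[OF neF bddJ, of "c + 1 / real (Suc k)"] by (auto simp: c_def)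
  then obtain F where F: "range (F k) \<subseteq> S" "J (F k) < c + 1 / real (Suc k)" for k
    by metis
  \<comment> \<open>A minimizing sequence consists of countably many sequences in \<open>S\<close>;
    merging them into one attains the infimum \<open>c\<close>.\<close>
  define G where "G n = (case prod_decode n of (k, m) \<Rightarrow> F k m)" for n
  have G: "range G \<subseteq> S" using range_subsetD[OF F(1)] by (auto simp: G_def split: prod.splits)
  have GF: "h G w \<le> h (F k) w" for k w
    using h_le[of G w "prod_encode (k, n)" for n] by (intro h_ge) (simp add: G_def)
  have "J G \<le> J (F k)" for k
    unfolding J_def using GF h_int[OF G] h_int[OF F(1)] by (intro integral_mono) auto
  then have "J G \<le> c + 1 / real (Suc k)" for k using F(2)[of k] by (meson less_imp_le order_trans)
  moreover have "(\<lambda>k. c + 1 / real (Suc k)) \<longlonglongrightarrow> c + 0"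
    using LIMSEQ_inverse_real_of_nat by (intro tendsto_intros) (simp add: inverse_eq_divide)
  ultimately have JG: "J G \<le> c" by (auto intro: LIMSEQ_le_const)
  show ?thesis
  proof (rule that[OF G])
    fix f assume f: "f \<in> S"
    \<comment> \<open>Adjoining \<open>f\<close> cannot push the integral below \<open>c\<close>.
      Hence it leaves the infimum unchanged almost surely, which says that \<open>f\<close> lies
      above it.\<close>
    define G' where "G' = case_nat f G"
    have G': "range G' \<subseteq> S" using f range_subsetD[OF G] by (auto simp: G'_def split: nat.splits)
    have le: "h G' w \<le> h G w" for w
      using h_le[of G' w "Suc n" for n] by (intro h_ge) (simp add: G'_def)
    have "AE w in M. h G' w = h G w"
    proof (rule integral_ineq_eq_0_then_AE)
      show "AE w in M. h G' w \<le> h G w" using le by simp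
      show "integral\<^sup>L M (h G') = integral\<^sup>L M (h G)"
        using integral_mono[OF h_int[OF G'] h_int[OF G] le] JG c_le[OF G'] by (simp add: J_def)
    qed (use h_int G G' in auto)
    then show "AE w in M. \<forall>u. (\<forall>n. u \<le> G n w) \<longrightarrow> u \<le> f w"
    proof eventually_elim
      case (elim w)
      have "u \<le> f w" if "\<And>n. u \<le> G n w" for u
      proof -
        have "arctan u \<le> h G w" using that by (intro h_ge) (simp add: arctan_le_iff)
        also have "\<dots> \<le> arctan (f w)" using h_le[of G' w 0] elim by (simp add: G'_def)
        finally show ?thesis by (simp add: arctan_le_iff)
      qed
      then show ?case by blast
    qed
  qed
qed

text \<open>The last clause is the greatest lower bound property (\<open>t = 1\<close>,
  \<open>c = 0\<close>) together with its affine consequences. Having these built in lets scaled and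
  shifted estimates pass to the infimum directly, also on the event \<open>t = 0\<close> where
  dividing by \<open>t\<close> is impossible.\<close>

definition is_ess_inf :: "'w measure \<Rightarrow> ('w \<Rightarrow> real) set \<Rightarrow> ('w \<Rightarrow> real) \<Rightarrow> bool" where
  "is_ess_inf M S g \<longleftrightarrow> g \<in> borel_measurable M \<and> (\<forall>f\<in>S. AE w in M. g w \<le> f w) \<and>
     (\<forall>a t c. (\<forall>f\<in>S. AE w in M. a w \<le> t w * f w + c w) \<longrightarrow> (\<forall>w. 0 \<le> t w) \<longrightarrow>
        (AE w in M. a w \<le> t w * g w + c w))"

definition ess_inf :: "'w measure \<Rightarrow> ('w \<Rightarrow> real) set \<Rightarrow> 'w \<Rightarrow> real" where
  "ess_inf M S = (SOME g. is_ess_inf M S g)"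

text \<open>The pointwise infimum of the countable subfamily from \<open>ess_inf_sequence\<close> is
  a witness. The bound \<open>b\<close> makes it a genuine real infimum outside a single null set,
  since only countably many functions are involved.\<close>

lemma (in prob_space) is_ess_inf_ess_inf:
  assumes "S \<noteq> {}" "S \<subseteq> borel_measurable M" and b: "\<And>f. f \<in> S \<Longrightarrow> AE w in M. b w \<le> f w"
  shows "is_ess_inf M S (ess_inf M S)"
proof -
  obtain F :: "nat \<Rightarrow> 'a \<Rightarrow> real" where F: "range F \<subseteq> S"
    "\<And>f. f \<in> S \<Longrightarrow> AE w in M. \<forall>u. (\<forall>n. u \<le> F n w) \<longrightarrow> u \<le> f w"
    using ess_inf_sequence[OF assms(1,2)] by blast
  define g where "g w = (INF n. F n w)" for w
  have [measurable]: "F n \<in> borel_measurable M" for n using F(1) assms(2) by auto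
  have "AE w in M. \<forall>n. b w \<le> F n w" using b F(1) by (auto simp: AE_all_countable)
  then have bdd: "AE w in M. bdd_below (range (\<lambda>n. F n w))"
    by eventually_elim (auto intro: bdd_belowI)
  have "is_ess_inf M S g"
    unfolding is_ess_inf_def
  proof (intro conjI allI impI ballI)
    show "g \<in> borel_measurable M" unfolding g_def by measurable
    show "AE w in M. g w \<le> f w" if "f \<in> S" for f
      using bdd F(2)[OF that]
    proof eventually_elim
      case (elim w)
      then have "g w \<le> F n w" for n unfolding g_def by (intro cINF_lower) auto
      then show ?case using elim by blast
    qed
    show "AE w in M. a w \<le> t w * g w + c w"
      if "\<forall>f\<in>S. AE w in M. a w \<le> t w * f w + c w" "\<forall>w. 0 \<le> t w" for a t c
    proof -
      have "AE w in M. \<forall>n. a w \<le> t w * F n w + c w"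
        using that range_subsetD[OF F(1)] by (simp add: AE_all_countable)
      then show ?thesis
      proof eventually_elim
        case (elim w)
        show ?case
        proof (cases "t w = 0")
          case True
          then show ?thesis using elim by simp
        next
          case False
          then have t: "0 < t w" using that(2) by (simp add: order.strict_iff_order)
          have "(a w - c w) / t w \<le> F n w" for n
            using elim[rule_format, of n] t by (simp add: divide_le_eq algebra_simps)
          then have "(a w - c w) / t w \<le> g w" unfolding g_def by (intro cINF_greatest) auto
          then show ?thesis using t by (simp add: divide_le_eq algebra_simps)
        qed
      qed
    qed
  qed
  then show ?thesis unfolding ess_inf_def by (rule someI[where P = "is_ess_inf M S"])
qed

lemma (in prob_space)
  assumes "S \<noteq> {}" "S \<subseteq> borel_measurable M" "\<And>f. f \<in> S \<Longrightarrow> AE w in M. b w \<le> f w"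
  shows ess_inf_measurable: "ess_inf M S \<in> borel_measurable M"
    and ess_inf_lower: "f \<in> S \<Longrightarrow> AE w in M. ess_inf M S w \<le> f w"
    and ess_inf_greatest:
      "(\<And>f. f \<in> S \<Longrightarrow> AE w in M. a w \<le> t w * f w + c w) \<Longrightarrow> (\<And>w. 0 \<le> t w) \<Longrightarrow>
         AE w in M. a w \<le> t w * ess_inf M S w + c w"
  using is_ess_inf_ess_inf[OF assms] by (auto simp: is_ess_inf_def)


section \<open>Scalars\<close>

text \<open>Over the reals \<open>j = 0\<close>, over the complex numbers \<open>j\<close> is an imaginary unit. In both cases a
  real-linear functional \<open>f\<close> gives rise to the linear functional \<open>f x - j f (j x)\<close>.\<close>

lemma real_or_complex_real_part:
  obtains re :: "'k::real_or_complex \<Rightarrow> real" and j :: 'k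
  where "linear re" "\<And>z. \<bar>re z\<bar> \<le> norm z" "\<And>z. z = of_real (re z) - j * of_real (re (j * z))"
    "\<And>a. re (of_real a) = a" "\<And>a. re (j * of_real a) = 0" "j * j = - 1 \<or> j = 0"
proof (cases "\<forall>z::'k. \<exists>a. z = a *\<^sub>R 1")
  case True
  then obtain re where re: "\<And>z::'k. z = of_real (re z)" by (metis of_real_def)
  have [simp]: "re (of_real a) = a" for a using re[of "of_real a"] by (simp add: of_real_eq_iff)
  show ?thesis
  proof (rule that[of re 0])
    show "linear re"
    proof (rule linearI)
      show "re (x + y) = re x + re y" for x y
        using re by (metis of_real_add of_real_eq_iff)
      show "re (r *\<^sub>R x) = r *\<^sub>R re x" for r x
        using re by (metis of_real_mult of_real_eq_iff real_scaleR_def scaleR_conv_of_real)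
    qed
    show "\<bar>re z\<bar> \<le> norm z" for z using re by (metis norm_of_real order_refl)
    have "re 0 = 0" using \<open>re (of_real 0) = 0\<close> by simp
    then show "re (0 * of_real a) = 0" for a by simp
  qed (use re in auto)
next
  case False
  then obtain i :: 'k where i: "i * i = - 1"
    and "\<forall>z. \<exists>a b. z = a *\<^sub>R 1 + b *\<^sub>R i \<and> norm z = sqrt (a\<^sup>2 + b\<^sup>2)"
    using real_or_complex by blast
  then obtain re im where d: "\<And>z::'k. z = re z *\<^sub>R 1 + im z *\<^sub>R i"
      "\<And>z. norm z = sqrt ((re z)\<^sup>2 + (im z)\<^sup>2)"
    by metis
  \<comment> \<open>Squaring \<open>a = - b i\<close> gives \<open>a * a + b * b = 0\<close>, so 1
    and \<open>i\<close> are linearly independent over the reals. Therefore \<open>re\<close> and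
    \<open>im\<close>, which were merely chosen, are the coordinates.\<close>
  have 0: "a = 0 \<and> b = 0" if "a *\<^sub>R 1 + b *\<^sub>R i = 0" for a b
  proof -
    have "a *\<^sub>R 1 = (- b) *\<^sub>R i" using that by (simp add: eq_neg_iff_add_eq_0)
    then have "(a *\<^sub>R 1) * (a *\<^sub>R 1) = ((- b) *\<^sub>R i) * ((- b) *\<^sub>R i)" by simp
    then have "(a * a + b * b) *\<^sub>R (1::'k) = 0" by (simp add: i scaleR_add_left)
    then have "a * a + b * b = 0" by simp
    then show ?thesis by (simp add: sum_squares_eq_zero_iff)
  qed
  have u: "re (a *\<^sub>R 1 + b *\<^sub>R i) = a" "im (a *\<^sub>R 1 + b *\<^sub>R i) = b" for a b
  proof -
    let ?z = "a *\<^sub>R 1 + b *\<^sub>R i"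
    have "(re ?z - a) *\<^sub>R 1 + (im ?z - b) *\<^sub>R i = 0" using d(1)[of ?z] by (simp add: algebra_simps)
    then show "re ?z = a" "im ?z = b" using 0 by fastforce+
  qed
  show ?thesis
  proof (rule that[of re i])
    show "linear re"
    proof (rule linearI)
      fix x y r
      have "x + y = (re x + re y) *\<^sub>R 1 + (im x + im y) *\<^sub>R i"
        using d(1)[of x] d(1)[of y] by (simp add: algebra_simps)
      then show "re (x + y) = re x + re y" using u(1) by metis
      have "r *\<^sub>R x = (r * re x) *\<^sub>R 1 + (r * im x) *\<^sub>R i"
        using arg_cong[OF d(1)[of x], of "scaleR r"] by (simp add: scaleR_add_right)
      then show "re (r *\<^sub>R x) = r *\<^sub>R re x" using u(1) by (metis real_scaleR_def)
    qed
    show "\<bar>re z\<bar> \<le> norm z" for z by (simp add: d(2)[of z])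
    show "z = of_real (re z) - i * of_real (re (i * z))" for z
    proof -
      have "i * z = (- im z) *\<^sub>R 1 + re z *\<^sub>R i"
        using arg_cong[OF d(1)[of z], of "(*) i"] i by (simp add: distrib_left)
      then have "re (i * z) = - im z" using u(1) by metis
      then show ?thesis using d(1)[of z] by (simp add: of_real_def)
    qed
    show "re (of_real a) = a" for a using u(1)[of a 0] by (simp add: of_real_def)
    show "re (i * of_real a) = 0" for a using u(1)[of 0 a] by (simp add: of_real_def)
  qed (use i in simp)
qed


section \<open>Modules over the random variables\<close>

locale random_module = prob_space M + Module.module "L0 M" X
  for M :: "'w measure"
    and X :: "(('w \<Rightarrow> 'k::{real_normed_field,second_countable_topology}) set, 'x, 'm) module_scheme"
begin

text \<open>Letting functions act in place of their classes keeps all computations on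
  representatives, where they are pointwise.\<close>

definition scale :: "('w \<Rightarrow> 'k) \<Rightarrow> 'x \<Rightarrow> 'x"  (infixr "\<cdot>" 75)
  where "f \<cdot> x = AE_class M f \<odot>\<^bsub>X\<^esub> x"

abbreviation rscale :: "('w \<Rightarrow> real) \<Rightarrow> 'x \<Rightarrow> 'x"  (infixr "\<cdot>\<^sub>R" 75)
  where "t \<cdot>\<^sub>R x \<equiv> (\<lambda>w. of_real (t w)) \<cdot> x"

lemma class_carrier [simp]: "f \<in> borel_measurable M \<Longrightarrow> AE_class M f \<in> carrier (L0 M)"
  by (auto simp: L0_carrier_iff)

lemma scale_closed [simp]: "f \<in> borel_measurable M \<Longrightarrow> x \<in> carrier X \<Longrightarrow> f \<cdot> x \<in> carrier X"
  by (simp add: scale_def)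

lemma scale_add_right:
  "f \<in> borel_measurable M \<Longrightarrow> x \<in> carrier X \<Longrightarrow> y \<in> carrier X \<Longrightarrow>
    f \<cdot> (x \<oplus>\<^bsub>X\<^esub> y) = f \<cdot> x \<oplus>\<^bsub>X\<^esub> f \<cdot> y"
  by (simp add: scale_def smult_r_distr)

lemma scale_add_left:
  "f \<in> borel_measurable M \<Longrightarrow> g \<in> borel_measurable M \<Longrightarrow> x \<in> carrier X \<Longrightarrow>
    (\<lambda>w. f w + g w) \<cdot> x = f \<cdot> x \<oplus>\<^bsub>X\<^esub> g \<cdot> x"
  by (simp add: scale_def smult_l_distr flip: L0_add_class)

lemma scale_scale:
  "f \<in> borel_measurable M \<Longrightarrow> g \<in> borel_measurable M \<Longrightarrow> x \<in> carrier X \<Longrightarrow>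
    f \<cdot> g \<cdot> x = (\<lambda>w. f w * g w) \<cdot> x"
  by (simp add: scale_def smult_assoc1 flip: L0_mult_class)

lemma scale_one [simp]: "x \<in> carrier X \<Longrightarrow> (\<lambda>_. 1) \<cdot> x = x"
  using smult_one by (simp add: scale_def L0_one)

lemma scale_zero [simp]: "x \<in> carrier X \<Longrightarrow> (\<lambda>_. 0) \<cdot> x = \<zero>\<^bsub>X\<^esub>"
  using smult_l_null by (simp add: scale_def L0_zero)

lemma scale_cong:
  "f \<in> borel_measurable M \<Longrightarrow> g \<in> borel_measurable M \<Longrightarrow> (AE w in M. f w = g w) \<Longrightarrow> f \<cdot> x = g \<cdot> x"
  unfolding scale_def by (metis AE_class_eq_iff)

lemma add_scale_minus_one: "x \<in> carrier X \<Longrightarrow> x \<oplus>\<^bsub>X\<^esub> (\<lambda>_. - 1) \<cdot> x = \<zero>\<^bsub>X\<^esub>"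
  using scale_add_left[of "\<lambda>_. 1" "\<lambda>_. - 1" x] by simp


section \<open>Sublinear functionals and the Hahn--Banach theorem\<close>

text \<open>Homogeneity is demanded as an inequality because that form passes to essential infima;
  equality is recovered in \<open>sublinear_scale\<close>.\<close>

definition sublinear :: "('x \<Rightarrow> 'w \<Rightarrow> real) \<Rightarrow> bool" where
  "sublinear \<phi> \<longleftrightarrow> (\<forall>x\<in>carrier X. \<phi> x \<in> borel_measurable M) \<and>
     (\<forall>x\<in>carrier X. \<forall>y\<in>carrier X. AE w in M. \<phi> (x \<oplus>\<^bsub>X\<^esub> y) w \<le> \<phi> x w + \<phi> y w) \<and>
     (\<forall>t\<in>borel_measurable M. \<forall>x\<in>carrier X. (\<forall>w. 0 \<le> t w) \<longrightarrow>
        (AE w in M. \<phi> (t \<cdot>\<^sub>R x) w \<le> t w * \<phi> x w))"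

lemma sublinear_measurable: "sublinear \<phi> \<Longrightarrow> x \<in> carrier X \<Longrightarrow> \<phi> x \<in> borel_measurable M"
  by (simp add: sublinear_def)

lemma sublinear_add:
  "sublinear \<phi> \<Longrightarrow> x \<in> carrier X \<Longrightarrow> y \<in> carrier X \<Longrightarrow>
    AE w in M. \<phi> (x \<oplus>\<^bsub>X\<^esub> y) w \<le> \<phi> x w + \<phi> y w"
  by (simp add: sublinear_def)

lemma sublinear_scale_le:
  "sublinear \<phi> \<Longrightarrow> t \<in> borel_measurable M \<Longrightarrow> x \<in> carrier X \<Longrightarrow> (\<And>w. 0 \<le> t w) \<Longrightarrow>
    AE w in M. \<phi> (t \<cdot>\<^sub>R x) w \<le> t w * \<phi> x w"
  by (simp add: sublinear_def)

lemma sublinear_zero: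
  assumes "sublinear \<phi>" shows "AE w in M. \<phi> \<zero>\<^bsub>X\<^esub> w = 0"
proof -
  have "AE w in M. \<phi> \<zero>\<^bsub>X\<^esub> w \<le> 0"
    using sublinear_scale_le[OF assms, of "\<lambda>_. 0" "\<zero>\<^bsub>X\<^esub>"] by simp
  moreover have "AE w in M. \<phi> \<zero>\<^bsub>X\<^esub> w \<le> \<phi> \<zero>\<^bsub>X\<^esub> w + \<phi> \<zero>\<^bsub>X\<^esub> w"
    using sublinear_add[OF assms, of "\<zero>\<^bsub>X\<^esub>" "\<zero>\<^bsub>X\<^esub>"] by simp
  ultimately show ?thesis by eventually_elim simp
qed

lemma sublinear_minus:
  assumes "sublinear \<phi>" "x \<in> carrier X"
  shows "AE w in M. - \<phi> ((\<lambda>_. - 1) \<cdot> x) w \<le> \<phi> x w"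
proof -
  have "AE w in M. \<phi> \<zero>\<^bsub>X\<^esub> w \<le> \<phi> x w + \<phi> ((\<lambda>_. - 1) \<cdot> x) w"
    using sublinear_add[of \<phi> x "(\<lambda>_. - 1) \<cdot> x"] assms by (simp add: add_scale_minus_one)
  with sublinear_zero[OF assms(1)] show ?thesis by eventually_elim simp
qed

text \<open>The reverse inequality holds because \<open>t\<close> is invertible on the event \<open>t > 0\<close>.\<close>

lemma sublinear_scale:
  assumes \<phi>: "sublinear \<phi>" and t [measurable]: "t \<in> borel_measurable M" and x: "x \<in> carrier X"
    and t0: "\<And>w. 0 \<le> t w"
  shows "AE w in M. \<phi> (t \<cdot>\<^sub>R x) w = t w * \<phi> x w"
proof -
  \<comment> \<open>Since \<open>inverse 0 = 0\<close>, the product \<open>s * t\<close> is the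
    indicator \<open>b\<close> of the event \<open>t \<noteq> 0\<close>, and \<open>c\<close> is the
    complementary indicator. The vector \<open>x\<close> splits as \<open>b x + c x\<close>; scaling
    \<open>t x\<close> by \<open>s\<close> recovers the first part, and the second contributes only
    where \<open>t\<close> vanishes.\<close>
  define s where "s w = inverse (t w)" for w
  define b c where "b w = (if t w = 0 then 0 else 1 :: real)"
    and "c w = (if t w = 0 then 1 else 0 :: real)" for w
  have [measurable]: "s \<in> borel_measurable M" "b \<in> borel_measurable M" "c \<in> borel_measurable M"
    unfolding s_def b_def c_def by measurable
  have st: "(\<lambda>w. of_real (s w) * of_real (t w) :: 'k) = (\<lambda>w. of_real (b w))"
    and ct: "(\<lambda>w. of_real (c w) * of_real (t w) :: 'k) = (\<lambda>_. 0)"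
    and bc: "(\<lambda>w. of_real (b w) + of_real (c w) :: 'k) = (\<lambda>_. 1)"
    by (auto simp: s_def b_def c_def fun_eq_iff simp flip: of_real_mult of_real_inverse)
  have "AE w in M. \<phi> (b \<cdot>\<^sub>R x) w \<le> s w * \<phi> (t \<cdot>\<^sub>R x) w"
    using sublinear_scale_le[OF \<phi>, of s "t \<cdot>\<^sub>R x"] x t0 by (simp add: scale_scale st) (simp add: s_def)
  moreover have "AE w in M. \<phi> \<zero>\<^bsub>X\<^esub> w \<le> c w * \<phi> (t \<cdot>\<^sub>R x) w"
    using sublinear_scale_le[OF \<phi>, of c "t \<cdot>\<^sub>R x"] x by (simp add: scale_scale ct) (simp add: c_def)
  moreover have "AE w in M. \<phi> x w \<le> \<phi> (b \<cdot>\<^sub>R x) w + \<phi> (c \<cdot>\<^sub>R x) w"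
    using sublinear_add[OF \<phi>, of "b \<cdot>\<^sub>R x" "c \<cdot>\<^sub>R x"] x by (simp add: bc flip: scale_add_left)
  moreover have "AE w in M. \<phi> (c \<cdot>\<^sub>R x) w \<le> c w * \<phi> x w"
    using x by (intro sublinear_scale_le[OF \<phi>]) (auto simp: c_def)
  moreover note sublinear_scale_le[OF \<phi> t x t0] sublinear_zero[OF \<phi>]
  ultimately show ?thesis
  proof eventually_elim
    case (elim w)
    show ?case
    proof (cases "t w = 0")
      case True
      then show ?thesis using elim by (simp add: c_def)
    next
      case False
      then have "0 < t w" using t0[of w] by linarith
      moreover have "\<phi> x w \<le> inverse (t w) * \<phi> (t \<cdot>\<^sub>R x) w"
        using elim False by (simp add: c_def s_def)
      ultimately have "t w * \<phi> x w \<le> \<phi> (t \<cdot>\<^sub>R x) w" by (simp add: field_simps)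
      then show ?thesis using elim by simp
    qed
  qed
qed

text \<open>Subtracting from \<open>\<phi>\<close> the contribution of the direction \<open>z\<close>: the result is a smaller
  sublinear functional, and it coincides with \<open>\<phi>\<close> only if \<open>\<phi>\<close> is additive along \<open>z\<close>.\<close>

definition directional :: "('x \<Rightarrow> 'w \<Rightarrow> real) \<Rightarrow> 'x \<Rightarrow> 'x \<Rightarrow> 'w \<Rightarrow> real" where
  "directional \<phi> z x =
     ess_inf M {\<lambda>w. \<phi> (x \<oplus>\<^bsub>X\<^esub> t \<cdot>\<^sub>R z) w - t w * \<phi> z w |t. t \<in> borel_measurable M \<and> (\<forall>w. 0 \<le> t w)}"

context
  fixes \<phi> z
  assumes \<phi>: "sublinear \<phi>" and z: "z \<in> carrier X"
begin

text \<open>This lower bound, independent of \<open>t\<close>, makes the essential infimum defining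
  \<open>directional\<close> exist. It follows by writing \<open>t z\<close> as the sum of
  \<open>x + t z\<close> and \<open>- x\<close>.\<close>

lemma directional_bound:
  assumes x: "x \<in> carrier X" and [measurable]: "t \<in> borel_measurable M" and t0: "\<And>w. 0 \<le> t w"
  shows "AE w in M. - \<phi> ((\<lambda>_. - 1) \<cdot> x) w \<le> \<phi> (x \<oplus>\<^bsub>X\<^esub> t \<cdot>\<^sub>R z) w - t w * \<phi> z w"
proof -
  let ?m = "(\<lambda>_. - 1) \<cdot> x"
  have eq: "(x \<oplus>\<^bsub>X\<^esub> t \<cdot>\<^sub>R z) \<oplus>\<^bsub>X\<^esub> ?m = t \<cdot>\<^sub>R z"
  proof -
    have "(x \<oplus>\<^bsub>X\<^esub> t \<cdot>\<^sub>R z) \<oplus>\<^bsub>X\<^esub> ?m = (x \<oplus>\<^bsub>X\<^esub> ?m) \<oplus>\<^bsub>X\<^esub> t \<cdot>\<^sub>R z"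
      using x z by (simp add: M.a_ac)
    then show ?thesis using x z by (simp add: add_scale_minus_one)
  qed
  have "AE w in M. \<phi> (t \<cdot>\<^sub>R z) w \<le> \<phi> (x \<oplus>\<^bsub>X\<^esub> t \<cdot>\<^sub>R z) w + \<phi> ?m w"
    using sublinear_add[OF \<phi>, of "x \<oplus>\<^bsub>X\<^esub> t \<cdot>\<^sub>R z" ?m] x z by (simp add: eq)
  moreover have "AE w in M. \<phi> (t \<cdot>\<^sub>R z) w = t w * \<phi> z w"
    using z t0 by (intro sublinear_scale[OF \<phi>]) auto
  ultimately show ?thesis by eventually_elim simp
qed

lemma
  assumes x: "x \<in> carrier X"
  shows directional_measurable: "directional \<phi> z x \<in> borel_measurable M"
    and directional_lower: "t \<in> borel_measurable M \<Longrightarrow> (\<And>w. 0 \<le> t w) \<Longrightarrow>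
      AE w in M. directional \<phi> z x w \<le> \<phi> (x \<oplus>\<^bsub>X\<^esub> t \<cdot>\<^sub>R z) w - t w * \<phi> z w"
    and directional_greatest: "(\<And>t. t \<in> borel_measurable M \<Longrightarrow> (\<And>w. 0 \<le> t w) \<Longrightarrow>
        AE w in M. a w \<le> s w * (\<phi> (x \<oplus>\<^bsub>X\<^esub> t \<cdot>\<^sub>R z) w - t w * \<phi> z w) + c w) \<Longrightarrow> (\<And>w. 0 \<le> s w) \<Longrightarrow>
      AE w in M. a w \<le> s w * directional \<phi> z x w + c w"
proof -
  let ?S = "{\<lambda>w. \<phi> (x \<oplus>\<^bsub>X\<^esub> t \<cdot>\<^sub>R z) w - t w * \<phi> z w |t. t \<in> borel_measurable M \<and> (\<forall>w. 0 \<le> t w)}"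
  have "(\<lambda>_. 0 :: real) \<in> borel_measurable M" by simp
  then have ne: "?S \<noteq> {}" by fastforce
  have meas: "?S \<subseteq> borel_measurable M"
    using sublinear_measurable[OF \<phi>] x z by auto
  have bd: "AE w in M. - \<phi> ((\<lambda>_. - 1) \<cdot> x) w \<le> f w" if "f \<in> ?S" for f
    using that directional_bound[OF x] by auto
  show "directional \<phi> z x \<in> borel_measurable M"
    unfolding directional_def by (rule ess_inf_measurable[OF ne meas bd])
  show "AE w in M. directional \<phi> z x w \<le> \<phi> (x \<oplus>\<^bsub>X\<^esub> t \<cdot>\<^sub>R z) w - t w * \<phi> z w"
    if "t \<in> borel_measurable M" "\<And>w. 0 \<le> t w"
    unfolding directional_def using that by (intro ess_inf_lower[OF ne meas bd]) auto
  show "AE w in M. a w \<le> s w * directional \<phi> z x w + c w"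
    if "\<And>t. t \<in> borel_measurable M \<Longrightarrow> (\<And>w. 0 \<le> t w) \<Longrightarrow>
        AE w in M. a w \<le> s w * (\<phi> (x \<oplus>\<^bsub>X\<^esub> t \<cdot>\<^sub>R z) w - t w * \<phi> z w) + c w" "\<And>w. 0 \<le> s w"
    unfolding directional_def using that by (intro ess_inf_greatest[OF ne meas bd]) auto
qed

lemma sublinear_directional: "sublinear (directional \<phi> z)"
  unfolding sublinear_def
proof (intro conjI ballI impI)
  fix x assume x: "x \<in> carrier X"
  show "directional \<phi> z x \<in> borel_measurable M" by (rule directional_measurable[OF x])
next
  fix x y assume x: "x \<in> carrier X" and y: "y \<in> carrier X"
  have xy: "x \<oplus>\<^bsub>X\<^esub> y \<in> carrier X" using x y by simp
  let ?D = "directional \<phi> z (x \<oplus>\<^bsub>X\<^esub> y)"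
  let ?u = "\<lambda>x t w. \<phi> (x \<oplus>\<^bsub>X\<^esub> t \<cdot>\<^sub>R z) w - t w * \<phi> z w"
  \<comment> \<open>The multiples \<open>s\<close> for \<open>x\<close> and \<open>t\<close> for
    \<open>y\<close> are combined to the multiple \<open>s + t\<close> for \<open>x + y\<close>.
    Afterwards the infimum is taken over \<open>s\<close> with \<open>t\<close> fixed, then over
    \<open>t\<close>.\<close>
  have 1: "AE w in M. ?D w \<le> 1 * ?u x s w + ?u y t w"
    if [measurable]: "s \<in> borel_measurable M" "t \<in> borel_measurable M"
      and 0: "\<And>w. 0 \<le> s w" "\<And>w. 0 \<le> t w" for s t
  proof -
    have "(\<lambda>w. of_real (s w + t w)) \<cdot> z = s \<cdot>\<^sub>R z \<oplus>\<^bsub>X\<^esub> t \<cdot>\<^sub>R z" using z by (simp add: scale_add_left)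
    then have eq: "(x \<oplus>\<^bsub>X\<^esub> y) \<oplus>\<^bsub>X\<^esub> (\<lambda>w. s w + t w) \<cdot>\<^sub>R z
        = (x \<oplus>\<^bsub>X\<^esub> s \<cdot>\<^sub>R z) \<oplus>\<^bsub>X\<^esub> (y \<oplus>\<^bsub>X\<^esub> t \<cdot>\<^sub>R z)"
      using x y z by (simp add: M.a_ac)
    have "AE w in M. ?D w \<le> ?u (x \<oplus>\<^bsub>X\<^esub> y) (\<lambda>w. s w + t w) w"
      using 0 by (intro directional_lower[OF xy]) (auto intro: add_nonneg_nonneg)
    moreover have "AE w in M. \<phi> ((x \<oplus>\<^bsub>X\<^esub> y) \<oplus>\<^bsub>X\<^esub> (\<lambda>w. s w + t w) \<cdot>\<^sub>R z) w
        \<le> \<phi> (x \<oplus>\<^bsub>X\<^esub> s \<cdot>\<^sub>R z) w + \<phi> (y \<oplus>\<^bsub>X\<^esub> t \<cdot>\<^sub>R z) w"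
      unfolding eq using x y z by (intro sublinear_add[OF \<phi>]) auto
    ultimately show ?thesis by eventually_elim (simp add: algebra_simps)
  qed
  have 2: "AE w in M. ?D w \<le> 1 * ?u y t w + directional \<phi> z x w"
    if "t \<in> borel_measurable M" "\<And>w. 0 \<le> t w" for t
    using directional_greatest[OF x, of ?D "\<lambda>_. 1" "?u y t"] 1 that by (simp add: add.commute)
  show "AE w in M. ?D w \<le> directional \<phi> z x w + directional \<phi> z y w"
    using directional_greatest[OF y, of ?D "\<lambda>_. 1" "directional \<phi> z x"] 2 by (simp add: add.commute)
next
  fix r :: "'w \<Rightarrow> real" and x
  assume r [measurable]: "r \<in> borel_measurable M" and x: "x \<in> carrier X" and "\<forall>w. 0 \<le> r w"
  then have r0: "0 \<le> r w" for w by simp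
  have "AE w in M. directional \<phi> z (r \<cdot>\<^sub>R x) w \<le> r w * (\<phi> (x \<oplus>\<^bsub>X\<^esub> t \<cdot>\<^sub>R z) w - t w * \<phi> z w) + 0"
    if [measurable]: "t \<in> borel_measurable M" and t0: "\<And>w. 0 \<le> t w" for t
  proof -
    \<comment> \<open>The multiple \<open>t\<close> admissible for \<open>x\<close> becomes the
      multiple \<open>r * t\<close> admissible for \<open>r x\<close>.\<close>
    have eq: "r \<cdot>\<^sub>R x \<oplus>\<^bsub>X\<^esub> (\<lambda>w. r w * t w) \<cdot>\<^sub>R z = r \<cdot>\<^sub>R (x \<oplus>\<^bsub>X\<^esub> t \<cdot>\<^sub>R z)"
      using x z by (simp add: scale_add_right scale_scale)
    have "AE w in M. directional \<phi> z (r \<cdot>\<^sub>R x) w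
        \<le> \<phi> (r \<cdot>\<^sub>R x \<oplus>\<^bsub>X\<^esub> (\<lambda>w. r w * t w) \<cdot>\<^sub>R z) w - r w * t w * \<phi> z w"
      using x r0 t0 by (intro directional_lower) auto
    moreover have "AE w in M. \<phi> (r \<cdot>\<^sub>R x \<oplus>\<^bsub>X\<^esub> (\<lambda>w. r w * t w) \<cdot>\<^sub>R z) w \<le> r w * \<phi> (x \<oplus>\<^bsub>X\<^esub> t \<cdot>\<^sub>R z) w"
      unfolding eq using x z r0 by (intro sublinear_scale_le[OF \<phi>]) auto
    ultimately show ?thesis by eventually_elim (simp add: algebra_simps)
  qed
  then show "AE w in M. directional \<phi> z (r \<cdot>\<^sub>R x) w \<le> r w * directional \<phi> z x w"
    using directional_greatest[OF x, of "directional \<phi> z (r \<cdot>\<^sub>R x)" r "\<lambda>_. 0"] r0 by simp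
qed

lemma directional_le: "x \<in> carrier X \<Longrightarrow> AE w in M. directional \<phi> z x w \<le> \<phi> x w"
  using directional_lower[of x "\<lambda>_. 0"] z by simp

lemma directional_le_diff:
  "x \<in> carrier X \<Longrightarrow> AE w in M. directional \<phi> z x w \<le> \<phi> (x \<oplus>\<^bsub>X\<^esub> z) w - \<phi> z w"
  using directional_lower[of x "\<lambda>_. 1"] z by simp

end

text \<open>The essential infimum is formed separately at each vector; \<open>b\<close> keeps it
  finite. An infimum of sublinear functionals need not be subadditive in general: here the chain
  condition is what allows one member to serve for both summands.\<close>

lemma sublinear_chain_infimum:
  assumes ne: "C \<noteq> {}" and sub: "\<And>\<phi>. \<phi> \<in> C \<Longrightarrow> sublinear \<phi>"
    and bound: "\<And>\<phi> x. \<phi> \<in> C \<Longrightarrow> x \<in> carrier X \<Longrightarrow> AE w in M. b x w \<le> \<phi> x w"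
    and chain: "\<And>\<phi> \<psi>. \<phi> \<in> C \<Longrightarrow> \<psi> \<in> C \<Longrightarrow>
      (\<forall>x\<in>carrier X. AE w in M. \<phi> x w \<le> \<psi> x w) \<or> (\<forall>x\<in>carrier X. AE w in M. \<psi> x w \<le> \<phi> x w)"
  obtains \<rho> where "sublinear \<rho>" "\<And>\<phi> x. \<phi> \<in> C \<Longrightarrow> x \<in> carrier X \<Longrightarrow> AE w in M. \<rho> x w \<le> \<phi> x w"
proof -
  define \<rho> where "\<rho> x = ess_inf M ((\<lambda>\<phi>. \<phi> x) ` C)" for x
  have neS: "(\<lambda>\<phi>. \<phi> x) ` C \<noteq> {}" for x using ne by simp
  have meas: "(\<lambda>\<phi>. \<phi> x) ` C \<subseteq> borel_measurable M" if "x \<in> carrier X" for x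
    using sublinear_measurable sub that by auto
  have bd: "AE w in M. b x w \<le> f w" if "x \<in> carrier X" "f \<in> (\<lambda>\<phi>. \<phi> x) ` C" for x f
    using bound that by auto
  note ei = neS meas bd
  have lower: "AE w in M. \<rho> x w \<le> \<phi> x w" if "\<phi> \<in> C" "x \<in> carrier X" for \<phi> x
    unfolding \<rho>_def using that by (intro ess_inf_lower[OF ei]) auto
  have greatest: "AE w in M. a w \<le> s w * \<rho> x w + c w"
    if "\<And>\<phi>. \<phi> \<in> C \<Longrightarrow> AE w in M. a w \<le> s w * \<phi> x w + c w" "\<And>w. 0 \<le> s w" "x \<in> carrier X" for a s c x
    unfolding \<rho>_def using that by (intro ess_inf_greatest[OF ei]) auto
  have "sublinear \<rho>"
    unfolding sublinear_def
  proof (intro conjI ballI impI)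
    show "\<rho> x \<in> borel_measurable M" if "x \<in> carrier X" for x
      unfolding \<rho>_def using that by (intro ess_inf_measurable[OF ei]) auto
  next
    fix x y assume x: "x \<in> carrier X" and y: "y \<in> carrier X"
    let ?D = "\<rho> (x \<oplus>\<^bsub>X\<^esub> y)"
    have 1: "AE w in M. ?D w \<le> \<phi> x w + \<psi> y w" if \<phi>: "\<phi> \<in> C" and \<psi>: "\<psi> \<in> C" for \<phi> \<psi>
    proof -
      \<comment> \<open>The smaller of the two functionals serves as \<open>\<xi>\<close>. Its own
        subadditivity bounds the infimum at \<open>x + y\<close>.\<close>
      obtain \<xi> where \<xi>: "\<xi> \<in> C" "AE w in M. \<xi> x w \<le> \<phi> x w" "AE w in M. \<xi> y w \<le> \<psi> y w"
      proof (cases "\<forall>x\<in>carrier X. AE w in M. \<phi> x w \<le> \<psi> x w")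
        case True
        then show ?thesis using that[of \<phi>] \<phi> y by simp
      next
        case False
        then have "\<forall>x\<in>carrier X. AE w in M. \<psi> x w \<le> \<phi> x w" using chain[OF \<phi> \<psi>] by blast
        then show ?thesis using that[of \<psi>] \<psi> x by simp
      qed
      have "x \<oplus>\<^bsub>X\<^esub> y \<in> carrier X" using x y by simp
      with \<xi> sublinear_add[OF sub[OF \<xi>(1)] x y] lower[OF \<xi>(1), of "x \<oplus>\<^bsub>X\<^esub> y"]
      show ?thesis by (auto elim: eventually_elim2[rotated])
    qed
    have 2: "AE w in M. ?D w \<le> 1 * \<rho> x w + \<psi> y w" if "\<psi> \<in> C" for \<psi>
      using x that 1 by (intro greatest) auto
    have "AE w in M. ?D w \<le> 1 * \<rho> y w + \<rho> x w"
      using y 2 by (intro greatest) (auto simp: add.commute)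
    then show "AE w in M. ?D w \<le> \<rho> x w + \<rho> y w" by (simp add: add.commute)
  next
    fix r :: "'w \<Rightarrow> real" and x
    assume r [measurable]: "r \<in> borel_measurable M" and x: "x \<in> carrier X" and "\<forall>w. 0 \<le> r w"
    then have r0: "0 \<le> r w" for w by simp
    have rx: "r \<cdot>\<^sub>R x \<in> carrier X" using x by simp
    have "AE w in M. \<rho> (r \<cdot>\<^sub>R x) w \<le> r w * \<phi> x w + 0" if \<phi>: "\<phi> \<in> C" for \<phi>
      using lower[OF \<phi> rx] sublinear_scale_le[OF sub[OF \<phi>] r x r0] by eventually_elim simp
    then have "AE w in M. \<rho> (r \<cdot>\<^sub>R x) w \<le> r w * \<rho> x w + 0" using x r0 by (intro greatest) auto
    then show "AE w in M. \<rho> (r \<cdot>\<^sub>R x) w \<le> r w * \<rho> x w" by simp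
  qed
  then show ?thesis using lower that by blast
qed

text \<open>Zorn's lemma is applied to epigraphs, since almost sure domination is only a preorder on
  functionals.\<close>

lemma minimal_sublinear:
  assumes q: "sublinear q"
  obtains \<phi> where "sublinear \<phi>" "\<And>x. x \<in> carrier X \<Longrightarrow> AE w in M. \<phi> x w \<le> q x w"
    "\<And>\<psi>. sublinear \<psi> \<Longrightarrow> \<forall>x\<in>carrier X. AE w in M. \<psi> x w \<le> \<phi> x w \<Longrightarrow>
      \<forall>x\<in>carrier X. AE w in M. \<phi> x w \<le> \<psi> x w"
proof -
  define le where "le \<phi> \<psi> \<longleftrightarrow> (\<forall>x\<in>carrier X. AE w in M. \<phi> x w \<le> \<psi> x w)" for \<phi> \<psi> :: "'x \<Rightarrow> 'w \<Rightarrow> real"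
  define epi where "epi \<phi> = {(x, f). x \<in> carrier X \<and> (AE w in M. \<phi> x w \<le> f w)}"
    for \<phi> :: "'x \<Rightarrow> 'w \<Rightarrow> real"
  define K where "K = {\<phi>. sublinear \<phi> \<and> le \<phi> q}"
  have le_trans: "le \<phi> \<xi>" if "le \<phi> \<psi>" "le \<psi> \<xi>" for \<phi> \<psi> \<xi>
    unfolding le_def
  proof
    fix x assume "x \<in> carrier X"
    then have "AE w in M. \<phi> x w \<le> \<psi> x w" "AE w in M. \<psi> x w \<le> \<xi> x w" using that by (auto simp: le_def)
    then show "AE w in M. \<phi> x w \<le> \<xi> x w" by eventually_elim simp
  qed
  have epi_iff: "epi \<psi> \<subseteq> epi \<phi> \<longleftrightarrow> le \<phi> \<psi>" for \<phi> \<psi>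
  proof
    assume "epi \<psi> \<subseteq> epi \<phi>"
    then have "(x, \<psi> x) \<in> epi \<phi>" if "x \<in> carrier X" for x using that by (auto simp: epi_def)
    then show "le \<phi> \<psi>" by (auto simp: epi_def le_def)
  next
    assume l: "le \<phi> \<psi>"
    show "epi \<psi> \<subseteq> epi \<phi>"
    proof clarify
      fix x f assume xf: "(x, f) \<in> epi \<psi>"
      then have "AE w in M. \<phi> x w \<le> \<psi> x w" "AE w in M. \<psi> x w \<le> f w"
        using l by (auto simp: le_def epi_def)
      then have "AE w in M. \<phi> x w \<le> f w" by eventually_elim simp
      then show "(x, f) \<in> epi \<phi>" using xf by (simp add: epi_def)
    qed
  qed
  have qK: "q \<in> K" using q by (simp add: K_def le_def)
  \<comment> \<open>Smaller functionals have larger epigraphs, so a maximal epigraph belongs to a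
    minimal functional, and functionals that agree almost surely at every vector have the same
    epigraph.\<close>
  have "\<exists>m\<in>epi ` K. \<forall>e\<in>epi ` K. m \<subseteq> e \<longrightarrow> e = m"
  proof (rule subset_Zorn)
    fix E assume E: "subset.chain (epi ` K) E"
    show "\<exists>U\<in>epi ` K. \<forall>e\<in>E. e \<subseteq> U"
    proof (cases "E = {}")
      case True
      then show ?thesis using qK by blast
    next
      case False
      define C where "C = {\<phi> \<in> K. epi \<phi> \<in> E}"
      have EC: "E = epi ` C" using E by (auto simp: subset_chain_def C_def)
      have sub: "sublinear \<phi>" if "\<phi> \<in> C" for \<phi> using that by (simp add: C_def K_def)
      obtain \<rho> where \<rho>: "sublinear \<rho>"
        "\<And>\<phi> x. \<phi> \<in> C \<Longrightarrow> x \<in> carrier X \<Longrightarrow> AE w in M. \<rho> x w \<le> \<phi> x w"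
      proof (rule sublinear_chain_infimum[of C "\<lambda>x w. - q ((\<lambda>_. - 1) \<cdot> x) w"])
        show "C \<noteq> {}" using False EC by auto
        \<comment> \<open>All members of the chain lie below \<open>q\<close>, so
          \<open>\<phi> x \<ge> - \<phi> (- x) \<ge> - q (- x)\<close> bounds them from below by one
          function.\<close>
        show "AE w in M. - q ((\<lambda>_. - 1) \<cdot> x) w \<le> \<phi> x w" if "\<phi> \<in> C" "x \<in> carrier X" for \<phi> x
        proof -
          have "(\<lambda>_. - 1) \<cdot> x \<in> carrier X" using that by simp
          then have "AE w in M. \<phi> ((\<lambda>_. - 1) \<cdot> x) w \<le> q ((\<lambda>_. - 1) \<cdot> x) w"
            using that by (auto simp: C_def K_def le_def)
          with sublinear_minus[OF sub[OF that(1)] that(2)] show ?thesis by eventually_elim simp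
        qed
        show "(\<forall>x\<in>carrier X. AE w in M. \<phi> x w \<le> \<psi> x w) \<or> (\<forall>x\<in>carrier X. AE w in M. \<psi> x w \<le> \<phi> x w)"
          if "\<phi> \<in> C" "\<psi> \<in> C" for \<phi> \<psi>
        proof -
          have "epi \<phi> \<subseteq> epi \<psi> \<or> epi \<psi> \<subseteq> epi \<phi>" using E that by (auto simp: subset_chain_def C_def)
          then show ?thesis unfolding epi_iff le_def by blast
        qed
      qed (use sub in auto)
      have \<rho>le: "le \<rho> \<phi>" if "\<phi> \<in> C" for \<phi> using \<rho>(2) that by (simp add: le_def)
      obtain \<phi> where "\<phi> \<in> C" using False EC by auto
      then have "le \<rho> q" using \<rho>le le_trans by (auto simp: C_def K_def)
      then have "\<rho> \<in> K" using \<rho>(1) by (simp add: K_def)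
      moreover have "e \<subseteq> epi \<rho>" if "e \<in> E" for e
        using that \<rho>le epi_iff unfolding EC by blast
      ultimately show ?thesis by blast
    qed
  qed
  then obtain \<phi> where \<phi>: "\<phi> \<in> K" and max: "\<And>\<psi>. \<psi> \<in> K \<Longrightarrow> epi \<phi> \<subseteq> epi \<psi> \<Longrightarrow> epi \<psi> = epi \<phi>"
    by auto
  show ?thesis
  proof (rule that[of \<phi>])
    show "sublinear \<phi>" using \<phi> by (simp add: K_def)
    show "AE w in M. \<phi> x w \<le> q x w" if "x \<in> carrier X" for x using \<phi> that by (simp add: K_def le_def)
    fix \<psi> assume \<psi>: "sublinear \<psi>" "\<forall>x\<in>carrier X. AE w in M. \<psi> x w \<le> \<phi> x w"
    then have l: "le \<psi> \<phi>" by (simp add: le_def)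
    then have "\<psi> \<in> K" using \<psi> \<phi> le_trans by (auto simp: K_def)
    then have "le \<phi> \<psi>" using max l epi_iff by blast
    then show "\<forall>x\<in>carrier X. AE w in M. \<phi> x w \<le> \<psi> x w" by (simp add: le_def)
  qed
qed

text \<open>The functional \<open>f\<close> is chosen minimal below \<open>directional q x0\<close>,
  not merely below \<open>q\<close>. At \<open>- x0\<close> that functional is at most
  \<open>- q x0\<close>, so linearity forces \<open>f x0 \<ge> q x0\<close>. Additivity comes from
  minimality: \<open>directional f z\<close> lies below \<open>f\<close>, hence cannot be smaller,
  and this gives \<open>f x + f z \<le> f (x + z)\<close>.\<close>

theorem Hahn_Banach:
  assumes q: "sublinear q" and x0: "x0 \<in> carrier X"
  obtains f where "\<And>x. x \<in> carrier X \<Longrightarrow> f x \<in> borel_measurable M"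
    "\<And>x y. x \<in> carrier X \<Longrightarrow> y \<in> carrier X \<Longrightarrow> AE w in M. f (x \<oplus>\<^bsub>X\<^esub> y) w = f x w + f y w"
    "\<And>t x. t \<in> borel_measurable M \<Longrightarrow> x \<in> carrier X \<Longrightarrow> AE w in M. f (t \<cdot>\<^sub>R x) w = t w * f x w"
    "\<And>x. x \<in> carrier X \<Longrightarrow> AE w in M. f x w \<le> q x w"
    "AE w in M. q x0 w \<le> f x0 w"
proof -
  obtain f where f: "sublinear f" "\<And>x. x \<in> carrier X \<Longrightarrow> AE w in M. f x w \<le> directional q x0 x w"
    and min: "\<And>\<psi>. sublinear \<psi> \<Longrightarrow> \<forall>x\<in>carrier X. AE w in M. \<psi> x w \<le> f x w \<Longrightarrow>
      \<forall>x\<in>carrier X. AE w in M. f x w \<le> \<psi> x w"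
    by (rule minimal_sublinear[OF sublinear_directional[OF q x0]]) blast
  have add: "AE w in M. f (x \<oplus>\<^bsub>X\<^esub> z) w = f x w + f z w" if x: "x \<in> carrier X" and z: "z \<in> carrier X" for x z
  proof -
    have "AE w in M. f x w \<le> directional f z x w"
      using directional_le[OF f(1) z] x min[OF sublinear_directional[OF f(1) z]] by blast
    with directional_le_diff[OF f(1) z x] sublinear_add[OF f(1) x z]
    show ?thesis by eventually_elim simp
  qed
  have neg: "AE w in M. f ((\<lambda>_. - 1) \<cdot> x) w = - f x w" if x: "x \<in> carrier X" for x
  proof -
    have "AE w in M. f \<zero>\<^bsub>X\<^esub> w = f x w + f ((\<lambda>_. - 1) \<cdot> x) w"
      using add[of x "(\<lambda>_. - 1) \<cdot> x"] x by (simp add: add_scale_minus_one)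
    with sublinear_zero[OF f(1)] show ?thesis by eventually_elim simp
  qed
  show ?thesis
  proof (rule that[of f])
    show "f x \<in> borel_measurable M" if "x \<in> carrier X" for x using sublinear_measurable f(1) that .
    show "AE w in M. f (t \<cdot>\<^sub>R x) w = t w * f x w"
      if [measurable]: "t \<in> borel_measurable M" and x: "x \<in> carrier X" for t x
    proof -
      \<comment> \<open>Sublinear homogeneity covers nonnegative multipliers only, so
        \<open>t\<close> is split into its positive and negative parts.\<close>
      define u v where "u w = max 0 (t w)" and "v w = max 0 (- t w)" for w
      have [measurable]: "u \<in> borel_measurable M" "v \<in> borel_measurable M"
        unfolding u_def v_def by measurable
      have uv: "t w = u w + - v w" for w by (auto simp: u_def v_def)
      have vx: "v \<cdot>\<^sub>R x \<in> carrier X" using x by simp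
      have eq: "t \<cdot>\<^sub>R x = u \<cdot>\<^sub>R x \<oplus>\<^bsub>X\<^esub> (\<lambda>_. - 1) \<cdot> v \<cdot>\<^sub>R x"
        using x by (simp add: scale_scale uv flip: scale_add_left)
      have "AE w in M. f (t \<cdot>\<^sub>R x) w = f (u \<cdot>\<^sub>R x) w + f ((\<lambda>_. - 1) \<cdot> v \<cdot>\<^sub>R x) w"
        unfolding eq using x by (intro add) auto
      moreover note neg[OF vx]
      moreover have "AE w in M. f (u \<cdot>\<^sub>R x) w = u w * f x w"
        using x by (intro sublinear_scale[OF f(1)]) (auto simp: u_def)
      moreover have "AE w in M. f (v \<cdot>\<^sub>R x) w = v w * f x w"
        using x by (intro sublinear_scale[OF f(1)]) (auto simp: v_def)
      ultimately show ?thesis by eventually_elim (simp add: uv algebra_simps)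
    qed
    show "AE w in M. f x w \<le> q x w" if "x \<in> carrier X" for x
      using f(2)[OF that] directional_le[OF q x0 that] by eventually_elim simp
    have m: "(\<lambda>_. - 1) \<cdot> x0 \<in> carrier X" using x0 by simp
    have "(\<lambda>_. - 1) \<cdot> x0 \<oplus>\<^bsub>X\<^esub> x0 = \<zero>\<^bsub>X\<^esub>" using add_scale_minus_one[OF x0] m x0 by (simp add: M.a_comm)
    then have "AE w in M. directional q x0 ((\<lambda>_. - 1) \<cdot> x0) w \<le> q \<zero>\<^bsub>X\<^esub> w - q x0 w"
      using directional_le_diff[OF q x0 m] by simp
    with f(2)[OF m] neg[OF x0] sublinear_zero[OF q]
    show "AE w in M. q x0 w \<le> f x0 w" by eventually_elim simp
  qed (use add in auto)
qed


section \<open>Gauges and separation\<close>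

text \<open>The counterpart of \<open>L0_seminorm\<close> on representatives, reduced to upper
  estimates because these are inherited by suprema and by the essential infimum in
  \<open>gauge\<close>. Nonnegativity is derived in \<open>seminorm_nonneg\<close>.\<close>

definition seminorm :: "('x \<Rightarrow> 'w \<Rightarrow> real) \<Rightarrow> bool" where
  "seminorm p \<longleftrightarrow> (\<forall>x\<in>carrier X. p x \<in> borel_measurable M) \<and>
     (\<forall>x\<in>carrier X. \<forall>y\<in>carrier X. AE w in M. p (x \<oplus>\<^bsub>X\<^esub> y) w \<le> p x w + p y w) \<and>
     (\<forall>\<eta>\<in>borel_measurable M. \<forall>x\<in>carrier X. AE w in M. p (\<eta> \<cdot> x) w \<le> norm (\<eta> w) * p x w)"

lemma seminorm_measurable: "seminorm p \<Longrightarrow> x \<in> carrier X \<Longrightarrow> p x \<in> borel_measurable M"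
  by (simp add: seminorm_def)

lemma seminorm_add:
  "seminorm p \<Longrightarrow> x \<in> carrier X \<Longrightarrow> y \<in> carrier X \<Longrightarrow> AE w in M. p (x \<oplus>\<^bsub>X\<^esub> y) w \<le> p x w + p y w"
  by (simp add: seminorm_def)

lemma seminorm_scale_le:
  "seminorm p \<Longrightarrow> \<eta> \<in> borel_measurable M \<Longrightarrow> x \<in> carrier X \<Longrightarrow>
    AE w in M. p (\<eta> \<cdot> x) w \<le> norm (\<eta> w) * p x w"
  by (simp add: seminorm_def)

lemma sublinear_seminorm: "seminorm p \<Longrightarrow> sublinear p"
  unfolding sublinear_def
proof (intro conjI ballI impI)
  fix t :: "'w \<Rightarrow> real" and x
  assume p: "seminorm p" and [measurable]: "t \<in> borel_measurable M" and x: "x \<in> carrier X"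
    and "\<forall>w. 0 \<le> t w"
  then show "AE w in M. p (t \<cdot>\<^sub>R x) w \<le> t w * p x w"
    using seminorm_scale_le[OF p _ x, of "\<lambda>w. of_real (t w)"] by simp
qed (auto simp: seminorm_measurable seminorm_add)

lemma seminorm_nonneg:
  assumes "seminorm p" "x \<in> carrier X" shows "AE w in M. 0 \<le> p x w"
proof -
  have "AE w in M. p ((\<lambda>_. - 1) \<cdot> x) w \<le> p x w"
    using seminorm_scale_le[of p "\<lambda>_. - 1" x] assms by simp
  with sublinear_minus[OF sublinear_seminorm[OF assms(1)] assms(2)]
  show ?thesis by eventually_elim simp
qed

text \<open>The bound on the multiplier holds at every point rather than almost surely, which suits
  explicitly constructed multipliers; \<open>balanced_iff\<close> shows that this gives the same
  notion as \<open>L0_balanced\<close>.\<close>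

definition balanced :: "'x set \<Rightarrow> bool" where
  "balanced G \<longleftrightarrow> (\<forall>\<eta>\<in>borel_measurable M. (\<forall>w. norm (\<eta> w) \<le> 1) \<longrightarrow> (\<forall>x\<in>G. \<eta> \<cdot> x \<in> G))"

definition convex_set :: "'x set \<Rightarrow> bool" where
  "convex_set G \<longleftrightarrow> (\<forall>t\<in>borel_measurable M. (\<forall>w. 0 \<le> t w \<and> t w \<le> 1) \<longrightarrow>
     (\<forall>x\<in>G. \<forall>y\<in>G. t \<cdot>\<^sub>R x \<oplus>\<^bsub>X\<^esub> (\<lambda>w. 1 - t w) \<cdot>\<^sub>R y \<in> G))"

text \<open>The infimal convolution of the Minkowski functional of \<open>G\<close> with \<open>l * p\<close>: it is at most \<open>1\<close>
  on \<open>G\<close> and, being dominated by \<open>l * p\<close>, it only dominates continuous functionals.\<close>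

definition gauge :: "('x \<Rightarrow> 'w \<Rightarrow> real) \<Rightarrow> ('w \<Rightarrow> real) \<Rightarrow> 'x set \<Rightarrow> 'x \<Rightarrow> 'w \<Rightarrow> real" where
  "gauge p l G z = ess_inf M {\<lambda>w. \<xi> w + l w * p (z \<oplus>\<^bsub>X\<^esub> (\<lambda>w. - \<xi> w) \<cdot>\<^sub>R h) w |\<xi> h.
     \<xi> \<in> borel_measurable M \<and> (\<forall>w. 0 \<le> \<xi> w) \<and> h \<in> G}"

context
  fixes p and l :: "'w \<Rightarrow> real" and G
  assumes p: "seminorm p" and l [measurable]: "l \<in> borel_measurable M" and l0: "\<And>w. 0 \<le> l w"
    and G: "G \<subseteq> carrier X" and ne: "G \<noteq> {}" and bal: "balanced G" and conv: "convex_set G"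
begin

lemma G_carrier: "h \<in> G \<Longrightarrow> h \<in> carrier X"
  using G by blast

lemma
  assumes z: "z \<in> carrier X"
  shows gauge_measurable: "gauge p l G z \<in> borel_measurable M"
    and gauge_lower: "\<xi> \<in> borel_measurable M \<Longrightarrow> (\<And>w. 0 \<le> \<xi> w) \<Longrightarrow> h \<in> G \<Longrightarrow>
      AE w in M. gauge p l G z w \<le> \<xi> w + l w * p (z \<oplus>\<^bsub>X\<^esub> (\<lambda>w. - \<xi> w) \<cdot>\<^sub>R h) w"
    and gauge_greatest: "(\<And>\<xi> h. \<xi> \<in> borel_measurable M \<Longrightarrow> (\<And>w. 0 \<le> \<xi> w) \<Longrightarrow> h \<in> G \<Longrightarrow>
        AE w in M. a w \<le> s w * (\<xi> w + l w * p (z \<oplus>\<^bsub>X\<^esub> (\<lambda>w. - \<xi> w) \<cdot>\<^sub>R h) w) + c w) \<Longrightarrow>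
      (\<And>w. 0 \<le> s w) \<Longrightarrow> AE w in M. a w \<le> s w * gauge p l G z w + c w"
proof -
  let ?S = "{\<lambda>w. \<xi> w + l w * p (z \<oplus>\<^bsub>X\<^esub> (\<lambda>w. - \<xi> w) \<cdot>\<^sub>R h) w |\<xi> h.
     \<xi> \<in> borel_measurable M \<and> (\<forall>w. 0 \<le> \<xi> w) \<and> h \<in> G}"
  have cl: "z \<oplus>\<^bsub>X\<^esub> (\<lambda>w. - \<xi> w) \<cdot>\<^sub>R h \<in> carrier X" if [measurable]: "\<xi> \<in> borel_measurable M" and "h \<in> G" for \<xi> h
    using z G_carrier that(2) by (intro M.a_closed scale_closed) auto
  have "(\<lambda>_. 0 :: real) \<in> borel_measurable M" by simp
  then have neS: "?S \<noteq> {}" using ne by fastforce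
  have meas: "?S \<subseteq> borel_measurable M"
    using seminorm_measurable[OF p cl] by auto
  have bd: "AE w in M. 0 \<le> f w" if fS: "f \<in> ?S" for f
  proof -
    obtain \<xi> h where f: "f = (\<lambda>w. \<xi> w + l w * p (z \<oplus>\<^bsub>X\<^esub> (\<lambda>w. - \<xi> w) \<cdot>\<^sub>R h) w)"
      "\<xi> \<in> borel_measurable M" "\<forall>w. 0 \<le> \<xi> w" "h \<in> G"
      using fS by blast
    show ?thesis
      using seminorm_nonneg[OF p cl[OF f(2,4)]] unfolding f(1)
      by eventually_elim (intro add_nonneg_nonneg mult_nonneg_nonneg f(3)[rule_format] l0)
  qed
  show "gauge p l G z \<in> borel_measurable M"
    unfolding gauge_def by (rule ess_inf_measurable[OF neS meas bd])
  show "AE w in M. gauge p l G z w \<le> \<xi> w + l w * p (z \<oplus>\<^bsub>X\<^esub> (\<lambda>w. - \<xi> w) \<cdot>\<^sub>R h) w"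
    if "\<xi> \<in> borel_measurable M" "\<And>w. 0 \<le> \<xi> w" "h \<in> G"
    unfolding gauge_def using that by (intro ess_inf_lower[OF neS meas bd]) blast+
  show "AE w in M. a w \<le> s w * gauge p l G z w + c w"
    if "\<And>\<xi> h. \<xi> \<in> borel_measurable M \<Longrightarrow> (\<And>w. 0 \<le> \<xi> w) \<Longrightarrow> h \<in> G \<Longrightarrow>
        AE w in M. a w \<le> s w * (\<xi> w + l w * p (z \<oplus>\<^bsub>X\<^esub> (\<lambda>w. - \<xi> w) \<cdot>\<^sub>R h) w) + c w" "\<And>w. 0 \<le> s w"
    unfolding gauge_def using that by (intro ess_inf_greatest[OF neS meas bd]) auto
qed

text \<open>Convexity in the form
  \<open>\<xi> G + \<zeta> G \<subseteq> (\<xi> + \<zeta>) G\<close>, which is what subadditivity of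
  the gauge rests on. The signs match the differences occurring there.\<close>

lemma combine_multiples:
  assumes [measurable]: "\<xi> \<in> borel_measurable M" "\<zeta> \<in> borel_measurable M"
    and 0: "\<And>w. 0 \<le> \<xi> w" "\<And>w. 0 \<le> \<zeta> w" and h: "h \<in> G" "k \<in> G"
  obtains g where "g \<in> G"
    "(\<lambda>w. - (\<xi> w + \<zeta> w)) \<cdot>\<^sub>R g = (\<lambda>w. - \<xi> w) \<cdot>\<^sub>R h \<oplus>\<^bsub>X\<^esub> (\<lambda>w. - \<zeta> w) \<cdot>\<^sub>R k"
proof -
  \<comment> \<open>Where \<open>\<xi> + \<zeta> = 0\<close> the quotient is 0 by convention. This
    is harmless, since both multiples vanish there by nonnegativity.\<close>
  define t where "t w = \<xi> w / (\<xi> w + \<zeta> w)" for w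
  have [measurable]: "t \<in> borel_measurable M" unfolding t_def by measurable
  have t01: "0 \<le> t w \<and> t w \<le> 1" for w
    using 0[of w] by (auto simp: t_def divide_le_eq_1 intro: add_nonneg_nonneg)
  let ?g = "t \<cdot>\<^sub>R h \<oplus>\<^bsub>X\<^esub> (\<lambda>w. 1 - t w) \<cdot>\<^sub>R k"
  have "\<xi> w + \<zeta> w = 0 \<Longrightarrow> \<xi> w = 0 \<and> \<zeta> w = 0" for w using 0[of w] by linarith
  then have "- (\<xi> w + \<zeta> w) * t w = - \<xi> w" "- (\<xi> w + \<zeta> w) * (1 - t w) = - \<zeta> w" for w
    by (cases "\<xi> w + \<zeta> w = 0"; auto simp: t_def field_simps)+
  then have eq: "of_real (- (\<xi> w + \<zeta> w)) * of_real (t w) = (of_real (- \<xi> w) :: 'k)"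
    "of_real (- (\<xi> w + \<zeta> w)) * of_real (1 - t w) = (of_real (- \<zeta> w) :: 'k)" for w
    by (simp_all only: flip: of_real_mult)
  show ?thesis
  proof (rule that)
    show "?g \<in> G" using conv h t01 by (simp add: convex_set_def)
    have "(\<lambda>w. - (\<xi> w + \<zeta> w)) \<cdot>\<^sub>R ?g
        = (\<lambda>w. - (\<xi> w + \<zeta> w)) \<cdot>\<^sub>R t \<cdot>\<^sub>R h \<oplus>\<^bsub>X\<^esub> (\<lambda>w. - (\<xi> w + \<zeta> w)) \<cdot>\<^sub>R (\<lambda>w. 1 - t w) \<cdot>\<^sub>R k"
      using h G_carrier by (intro scale_add_right scale_closed) auto
    also have "(\<lambda>w. - (\<xi> w + \<zeta> w)) \<cdot>\<^sub>R t \<cdot>\<^sub>R h = (\<lambda>w. - \<xi> w) \<cdot>\<^sub>R h"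
      using h G_carrier by (subst scale_scale) (simp_all only: eq, auto)
    also have "(\<lambda>w. - (\<xi> w + \<zeta> w)) \<cdot>\<^sub>R (\<lambda>w. 1 - t w) \<cdot>\<^sub>R k = (\<lambda>w. - \<zeta> w) \<cdot>\<^sub>R k"
      using h G_carrier by (subst scale_scale) (simp_all only: eq, auto)
    finally show "(\<lambda>w. - (\<xi> w + \<zeta> w)) \<cdot>\<^sub>R ?g = (\<lambda>w. - \<xi> w) \<cdot>\<^sub>R h \<oplus>\<^bsub>X\<^esub> (\<lambda>w. - \<zeta> w) \<cdot>\<^sub>R k" .
  qed
qed

lemma seminorm_gauge: "seminorm (gauge p l G)"
  unfolding seminorm_def
proof (intro conjI ballI)
  show "gauge p l G x \<in> borel_measurable M" if "x \<in> carrier X" for x using gauge_measurable that .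
next
  fix x y assume x: "x \<in> carrier X" and y: "y \<in> carrier X"
  have xy: "x \<oplus>\<^bsub>X\<^esub> y \<in> carrier X" using x y by simp
  let ?D = "gauge p l G (x \<oplus>\<^bsub>X\<^esub> y)"
  let ?m = "\<lambda>\<xi> h. (\<lambda>w. - \<xi> w) \<cdot>\<^sub>R h"
  let ?V = "\<lambda>x \<xi> h w. \<xi> w + l w * p (x \<oplus>\<^bsub>X\<^esub> ?m \<xi> h) w"
  have 1: "AE w in M. ?D w \<le> ?V x \<xi> h w + ?V y \<zeta> k w"
    if \<xi> [measurable]: "\<xi> \<in> borel_measurable M" and \<xi>0: "\<And>w. 0 \<le> \<xi> w" and h: "h \<in> G"
      and \<zeta> [measurable]: "\<zeta> \<in> borel_measurable M" and \<zeta>0: "\<And>w. 0 \<le> \<zeta> w" and k: "k \<in> G" for \<xi> \<zeta> h k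
  proof -
    obtain g where g: "g \<in> G" "?m (\<lambda>w. \<xi> w + \<zeta> w) g = ?m \<xi> h \<oplus>\<^bsub>X\<^esub> ?m \<zeta> k"
      using combine_multiples[OF \<xi> \<zeta> \<xi>0 \<zeta>0 h k] .
    have c: "?m \<xi> h \<in> carrier X" "?m \<zeta> k \<in> carrier X"
      using h k G_carrier by (auto intro!: scale_closed simp del: of_real_minus)
    then have eq: "(x \<oplus>\<^bsub>X\<^esub> y) \<oplus>\<^bsub>X\<^esub> ?m (\<lambda>w. \<xi> w + \<zeta> w) g = (x \<oplus>\<^bsub>X\<^esub> ?m \<xi> h) \<oplus>\<^bsub>X\<^esub> (y \<oplus>\<^bsub>X\<^esub> ?m \<zeta> k)"
      unfolding g(2) using x y by (simp add: M.a_ac del: of_real_minus)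
    have "AE w in M. ?D w \<le> ?V (x \<oplus>\<^bsub>X\<^esub> y) (\<lambda>w. \<xi> w + \<zeta> w) g w"
      using \<xi>0 \<zeta>0 g(1) by (intro gauge_lower[OF xy]) (auto intro: add_nonneg_nonneg)
    moreover have "AE w in M. p ((x \<oplus>\<^bsub>X\<^esub> y) \<oplus>\<^bsub>X\<^esub> ?m (\<lambda>w. \<xi> w + \<zeta> w) g) w
        \<le> p (x \<oplus>\<^bsub>X\<^esub> ?m \<xi> h) w + p (y \<oplus>\<^bsub>X\<^esub> ?m \<zeta> k) w"
      unfolding eq using x y c by (intro seminorm_add[OF p] M.a_closed)
    ultimately show ?thesis
    proof eventually_elim
      case (elim w)
      have "?D w \<le> \<xi> w + \<zeta> w + l w * (p (x \<oplus>\<^bsub>X\<^esub> ?m \<xi> h) w + p (y \<oplus>\<^bsub>X\<^esub> ?m \<zeta> k) w)"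
        using elim(1) mult_left_mono[OF elim(2) l0[of w]] by linarith
      then show ?case by (simp add: distrib_left)
    qed
  qed
  have 2: "AE w in M. ?D w \<le> gauge p l G x w + ?V y \<zeta> k w"
    if \<zeta>: "\<zeta> \<in> borel_measurable M" and \<zeta>0: "\<And>w. 0 \<le> \<zeta> w" and k: "k \<in> G" for \<zeta> k
  proof -
    have "AE w in M. ?D w \<le> 1 * gauge p l G x w + ?V y \<zeta> k w"
      by (rule gauge_greatest[OF x]) (use 1[OF _ _ _ \<zeta> \<zeta>0 k] in simp_all)
    then show ?thesis by simp
  qed
  have "AE w in M. ?D w \<le> 1 * gauge p l G y w + gauge p l G x w"
    by (rule gauge_greatest[OF y]) (use 2 in \<open>simp_all add: add.commute\<close>)
  then show "AE w in M. ?D w \<le> gauge p l G x w + gauge p l G y w" by (simp add: add.commute)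
next
  fix \<eta> :: "'w \<Rightarrow> 'k" and x
  assume \<eta> [measurable]: "\<eta> \<in> borel_measurable M" and x: "x \<in> carrier X"
  have \<eta>x: "\<eta> \<cdot> x \<in> carrier X" using x by simp
  let ?m = "\<lambda>\<xi> h. (\<lambda>w. - \<xi> w) \<cdot>\<^sub>R h"
  \<comment> \<open>The phase of \<open>\<eta>\<close>, equal to 0 where \<open>\<eta>\<close>
    vanishes. Balancedness keeps \<open>\<theta> h\<close> in \<open>G\<close>, and the multiple
    \<open>norm \<eta> * \<xi>\<close> of \<open>\<theta> h\<close> is \<open>\<eta>\<close> times
    the multiple \<open>\<xi>\<close> of \<open>h\<close>, so the whole difference is scaled by
    \<open>\<eta>\<close>.\<close>
  define \<theta> where "\<theta> w = \<eta> w / of_real (norm (\<eta> w))" for w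
  have \<theta> [measurable]: "\<theta> \<in> borel_measurable M" unfolding \<theta>_def by measurable
  have \<theta>1: "norm (\<theta> w) \<le> 1" for w by (simp add: \<theta>_def norm_divide)
  have "AE w in M. gauge p l G (\<eta> \<cdot> x) w \<le> norm (\<eta> w) * (\<xi> w + l w * p (x \<oplus>\<^bsub>X\<^esub> ?m \<xi> h) w) + 0"
    if \<xi> [measurable]: "\<xi> \<in> borel_measurable M" and \<xi>0: "\<And>w. 0 \<le> \<xi> w" and h: "h \<in> G" for \<xi> h
  proof -
    have hc: "h \<in> carrier X" using h G_carrier by simp
    have "\<theta> \<cdot> h \<in> G" using bal h \<theta>1 by (simp add: balanced_def)
    then have "AE w in M. gauge p l G (\<eta> \<cdot> x) w
        \<le> norm (\<eta> w) * \<xi> w + l w * p (\<eta> \<cdot> x \<oplus>\<^bsub>X\<^esub> ?m (\<lambda>w. norm (\<eta> w) * \<xi> w) (\<theta> \<cdot> h)) w"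
      using \<xi>0 by (intro gauge_lower[OF \<eta>x]) auto
    moreover have eq: "\<eta> \<cdot> x \<oplus>\<^bsub>X\<^esub> ?m (\<lambda>w. norm (\<eta> w) * \<xi> w) (\<theta> \<cdot> h) = \<eta> \<cdot> (x \<oplus>\<^bsub>X\<^esub> ?m \<xi> h)"
    proof -
      have \<theta>\<xi>: "(\<lambda>w. of_real (- (norm (\<eta> w) * \<xi> w)) * \<theta> w) = (\<lambda>w. \<eta> w * of_real (- \<xi> w))"
        by (auto simp: \<theta>_def)
      have "?m (\<lambda>w. norm (\<eta> w) * \<xi> w) (\<theta> \<cdot> h)
          = (\<lambda>w. of_real (- (norm (\<eta> w) * \<xi> w)) * \<theta> w) \<cdot> h"
        using hc by (intro scale_scale) auto
      also have "\<dots> = \<eta> \<cdot> ?m \<xi> h"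
        unfolding \<theta>\<xi> using hc by (intro scale_scale[symmetric]) auto
      finally have "?m (\<lambda>w. norm (\<eta> w) * \<xi> w) (\<theta> \<cdot> h) = \<eta> \<cdot> ?m \<xi> h" .
      then show ?thesis using x hc by (simp add: scale_add_right)
    qed
    moreover have "AE w in M. p (\<eta> \<cdot> (x \<oplus>\<^bsub>X\<^esub> ?m \<xi> h)) w \<le> norm (\<eta> w) * p (x \<oplus>\<^bsub>X\<^esub> ?m \<xi> h) w"
      using x hc by (intro seminorm_scale_le[OF p]) auto
    ultimately have "AE w in M. gauge p l G (\<eta> \<cdot> x) w
        \<le> norm (\<eta> w) * \<xi> w + l w * p (\<eta> \<cdot> (x \<oplus>\<^bsub>X\<^esub> ?m \<xi> h)) w"
      "AE w in M. p (\<eta> \<cdot> (x \<oplus>\<^bsub>X\<^esub> ?m \<xi> h)) w \<le> norm (\<eta> w) * p (x \<oplus>\<^bsub>X\<^esub> ?m \<xi> h) w"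
      by simp_all
    then show ?thesis
    proof eventually_elim
      case (elim w)
      have "gauge p l G (\<eta> \<cdot> x) w \<le> norm (\<eta> w) * \<xi> w + l w * (norm (\<eta> w) * p (x \<oplus>\<^bsub>X\<^esub> ?m \<xi> h) w)"
        using elim(1) mult_left_mono[OF elim(2) l0[of w]] by linarith
      then show ?case by (simp add: algebra_simps)
    qed
  qed
  then have "AE w in M. gauge p l G (\<eta> \<cdot> x) w \<le> norm (\<eta> w) * gauge p l G x w + 0"
    by (intro gauge_greatest[OF x]) auto
  then show "AE w in M. gauge p l G (\<eta> \<cdot> x) w \<le> norm (\<eta> w) * gauge p l G x w" by simp
qed

lemma gauge_le: "x \<in> carrier X \<Longrightarrow> AE w in M. gauge p l G x w \<le> l w * p x w"
proof -
  assume x: "x \<in> carrier X"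
  obtain h where h: "h \<in> G" using ne by auto
  show ?thesis using gauge_lower[OF x, of "\<lambda>_. 0" h] h G_carrier[OF h] x by simp
qed

lemma gauge_le_one: "h \<in> G \<Longrightarrow> AE w in M. gauge p l G h w \<le> 1"
proof -
  assume h: "h \<in> G"
  have "AE w in M. gauge p l G h w \<le> 1 + l w * p \<zero>\<^bsub>X\<^esub> w"
    using gauge_lower[OF G_carrier[OF h], of "\<lambda>_. 1" h] h
    by (simp add: add_scale_minus_one[OF G_carrier[OF h]])
  with sublinear_zero[OF sublinear_seminorm[OF p]] show ?thesis by eventually_elim simp
qed

end

text \<open>Write \<open>U\<close> for the value of \<open>p\<close> at \<open>x - \<xi> h\<close>.
  On \<open>D\<close>, if \<open>\<xi> \<le> 1\<close>, then \<open>\<xi> h\<close> counts as a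
  point of \<open>G\<close> and \<open>U \<ge> e\<close>. If \<open>\<xi> > 1\<close> and
  \<open>U \<ge> e / 2\<close>, then \<open>\<xi>\<close> and \<open>2 U / e\<close> are both at
  least 1. Otherwise \<open>x - \<xi> h\<close> is small while \<open>x - h\<close> is not, which is
  possible only if \<open>(\<xi> - 1) * p x \<ge> e / 2\<close>. In each case the cost exceeds 1 by
  an amount independent of \<open>\<xi>\<close> and \<open>h\<close>.\<close>

lemma gauge_gt:
  assumes p: "seminorm p" and [measurable]: "e \<in> borel_measurable M" and e0: "\<And>w. 0 < e w"
    and G: "G \<subseteq> carrier X" "G \<noteq> {}" "balanced G" "convex_set G" and x: "x \<in> carrier X"
    and far: "\<And>h. h \<in> G \<Longrightarrow> AE w in M. w \<in> D \<longrightarrow> e w \<le> p (x \<oplus>\<^bsub>X\<^esub> (\<lambda>_. - 1) \<cdot> h) w"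
  shows "AE w in M. w \<in> D \<longrightarrow> 1 < gauge p (\<lambda>w. 2 / e w) G x w"
proof -
  \<comment> \<open>An explicit lower bound for all competitors at once. Its excess over 1 is the
    solution of \<open>(\<xi> - 1) * (p x + e) = e / 2\<close> for \<open>\<xi> - 1\<close>; the
    added \<open>e\<close> avoids a zero denominator where \<open>p x = 0\<close>.\<close>
  define a where "a w = (if w \<in> D then 1 + e w / (2 * (p x w + e w)) else 0)" for w
  let ?u = "\<lambda>\<xi> h. p (x \<oplus>\<^bsub>X\<^esub> (\<lambda>w. - \<xi> w) \<cdot>\<^sub>R h)"
  have a_le: "AE w in M. a w \<le> 1 * (\<xi> w + (2 / e w) * ?u \<xi> h w) + 0"
    if \<xi> [measurable]: "\<xi> \<in> borel_measurable M" and \<xi>0: "\<And>w. 0 \<le> \<xi> w" and h: "h \<in> G" for \<xi> h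
  proof -
    have hc: "h \<in> carrier X" using h G by blast
    have \<xi>h: "(\<lambda>w. - \<xi> w) \<cdot>\<^sub>R h \<in> carrier X" using hc by (intro scale_closed) auto
    then have xh: "x \<oplus>\<^bsub>X\<^esub> (\<lambda>w. - \<xi> w) \<cdot>\<^sub>R h \<in> carrier X" using x by (intro M.a_closed)
    \<comment> \<open>A random \<open>\<xi>\<close> may lie below 1 on one event and above on
      another. Truncation gives a point \<open>m h\<close> of \<open>G\<close> in all cases, and the
      error \<open>\<xi> - m\<close> vanishes wherever \<open>\<xi> \<le> 1\<close>.\<close>
    define m where "m w = min 1 (\<xi> w)" for w
    have [measurable]: "m \<in> borel_measurable M" unfolding m_def by measurable
    have mh: "m \<cdot>\<^sub>R h \<in> G"
      using G(3) h \<xi>0 by (simp add: balanced_def m_def abs_of_nonneg)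
    have nm: "(\<lambda>_. - 1) \<cdot> m \<cdot>\<^sub>R h = (\<lambda>w. - \<xi> w) \<cdot>\<^sub>R h \<oplus>\<^bsub>X\<^esub> (\<lambda>w. \<xi> w - m w) \<cdot>\<^sub>R h"
      using hc by (simp add: scale_scale flip: scale_add_left)
    have f: "AE w in M. w \<in> D \<longrightarrow> e w \<le> p (x \<oplus>\<^bsub>X\<^esub> (\<lambda>_. - 1) \<cdot> m \<cdot>\<^sub>R h) w"
      by (rule far[OF mh])
    have e: "x \<oplus>\<^bsub>X\<^esub> (\<lambda>_. - 1) \<cdot> m \<cdot>\<^sub>R h = (x \<oplus>\<^bsub>X\<^esub> (\<lambda>w. - \<xi> w) \<cdot>\<^sub>R h) \<oplus>\<^bsub>X\<^esub> (\<lambda>w. \<xi> w - m w) \<cdot>\<^sub>R h"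
      unfolding nm using x hc \<xi>h by (intro M.a_assoc[symmetric]) auto
    have "AE w in M. p ((x \<oplus>\<^bsub>X\<^esub> (\<lambda>w. - \<xi> w) \<cdot>\<^sub>R h) \<oplus>\<^bsub>X\<^esub> (\<lambda>w. \<xi> w - m w) \<cdot>\<^sub>R h) w
        \<le> ?u \<xi> h w + p ((\<lambda>w. \<xi> w - m w) \<cdot>\<^sub>R h) w"
      using xh hc by (intro seminorm_add[OF p]) auto
    moreover have "AE w in M. p ((\<lambda>w. \<xi> w - m w) \<cdot>\<^sub>R h) w \<le> norm (of_real (\<xi> w - m w) :: 'k) * p h w"
      using hc by (intro seminorm_scale_le[OF p]) auto
    moreover note f[unfolded e]
    ultimately have 1: "AE w in M. w \<in> D \<longrightarrow> e w \<le> ?u \<xi> h w + norm (of_real (\<xi> w - m w) :: 'k) * p h w"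
      by eventually_elim linarith
    \<comment> \<open>This decomposition serves the event \<open>\<xi> > 1\<close>: it compares
      \<open>\<xi>\<close> times the distance of \<open>x\<close> from \<open>h\<close> with
      \<open>U\<close> plus \<open>(\<xi> - 1) * p x\<close>.\<close>
    have eq: "\<xi> \<cdot>\<^sub>R (x \<oplus>\<^bsub>X\<^esub> (\<lambda>_. - 1) \<cdot> h) = (x \<oplus>\<^bsub>X\<^esub> (\<lambda>w. - \<xi> w) \<cdot>\<^sub>R h) \<oplus>\<^bsub>X\<^esub> (\<lambda>w. \<xi> w - 1) \<cdot>\<^sub>R x"
    proof -
      have "\<xi> \<cdot>\<^sub>R x = x \<oplus>\<^bsub>X\<^esub> (\<lambda>w. \<xi> w - 1) \<cdot>\<^sub>R x"
        using scale_add_left[of "\<lambda>_. 1" "\<lambda>w. of_real (\<xi> w - 1)" x] x by simp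
      moreover have "\<xi> \<cdot>\<^sub>R (\<lambda>_. - 1) \<cdot> h = (\<lambda>w. - \<xi> w) \<cdot>\<^sub>R h"
        using hc by (simp add: scale_scale)
      moreover have "\<xi> \<cdot>\<^sub>R (x \<oplus>\<^bsub>X\<^esub> (\<lambda>_. - 1) \<cdot> h) = \<xi> \<cdot>\<^sub>R x \<oplus>\<^bsub>X\<^esub> \<xi> \<cdot>\<^sub>R (\<lambda>_. - 1) \<cdot> h"
        using x hc by (intro scale_add_right) auto
      moreover have "(\<lambda>w. \<xi> w - 1) \<cdot>\<^sub>R x \<in> carrier X" using x by (intro scale_closed) auto
      ultimately show ?thesis using x hc \<xi>h by (simp add: M.a_ac del: of_real_minus of_real_diff)
    qed
    have "AE w in M. p (\<xi> \<cdot>\<^sub>R (x \<oplus>\<^bsub>X\<^esub> (\<lambda>_. - 1) \<cdot> h)) w = \<xi> w * p (x \<oplus>\<^bsub>X\<^esub> (\<lambda>_. - 1) \<cdot> h) w"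
      using x hc \<xi>0 by (intro sublinear_scale[OF sublinear_seminorm[OF p]]) auto
    moreover have "AE w in M. p (\<xi> \<cdot>\<^sub>R (x \<oplus>\<^bsub>X\<^esub> (\<lambda>_. - 1) \<cdot> h)) w \<le> ?u \<xi> h w + p ((\<lambda>w. \<xi> w - 1) \<cdot>\<^sub>R x) w"
      unfolding eq using xh x by (intro seminorm_add[OF p]) auto
    moreover have "AE w in M. p ((\<lambda>w. \<xi> w - 1) \<cdot>\<^sub>R x) w \<le> norm (of_real (\<xi> w - 1) :: 'k) * p x w"
      using x by (intro seminorm_scale_le[OF p]) auto
    moreover note far[OF h] 1 seminorm_nonneg[OF p xh] seminorm_nonneg[OF p x]
    ultimately show ?thesis
    proof eventually_elim
      case (elim w)
      note u0 = elim(6) and P0 = elim(7)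
      show ?case
      proof (cases "w \<in> D")
        case False
        then show ?thesis using u0 \<xi>0[of w] e0[of w] by (simp add: a_def)
      next
        case D: True
        let ?U = "?u \<xi> h w" and ?P = "p x w"
        have a2: "a w \<le> 2" using D e0[of w] P0 by (simp add: a_def divide_le_eq)
        \<comment> \<open>The first case collects the situations in which the cost is at least 2,
          hence at least \<open>a\<close>. In the second, \<open>\<xi> > 1\<close> and
          \<open>U < e / 2\<close>.\<close>
        show ?thesis
        proof (cases "e w / 2 \<le> ?U \<and> 1 \<le> \<xi> w \<or> \<xi> w \<le> 1")
          case True
          have "2 \<le> \<xi> w + 2 / e w * ?U"
          proof (cases "\<xi> w \<le> 1")
            case True
            then have "e w \<le> ?U" using elim(5) D by (simp add: m_def min_def split: if_splits)
            then have "2 \<le> 2 / e w * ?U" using e0[of w] by (simp add: field_simps)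
            then show ?thesis using \<xi>0[of w] by linarith
          next
            case False
            then have "1 \<le> 2 / e w * ?U" using True e0[of w] by (simp add: field_simps)
            then show ?thesis using False by linarith
          qed
          then show ?thesis using a2 by simp
        next
          case False
          have "norm (of_real (\<xi> w - 1) :: 'k) = \<xi> w - 1" using False by (simp only: norm_of_real) simp
          then have "\<xi> w * p (x \<oplus>\<^bsub>X\<^esub> (\<lambda>_. - 1) \<cdot> h) w \<le> ?U + (\<xi> w - 1) * ?P"
            using elim(1-3) by simp
          moreover have "e w \<le> \<xi> w * p (x \<oplus>\<^bsub>X\<^esub> (\<lambda>_. - 1) \<cdot> h) w"
            using mult_mono[of 1 "\<xi> w" "e w" "p (x \<oplus>\<^bsub>X\<^esub> (\<lambda>_. - 1) \<cdot> h) w"] False elim(4) D e0[of w] \<xi>0[of w]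
            by simp
          ultimately have "e w / 2 \<le> (\<xi> w - 1) * ?P" using False by linarith
          also have "\<dots> \<le> (\<xi> w - 1) * (?P + e w)"
            using False e0[of w] by (intro mult_left_mono) auto
          finally have "e w / (2 * (?P + e w)) \<le> \<xi> w - 1"
            using P0 e0[of w] by (subst pos_divide_le_eq) (simp_all add: algebra_simps)
          moreover have "0 \<le> 2 / e w * ?U" using u0 e0[of w] by simp
          ultimately show ?thesis using D by (simp add: a_def)
        qed
      qed
    qed
  qed
  have "AE w in M. a w \<le> 1 * gauge p (\<lambda>w. 2 / e w) G x w + 0"
    using a_le e0 by (intro gauge_greatest[OF p _ _ G x]) (auto simp: less_imp_le)
  with seminorm_nonneg[OF p x] show ?thesis
  proof eventually_elim
    case (elim w)
    have "0 < e w / (2 * (p x w + e w))" using elim(1) e0[of w] by simp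
    then show ?case using elim(2) by (auto simp: a_def)
  qed
qed

end


section \<open>From classes to representatives\<close>

lemma L0_abs_class:
  fixes f :: "'w \<Rightarrow> 'k::{real_normed_field,second_countable_topology}"
  shows "f \<in> borel_measurable M \<Longrightarrow> L0_abs M (AE_class M f) = AE_class M (\<lambda>w. norm (f w))"
  unfolding L0_abs_def by (rule L0_lift_class) auto

lemma L0_of_real_class:
  "f \<in> borel_measurable M \<Longrightarrow>
    L0_of_real M (AE_class M f) = AE_class M (\<lambda>w. of_real (f w) :: 'k::{real_normed_field,second_countable_topology})"
  unfolding L0_of_real_def by (rule L0_lift_class) auto

lemma L0_smult: "a \<odot>\<^bsub>L0 M\<^esub> b = a \<otimes>\<^bsub>L0 M\<^esub> b"
  by (simp add: L0_def)

lemma L0_minus_class: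
  fixes f g :: "'w \<Rightarrow> real"
  assumes [measurable]: "f \<in> borel_measurable M" "g \<in> borel_measurable M"
  shows "AE_class M f \<ominus>\<^bsub>L0 M\<^esub> AE_class M g = AE_class M (\<lambda>w. f w - g w)"
proof -
  interpret cring "L0 M :: (('w \<Rightarrow> real) set, _) module" by (rule L0_cring)
  have c: "AE_class M h \<in> carrier (L0 M)" if "h \<in> borel_measurable M" for h :: "'w \<Rightarrow> real"
    using that by (auto simp: L0_carrier_iff)
  have "\<ominus>\<^bsub>L0 M\<^esub> AE_class M g = AE_class M (\<lambda>w. - g w)"
    by (rule minus_equality) (simp_all add: c L0_add_class L0_zero)
  then show ?thesis by (simp add: minus_eq L0_add_class)
qed

lemma L0_le_one_iff:
  assumes "f \<in> borel_measurable M"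
  shows "L0_le M (L0_abs M (AE_class M f)) \<one>\<^bsub>L0 M\<^esub> \<longleftrightarrow>
    (AE w in M. norm (f w :: 'k::{real_normed_field,second_countable_topology}) \<le> 1)"
  using assms by (simp add: L0_abs_class L0_one L0_le_class)

lemma L0_ball_abs_iff:
  fixes f :: "'w \<Rightarrow> 'k::{real_normed_field,second_countable_topology}"
  assumes f [measurable]: "f \<in> borel_measurable M" and e: "e \<in> borel_measurable M"
  shows "AE_class M f \<in> L0_ball M (L0 M) {L0_abs M} (AE_class M e) \<longleftrightarrow> (AE w in M. norm (f w) \<le> e w)"
proof -
  let ?n = "AE_class M (\<lambda>w. norm (f w))"
  have n: "?n \<in> L0_plus M" by (auto simp: L0_plus_iff)
  then have s: "L0_is_Sup M {?n} ?n" by (auto simp: L0_is_Sup_iff L0_le_class)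
  have "L0_le M ?n (AE_class M e)" if "L0_is_Sup M {?n} t" "L0_le M t (AE_class M e)" for t
  proof -
    have "L0_le M ?n t" "t \<in> carrier (L0 M)"
      using that n by (auto simp: L0_is_Sup_iff L0_plus_def)
    then show ?thesis using that(2) L0_le_trans by blast
  qed
  then have "AE_class M f \<in> L0_ball M (L0 M) {L0_abs M} (AE_class M e) \<longleftrightarrow> L0_le M ?n (AE_class M e)"
    using s by (auto simp: L0_ball_def L0_abs_class L0_carrier_iff)
  then show ?thesis using e by (simp add: L0_le_class)
qed

lemma topspace_Tc:
  assumes "abelian_group X" shows "topspace (Tc M X P) = carrier X"
proof
  interpret abelian_group X by fact
  show "topspace (Tc M X P) \<subseteq> carrier X" using openin_topspace by (metis openin_Tc)
  have "x <+\<^bsub>X\<^esub> L0_ball M X {} e \<subseteq> carrier X" if "x \<in> carrier X" for x e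
    using that by (auto simp: a_l_coset_def' L0_ball_def)
  moreover have "AE_class M (\<lambda>_. 1) \<in> L0_plusplus M" by (auto simp: L0_plusplus_iff)
  ultimately have "openin (Tc M X P) (carrier X)"
    unfolding openin_Tc by (metis finite.emptyI empty_subsetI subset_refl)
  then show "carrier X \<subseteq> topspace (Tc M X P)" by (rule openin_subset)
qed

lemma topspace_Tc_L0:
  "topspace (Tc M (L0 M) P) =
    carrier (L0 M :: (('w \<Rightarrow> 'k::{real_normed_field,second_countable_topology}) set, _) module)"
proof (rule topspace_Tc)
  interpret cring "L0 M :: (('w \<Rightarrow> 'k) set, _) module" by (rule L0_cring)
  show "abelian_group (L0 M :: (('w \<Rightarrow> 'k) set, _) module)" by unfold_locales
qed

context random_module
begin

text \<open>A class bounded by 1 almost surely has a representative bounded by 1 everywhere: its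
  values on the exceptional null set are reset to 0, without changing the action on
  \<open>X\<close>.\<close>

lemma balanced_iff: "L0_balanced M X B \<longleftrightarrow> balanced B"
proof
  assume B: "L0_balanced M X B"
  show "balanced B"
    unfolding balanced_def scale_def
    using B by (auto simp: L0_balanced_def L0_le_one_iff)
next
  assume B: "balanced B"
  show "L0_balanced M X B"
    unfolding L0_balanced_def
  proof (intro ballI impI)
    fix x and \<eta> :: "('w \<Rightarrow> 'k) set"
    assume x: "x \<in> B" and \<eta>: "\<eta> \<in> carrier (L0 M)" and le: "L0_le M (L0_abs M \<eta>) \<one>\<^bsub>L0 M\<^esub>"
    obtain f where f [measurable]: "f \<in> borel_measurable M" and \<eta>f: "\<eta> = AE_class M f"
      using \<eta> by (auto simp: L0_carrier_iff)
    define g where "g w = (if norm (f w) \<le> 1 then f w else 0)" for w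
    have g [measurable]: "g \<in> borel_measurable M" unfolding g_def by measurable
    have "AE w in M. norm (f w) \<le> 1" using le \<eta>f f by (simp add: L0_le_one_iff)
    then have "AE w in M. f w = g w" by eventually_elim (simp add: g_def)
    then have "f \<cdot> x = g \<cdot> x" by (intro scale_cong) auto
    moreover have "g \<cdot> x \<in> B" using B x by (simp add: balanced_def g_def)
    ultimately show "\<eta> \<odot>\<^bsub>X\<^esub> x \<in> B" by (simp add: \<eta>f scale_def)
  qed
qed

lemma convex_iff: "L0_convex M X B \<longleftrightarrow> convex_set B"
proof -
  have eq: "L0_of_real M (AE_class M t) \<odot>\<^bsub>X\<^esub> x \<oplus>\<^bsub>X\<^esub> L0_of_real M (\<one>\<^bsub>L0 M\<^esub> \<ominus>\<^bsub>L0 M\<^esub> AE_class M t) \<odot>\<^bsub>X\<^esub> y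
      = t \<cdot>\<^sub>R x \<oplus>\<^bsub>X\<^esub> (\<lambda>w. 1 - t w) \<cdot>\<^sub>R y" if "t \<in> borel_measurable M" for t x y
    using that by (simp add: L0_one L0_minus_class L0_of_real_class scale_def)
  show ?thesis
  proof
    assume B: "L0_convex M X B"
    show "convex_set B"
      unfolding convex_set_def
    proof (intro ballI impI)
      fix t :: "'w \<Rightarrow> real" and x y
      assume t [measurable]: "t \<in> borel_measurable M" and t01: "\<forall>w. 0 \<le> t w \<and> t w \<le> 1"
        and xy: "x \<in> B" "y \<in> B"
      have "AE_class M t \<in> L0_plus M" "L0_le M (AE_class M t) \<one>\<^bsub>L0 M\<^esub>"
        using t t01 by (auto simp: L0_plus_iff L0_one L0_le_class)
      then show "t \<cdot>\<^sub>R x \<oplus>\<^bsub>X\<^esub> (\<lambda>w. 1 - t w) \<cdot>\<^sub>R y \<in> B"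
        using B xy eq[OF t, of x y] by (metis L0_convex_def)
    qed
  next
    assume B: "convex_set B"
    show "L0_convex M X B"
      unfolding L0_convex_def
    proof (intro ballI impI)
      fix x y and \<xi> :: "('w \<Rightarrow> real) set"
      assume xy: "x \<in> B" "y \<in> B" and \<xi>: "\<xi> \<in> L0_plus M" "L0_le M \<xi> \<one>\<^bsub>L0 M\<^esub>"
      obtain f where f [measurable]: "f \<in> borel_measurable M" and \<xi>f: "\<xi> = AE_class M f"
        and f0: "AE w in M. 0 \<le> f w"
        using \<xi> by (auto simp: L0_plus_iff)
      have f1: "AE w in M. f w \<le> 1" using \<xi> by (simp add: \<xi>f L0_one L0_le_class)
      define t where "t w = max 0 (min 1 (f w))" for w
      have t [measurable]: "t \<in> borel_measurable M" unfolding t_def by measurable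
      have "AE w in M. f w = t w" using f0 f1 by eventually_elim (simp add: t_def)
      then have \<xi>t: "\<xi> = AE_class M t" by (simp add: \<xi>f AE_class_eq_iff)
      have "t \<cdot>\<^sub>R x \<oplus>\<^bsub>X\<^esub> (\<lambda>w. 1 - t w) \<cdot>\<^sub>R y \<in> B"
        using B xy by (simp add: convex_set_def t_def)
      then show "L0_of_real M \<xi> \<odot>\<^bsub>X\<^esub> x \<oplus>\<^bsub>X\<^esub> L0_of_real M (\<one>\<^bsub>L0 M\<^esub> \<ominus>\<^bsub>L0 M\<^esub> \<xi>) \<odot>\<^bsub>X\<^esub> y \<in> B"
        unfolding \<xi>t eq[OF t] .
    qed
  qed
qed

text \<open>Balancedness and convexity pass to intersections. Nonemptiness does not in general, but
  every set taking part contains zero as the zero multiple of one of its points; this covers the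
  case \<open>A = {}\<close>.\<close>

lemma L0_Gamma_properties:
  assumes "A \<subseteq> carrier X"
  shows "A \<subseteq> L0_Gamma M X A" "L0_Gamma M X A \<subseteq> carrier X" "L0_Gamma M X A \<noteq> {}"
    "balanced (L0_Gamma M X A)" "convex_set (L0_Gamma M X A)"
proof -
  let ?S = "\<lambda>B. B \<subseteq> carrier X \<and> B \<noteq> {} \<and> L0_balanced M X B \<and> L0_convex M X B"
  show "A \<subseteq> L0_Gamma M X A" unfolding L0_Gamma_def by (rule hull_subset)
  have "balanced (carrier X)" "convex_set (carrier X)" by (auto simp: balanced_def convex_set_def)
  then have "?S (carrier X)" using M.zero_closed by (auto simp: balanced_iff convex_iff)
  then show "L0_Gamma M X A \<subseteq> carrier X"
    unfolding L0_Gamma_def by (intro hull_minimal assms)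
  have "\<zero>\<^bsub>X\<^esub> \<in> B" if "?S B" for B
  proof -
    obtain x where "x \<in> B" using \<open>?S B\<close> by auto
    moreover have "(\<lambda>_. 0) \<cdot> x \<in> B" using that \<open>x \<in> B\<close> by (simp add: balanced_iff balanced_def)
    ultimately show ?thesis using that by (metis scale_zero subsetD)
  qed
  then have "\<zero>\<^bsub>X\<^esub> \<in> L0_Gamma M X A" unfolding L0_Gamma_def hull_def by blast
  then show "L0_Gamma M X A \<noteq> {}" by blast
  show "balanced (L0_Gamma M X A)"
    unfolding L0_Gamma_def hull_def balanced_iff balanced_def by blast
  show "convex_set (L0_Gamma M X A)"
    unfolding L0_Gamma_def hull_def convex_iff convex_set_def by blast
qed

text \<open>A basic neighbourhood is given by suprema of classes; here it becomes an almost sure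
  inequality for a single function-valued seminorm. A representative of the supremum is chosen at
  each vector, and the seminorm estimates follow from leastness.\<close>

lemma finite_Sup_seminorm:
  assumes Q: "finite Q" "\<And>r. r \<in> Q \<Longrightarrow> L0_seminorm M X r"
  obtains p where "seminorm p"
    "\<And>z e. z \<in> carrier X \<Longrightarrow> e \<in> borel_measurable M \<Longrightarrow>
      z \<in> L0_ball M X Q (AE_class M e) \<longleftrightarrow> (AE w in M. p z w \<le> e w)"
proof -
  have "\<exists>f. f \<in> borel_measurable M \<and> L0_is_Sup M ((\<lambda>r. r x) ` Q) (AE_class M f) \<and> (AE w in M. 0 \<le> f w)" for x
  proof -
    obtain s where "L0_is_Sup M ((\<lambda>r. r x) ` Q) s" using L0_finite_Sup Q(1) by blast
    moreover from this obtain f where "f \<in> borel_measurable M" "s = AE_class M f" "AE w in M. 0 \<le> f w"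
      by (auto simp: L0_is_Sup_iff L0_plus_iff)
    ultimately show ?thesis by blast
  qed
  then obtain p where p: "\<And>x. p x \<in> borel_measurable M"
      "\<And>x. L0_is_Sup M ((\<lambda>r. r x) ` Q) (AE_class M (p x))" "\<And>x. AE w in M. 0 \<le> p x w"
    by metis
  note p(1)[measurable]
  have "\<exists>g. g \<in> borel_measurable M \<and> r x = AE_class M g \<and> (AE w in M. 0 \<le> g w)"
    if "r \<in> Q" "x \<in> carrier X" for r x
    using Q(2)[OF that(1)] that(2) by (auto simp: L0_seminorm_def Pi_iff L0_plus_iff)
  then obtain g where g: "\<And>r x. r \<in> Q \<Longrightarrow> x \<in> carrier X \<Longrightarrow> g r x \<in> borel_measurable M"
      "\<And>r x. r \<in> Q \<Longrightarrow> x \<in> carrier X \<Longrightarrow> r x = AE_class M (g r x)"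
      "\<And>r x. r \<in> Q \<Longrightarrow> x \<in> carrier X \<Longrightarrow> AE w in M. 0 \<le> g r x w"
    by metis
  have plus: "r x \<in> L0_plus M" if "r \<in> Q" "x \<in> carrier X" for r x
    using g[OF that] by (auto simp: L0_plus_iff)
  have upper: "AE w in M. g r x w \<le> p x w" if "r \<in> Q" "x \<in> carrier X" for r x
  proof -
    have "L0_le M (r x) (AE_class M (p x))"
      using p(2)[of x] plus[OF that] that(1) by (auto simp: L0_is_Sup_iff)
    then show ?thesis using g(1)[OF that] by (simp add: g(2)[OF that] L0_le_class)
  qed
  \<comment> \<open>The supremum is formed among nonnegative classes, so \<open>u\<close> must be
    nonnegative; for empty \<open>Q\<close> this is the only constraint and yields
    \<open>p = 0\<close>.\<close>
  have least: "AE w in M. p x w \<le> u w"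
    if u: "u \<in> borel_measurable M" "AE w in M. 0 \<le> u w" and x: "x \<in> carrier X"
      and le: "\<And>r. r \<in> Q \<Longrightarrow> AE w in M. g r x w \<le> u w" for x u
  proof -
    have "L0_le M y (AE_class M u)" if "y \<in> (\<lambda>r. r x) ` Q \<inter> L0_plus M" for y
    proof -
      from that obtain r where r: "r \<in> Q" "y = r x" by blast
      then show ?thesis
        using le[OF r(1)] g(1)[OF r(1) x] u(1) by (simp add: g(2)[OF r(1) x] L0_le_class)
    qed
    moreover have "AE_class M u \<in> L0_plus M" using u by (auto simp: L0_plus_iff)
    ultimately have "L0_le M (AE_class M (p x)) (AE_class M u)"
      using p(2)[of x] by (simp add: L0_is_Sup_iff)
    then show ?thesis using u by (simp add: L0_le_class)
  qed
  have "seminorm p"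
    unfolding seminorm_def
  proof (intro conjI ballI)
    fix x y assume x: "x \<in> carrier X" and y: "y \<in> carrier X"
    have xy: "x \<oplus>\<^bsub>X\<^esub> y \<in> carrier X" using x y by simp
    show "AE w in M. p (x \<oplus>\<^bsub>X\<^esub> y) w \<le> p x w + p y w"
    proof (rule least[OF _ _ xy])
      show "AE w in M. 0 \<le> p x w + p y w" using p(3)[of x] p(3)[of y] by eventually_elim simp
      fix r assume r: "r \<in> Q"
      have "L0_le M (r (x \<oplus>\<^bsub>X\<^esub> y)) (r x \<oplus>\<^bsub>L0 M\<^esub> r y)"
        using Q(2)[OF r] x y by (simp add: L0_seminorm_def)
      then have "AE w in M. g r (x \<oplus>\<^bsub>X\<^esub> y) w \<le> g r x w + g r y w"
        using g(1)[OF r x] g(1)[OF r y] g(1)[OF r xy]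
        by (simp add: g(2)[OF r x] g(2)[OF r y] g(2)[OF r xy] L0_add_class L0_le_class)
      with upper[OF r x] upper[OF r y]
      show "AE w in M. g r (x \<oplus>\<^bsub>X\<^esub> y) w \<le> p x w + p y w" by eventually_elim simp
    qed measurable
  next
    fix \<eta> :: "'w \<Rightarrow> 'k" and x
    assume \<eta> [measurable]: "\<eta> \<in> borel_measurable M" and x: "x \<in> carrier X"
    have \<eta>x: "\<eta> \<cdot> x \<in> carrier X" using x by simp
    show "AE w in M. p (\<eta> \<cdot> x) w \<le> norm (\<eta> w) * p x w"
    proof (rule least[OF _ _ \<eta>x])
      show "AE w in M. 0 \<le> norm (\<eta> w) * p x w" using p(3)[of x] by eventually_elim simp
      fix r assume r: "r \<in> Q"
      have "r (\<eta> \<cdot> x) = L0_abs M (AE_class M \<eta>) \<otimes>\<^bsub>L0 M\<^esub> r x"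
        using Q(2)[OF r] x by (simp add: L0_seminorm_def scale_def)
      then have "AE w in M. g r (\<eta> \<cdot> x) w = norm (\<eta> w) * g r x w"
        using g(1)[OF r x] g(1)[OF r \<eta>x]
        by (simp add: g(2)[OF r x] g(2)[OF r \<eta>x] L0_abs_class L0_mult_class AE_class_eq_iff)
      with upper[OF r x] show "AE w in M. g r (\<eta> \<cdot> x) w \<le> norm (\<eta> w) * p x w"
        by eventually_elim (simp add: mult_left_mono)
    qed measurable
  qed (rule p(1))
  moreover have "z \<in> L0_ball M X Q (AE_class M e) \<longleftrightarrow> (AE w in M. p z w \<le> e w)"
    if z: "z \<in> carrier X" and e: "e \<in> borel_measurable M" for z e
  proof
    assume "z \<in> L0_ball M X Q (AE_class M e)"
    then obtain s where s: "L0_is_Sup M ((\<lambda>r. r z) ` Q) s" "L0_le M s (AE_class M e)"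
      by (auto simp: L0_ball_def)
    then have "L0_le M (AE_class M (p z)) s" "s \<in> carrier (L0 M)"
      using p(2)[of z] by (auto simp: L0_is_Sup_iff L0_plus_def)
    then have "L0_le M (AE_class M (p z)) (AE_class M e)" using s(2) L0_le_trans by blast
    then show "AE w in M. p z w \<le> e w" using e by (simp add: L0_le_class)
  next
    assume "AE w in M. p z w \<le> e w"
    then have "L0_le M (AE_class M (p z)) (AE_class M e)" using e by (simp add: L0_le_class)
    then show "z \<in> L0_ball M X Q (AE_class M e)" using p(2)[of z] z by (auto simp: L0_ball_def)
  qed
  ultimately show ?thesis using that by blast
qed


section \<open>Homomorphisms into the scalars\<close>

text \<open>Representatives are chosen independently at each vector, so linearity of
  \<open>\<Phi>\<close> becomes a family of almost sure identities whose null sets depend on the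
  arguments.\<close>

definition is_repr :: "('x \<Rightarrow> ('w \<Rightarrow> 'k) set) \<Rightarrow> ('x \<Rightarrow> 'w \<Rightarrow> 'k) \<Rightarrow> bool" where
  "is_repr \<Phi> F \<longleftrightarrow> (\<forall>x\<in>carrier X. F x \<in> borel_measurable M \<and> \<Phi> x = AE_class M (F x))"

lemma module_hom_repr_iff:
  assumes F: "is_repr \<Phi> F"
  shows "\<Phi> \<in> module_homs (L0 M) X (L0 M) \<longleftrightarrow>
    (\<forall>x\<in>carrier X. \<forall>y\<in>carrier X. AE w in M. F (x \<oplus>\<^bsub>X\<^esub> y) w = F x w + F y w) \<and>
    (\<forall>\<eta>\<in>borel_measurable M. \<forall>x\<in>carrier X. AE w in M. F (\<eta> \<cdot> x) w = \<eta> w * F x w)"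
proof -
  note [measurable] = bspec[OF F[unfolded is_repr_def], THEN conjunct1]
  have eq: "\<Phi> x = AE_class M (F x)" if "x \<in> carrier X" for x using F that by (simp add: is_repr_def)
  have add: "\<Phi> (x \<oplus>\<^bsub>X\<^esub> y) = \<Phi> x \<oplus>\<^bsub>L0 M\<^esub> \<Phi> y \<longleftrightarrow> (AE w in M. F (x \<oplus>\<^bsub>X\<^esub> y) w = F x w + F y w)"
    if "x \<in> carrier X" "y \<in> carrier X" for x y
    using that by (simp add: eq L0_add_class AE_class_eq_iff)
  have smult: "\<Phi> (AE_class M \<eta> \<odot>\<^bsub>X\<^esub> x) = AE_class M \<eta> \<odot>\<^bsub>L0 M\<^esub> \<Phi> x \<longleftrightarrow> (AE w in M. F (\<eta> \<cdot> x) w = \<eta> w * F x w)"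
    if [measurable]: "\<eta> \<in> borel_measurable M" and "x \<in> carrier X" for \<eta> x
    using that by (simp add: eq L0_smult L0_mult_class AE_class_eq_iff flip: scale_def)
  have "(\<forall>r\<in>carrier (L0 M). \<forall>x\<in>carrier X. \<Phi> (r \<odot>\<^bsub>X\<^esub> x) = r \<odot>\<^bsub>L0 M\<^esub> \<Phi> x) \<longleftrightarrow>
      (\<forall>\<eta>\<in>borel_measurable M. \<forall>x\<in>carrier X. AE w in M. F (\<eta> \<cdot> x) w = \<eta> w * F x w)"
  proof (intro iffI ballI)
    fix \<eta> :: "'w \<Rightarrow> 'k" and x
    assume "\<forall>r\<in>carrier (L0 M). \<forall>x\<in>carrier X. \<Phi> (r \<odot>\<^bsub>X\<^esub> x) = r \<odot>\<^bsub>L0 M\<^esub> \<Phi> x"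
      and \<eta>: "\<eta> \<in> borel_measurable M" and x: "x \<in> carrier X"
    then have "\<Phi> (AE_class M \<eta> \<odot>\<^bsub>X\<^esub> x) = AE_class M \<eta> \<odot>\<^bsub>L0 M\<^esub> \<Phi> x"
      using class_carrier by blast
    then show "AE w in M. F (\<eta> \<cdot> x) w = \<eta> w * F x w" using smult[OF \<eta> x] by blast
  next
    fix r :: "('w \<Rightarrow> 'k) set" and x
    assume *: "\<forall>\<eta>\<in>borel_measurable M. \<forall>x\<in>carrier X. AE w in M. F (\<eta> \<cdot> x) w = \<eta> w * F x w"
      and r: "r \<in> carrier (L0 M)" and x: "x \<in> carrier X"
    obtain \<eta> where \<eta>: "\<eta> \<in> borel_measurable M" "r = AE_class M \<eta>" using r by (auto simp: L0_carrier_iff)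
    then show "\<Phi> (r \<odot>\<^bsub>X\<^esub> x) = r \<odot>\<^bsub>L0 M\<^esub> \<Phi> x" using * x smult[OF \<eta>(1) x] by blast
  qed
  moreover have "(\<forall>x\<in>carrier X. \<forall>y\<in>carrier X. \<Phi> (x \<oplus>\<^bsub>X\<^esub> y) = \<Phi> x \<oplus>\<^bsub>L0 M\<^esub> \<Phi> y) \<longleftrightarrow>
      (\<forall>x\<in>carrier X. \<forall>y\<in>carrier X. AE w in M. F (x \<oplus>\<^bsub>X\<^esub> y) w = F x w + F y w)"
    using add by blast
  moreover have "\<Phi> \<in> carrier X \<rightarrow> carrier (L0 M)" by (auto simp: eq)
  ultimately show ?thesis unfolding module_homs_def by blast
qed

lemma module_hom_repr:
  assumes "\<Phi> \<in> module_homs (L0 M) X (L0 M)"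
  obtains F where "is_repr \<Phi> F"
proof -
  have "\<exists>f. f \<in> borel_measurable M \<and> \<Phi> x = AE_class M f" if "x \<in> carrier X" for x
    using assms that by (auto simp: module_homs_def Pi_iff L0_carrier_iff)
  then show ?thesis using that unfolding is_repr_def by metis
qed

text \<open>For the functional given by \<open>y\<close> this is the polar of \<open>{y}\<close> in
  \<open>X\<close>. Hence a bipolar is an intersection of such sets, and the theorem is a statement
  about which of them contain \<open>A\<close>.\<close>

definition unit_set :: "('x \<Rightarrow> ('w \<Rightarrow> 'k) set) \<Rightarrow> 'x set" where
  "unit_set \<Phi> = {x \<in> carrier X. L0_le M (L0_abs M (\<Phi> x)) \<one>\<^bsub>L0 M\<^esub>}"

lemma unit_set_iff:
  "is_repr \<Phi> F \<Longrightarrow> x \<in> carrier X \<Longrightarrow> x \<in> unit_set \<Phi> \<longleftrightarrow> (AE w in M. norm (F x w) \<le> 1)"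
  by (simp add: unit_set_def is_repr_def L0_le_one_iff)

lemma
  assumes \<Phi>: "\<Phi> \<in> module_homs (L0 M) X (L0 M)"
  shows balanced_unit_set: "balanced (unit_set \<Phi>)"
    and convex_unit_set: "convex_set (unit_set \<Phi>)"
    and zero_mem_unit_set: "\<zero>\<^bsub>X\<^esub> \<in> unit_set \<Phi>"
    and Hcc_unit_set: "Hcc M X (unit_set \<Phi>) \<subseteq> unit_set \<Phi>"
proof -
  obtain F where F: "is_repr \<Phi> F" using module_hom_repr[OF \<Phi>] .
  have add: "AE w in M. F (x \<oplus>\<^bsub>X\<^esub> y) w = F x w + F y w" if "x \<in> carrier X" "y \<in> carrier X" for x y
    using \<Phi> that by (simp add: module_hom_repr_iff[OF F])
  have scale: "AE w in M. F (\<eta> \<cdot> x) w = \<eta> w * F x w" if "\<eta> \<in> borel_measurable M" "x \<in> carrier X" for \<eta> x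
    using \<Phi> that by (simp add: module_hom_repr_iff[OF F])
  have sub: "unit_set \<Phi> \<subseteq> carrier X" by (auto simp: unit_set_def)
  note iff = unit_set_iff[OF F]
  show "balanced (unit_set \<Phi>)"
    unfolding balanced_def
  proof (intro ballI impI)
    fix \<eta> :: "'w \<Rightarrow> 'k" and x
    assume \<eta>: "\<eta> \<in> borel_measurable M" "\<forall>w. norm (\<eta> w) \<le> 1" and x: "x \<in> unit_set \<Phi>"
    have xc: "x \<in> carrier X" using x sub by blast
    have "AE w in M. norm (F x w) \<le> 1" using iff xc x by blast
    with scale[OF \<eta>(1) xc] have "AE w in M. norm (F (\<eta> \<cdot> x) w) \<le> 1"
      by eventually_elim (use \<eta>(2) in \<open>simp add: norm_mult mult_le_one\<close>)
    then show "\<eta> \<cdot> x \<in> unit_set \<Phi>" using iff[of "\<eta> \<cdot> x"] \<eta>(1) xc by simp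
  qed
  show "convex_set (unit_set \<Phi>)"
    unfolding convex_set_def
  proof (intro ballI impI)
    fix t :: "'w \<Rightarrow> real" and x y
    assume t [measurable]: "t \<in> borel_measurable M" and t01: "\<forall>w. 0 \<le> t w \<and> t w \<le> 1"
      and x: "x \<in> unit_set \<Phi>" and y: "y \<in> unit_set \<Phi>"
    have xc: "x \<in> carrier X" and yc: "y \<in> carrier X" using x y sub by blast+
    let ?z = "t \<cdot>\<^sub>R x \<oplus>\<^bsub>X\<^esub> (\<lambda>w. 1 - t w) \<cdot>\<^sub>R y"
    have tx: "t \<cdot>\<^sub>R x \<in> carrier X" and ty: "(\<lambda>w. 1 - t w) \<cdot>\<^sub>R y \<in> carrier X"
      using xc yc by (auto intro!: scale_closed simp del: of_real_diff)
    have "AE w in M. norm (F x w) \<le> 1" "AE w in M. norm (F y w) \<le> 1" using iff xc yc x y by blast+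
    moreover note add[OF tx ty]
    moreover have "AE w in M. F (t \<cdot>\<^sub>R x) w = of_real (t w) * F x w"
      using xc by (intro scale) auto
    moreover have "AE w in M. F ((\<lambda>w. 1 - t w) \<cdot>\<^sub>R y) w = of_real (1 - t w) * F y w"
      using yc by (intro scale) auto
    ultimately have "AE w in M. norm (F ?z w) \<le> 1"
    proof eventually_elim
      case (elim w)
      have "norm (F ?z w) \<le> norm (of_real (t w) * F x w) + norm (of_real (1 - t w) * F y w)"
        using elim norm_triangle_ineq by metis
      also have "\<dots> = t w * norm (F x w) + (1 - t w) * norm (F y w)"
        using t01 by (simp add: norm_mult del: of_real_diff)
      also have "\<dots> \<le> t w * 1 + (1 - t w) * 1"
        using elim t01 by (intro add_mono mult_left_mono) auto
      finally show ?case by simp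
    qed
    then show "?z \<in> unit_set \<Phi>" using iff[of ?z] tx ty by (simp del: of_real_diff)
  qed
  have "AE w in M. norm (F \<zero>\<^bsub>X\<^esub> w) \<le> 1"
  proof -
    have "AE w in M. F \<zero>\<^bsub>X\<^esub> w = 0" using scale[of "\<lambda>_. 0" "\<zero>\<^bsub>X\<^esub>"] by simp
    then show ?thesis by eventually_elim simp
  qed
  then show "\<zero>\<^bsub>X\<^esub> \<in> unit_set \<Phi>" by (simp add: iff)
  show "Hcc M X (unit_set \<Phi>) \<subseteq> unit_set \<Phi>"
  proof
    fix x assume "x \<in> Hcc M X (unit_set \<Phi>)"
    then obtain g A where g: "range g \<subseteq> unit_set \<Phi>" and A: "countable_partition M A"
      and c: "is_concatenation M X A g x"
      by (auto simp: Hcc_def)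
    have xc: "x \<in> carrier X" using c by (simp add: is_concatenation_def)
    \<comment> \<open>Homomorphisms are local: multiplying by the indicator of \<open>A n\<close>
      shows that the values at \<open>x\<close> and at \<open>g n\<close> agree on that piece.
      Countability of the partition then allows the null sets to be united.\<close>
    have "AE w in M. w \<in> A n \<longrightarrow> norm (F x w) \<le> 1" for n
    proof -
      have gn: "g n \<in> unit_set \<Phi>" using g by auto
      then have gc: "g n \<in> carrier X" using sub by blast
      have "A n \<in> sets M" using A by (auto simp: countable_partition_def)
      then have i: "(indicator (A n) :: 'w \<Rightarrow> 'k) \<in> borel_measurable M" by simp
      have eq: "indicator (A n) \<cdot> x = indicator (A n) \<cdot> g n"
        using c by (simp add: is_concatenation_def L0_indicator_def scale_def)
      have "AE w in M. norm (F (g n) w) \<le> 1" using iff gn gc by blast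
      with scale[OF i xc, unfolded eq] scale[OF i gc] show ?thesis
        by eventually_elim auto
    qed
    then have "AE w in M. \<forall>n. w \<in> A n \<longrightarrow> norm (F x w) \<le> 1" unfolding AE_all_countable by blast
    moreover have "AE w in M. \<exists>n. w \<in> A n"
    proof (rule AE_I2)
      show "\<exists>n. w \<in> A n" if "w \<in> space M" for w
        using A that unfolding countable_partition_def by blast
    qed
    ultimately have "AE w in M. norm (F x w) \<le> 1" by eventually_elim blast
    then show "x \<in> unit_set \<Phi>" using iff xc by blast
  qed
qed

text \<open>The set is the preimage of the unit ball of \<open>L0 M\<close>. A class outside that
  ball exceeds 1 on a nonnull event only, so the neighbourhood separating it has a random radius
  adapted to the excess.\<close>

lemma closedin_unit_set:
  assumes cont: "continuous_map (Tc M X P) (Tc M (L0 M) {L0_abs M}) (restrict \<Phi> (carrier X))"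
  shows "closedin (Tc M X P) (unit_set \<Phi>)"
proof -
  let ?L = "L0 M :: (('w \<Rightarrow> 'k) set, ('w \<Rightarrow> 'k) set) module"
  let ?K = "{\<xi> \<in> carrier ?L. L0_le M (L0_abs M \<xi>) \<one>\<^bsub>L0 M\<^esub>}"
  have topX: "topspace (Tc M X P) = carrier X" by (rule topspace_Tc) unfold_locales
  have "openin (Tc M ?L {L0_abs M}) (carrier ?L - ?K)"
    unfolding openin_Tc
  proof (intro conjI ballI)
    fix \<xi> assume \<xi>: "\<xi> \<in> carrier ?L - ?K"
    then obtain f where f [measurable]: "f \<in> borel_measurable M" and \<xi>f: "\<xi> = AE_class M f"
      by (auto simp: L0_carrier_iff)
    have nf: "\<not> (AE w in M. norm (f w) \<le> 1)" using \<xi> f by (simp add: \<xi>f L0_le_one_iff)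
    \<comment> \<open>Half of the excess over 1, where there is one: a perturbation of that size
      cannot bring the norm down to 1. The value 1 elsewhere only keeps the radius positive.\<close>
    define e where "e w = (if 1 < norm (f w) then (norm (f w) - 1) / 2 else 1)" for w
    have e [measurable]: "e \<in> borel_measurable M" unfolding e_def by measurable
    have "AE_class M e \<in> L0_plusplus M" using e by (auto simp: L0_plusplus_iff e_def)
    moreover have "\<xi> <+\<^bsub>L0 M\<^esub> L0_ball M ?L {L0_abs M} (AE_class M e) \<subseteq> carrier ?L - ?K"
    proof
      fix \<zeta> assume "\<zeta> \<in> \<xi> <+\<^bsub>L0 M\<^esub> L0_ball M ?L {L0_abs M} (AE_class M e)"
      then obtain \<eta> where \<eta>: "\<eta> \<in> L0_ball M ?L {L0_abs M} (AE_class M e)" and \<zeta>: "\<zeta> = \<xi> \<oplus>\<^bsub>L0 M\<^esub> \<eta>"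
        by (auto simp: a_l_coset_def')
      then obtain g where g [measurable]: "g \<in> borel_measurable M" and \<eta>g: "\<eta> = AE_class M g"
        by (auto simp: L0_ball_def L0_carrier_iff)
      have ge: "AE w in M. norm (g w) \<le> e w" using \<eta> by (simp add: \<eta>g L0_ball_abs_iff)
      have \<zeta>fg: "\<zeta> = AE_class M (\<lambda>w. f w + g w)" by (simp add: \<zeta> \<xi>f \<eta>g L0_add_class)
      have "\<not> (AE w in M. norm (f w + g w) \<le> 1)"
      proof
        assume "AE w in M. norm (f w + g w) \<le> 1"
        with ge have "AE w in M. norm (f w) \<le> 1"
        proof eventually_elim
          case (elim w)
          have "norm (f w) \<le> norm (f w + g w) + norm (g w)"
            using norm_triangle_ineq4[of "f w + g w" "g w"] by simp
          then show ?case using elim by (auto simp: e_def split: if_splits)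
        qed
        then show False using nf by simp
      qed
      then show "\<zeta> \<in> carrier ?L - ?K" by (simp add: \<zeta>fg L0_le_one_iff)
    qed
    ultimately show "\<exists>Q \<epsilon>. finite Q \<and> Q \<subseteq> {L0_abs M} \<and> \<epsilon> \<in> L0_plusplus M \<and>
        \<xi> <+\<^bsub>L0 M\<^esub> L0_ball M ?L Q \<epsilon> \<subseteq> carrier ?L - ?K"
      by (intro exI[of _ "{L0_abs M}"] exI[of _ "AE_class M e"] conjI) auto
  qed auto
  then have "closedin (Tc M ?L {L0_abs M}) ?K" by (auto simp: closedin_def topspace_Tc_L0)
  then have "closedin (Tc M X P) {x \<in> topspace (Tc M X P). restrict \<Phi> (carrier X) x \<in> ?K}"
    by (rule closedin_continuous_map_preimage[OF cont])
  moreover have "restrict \<Phi> (carrier X) x \<in> ?K \<longleftrightarrow> L0_le M (L0_abs M (\<Phi> x)) \<one>\<^bsub>L0 M\<^esub>"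
    if "x \<in> carrier X" for x
  proof -
    have "restrict \<Phi> (carrier X) x \<in> carrier ?L"
      using continuous_map_image_subset_topspace[OF cont] that
      unfolding topX topspace_Tc_L0 by (rule subsetD[OF _ imageI])
    then show ?thesis using that by simp
  qed
  then have "{x \<in> topspace (Tc M X P). restrict \<Phi> (carrier X) x \<in> ?K} = unit_set \<Phi>"
    unfolding topX unit_set_def by (intro Collect_cong conj_cong refl)
  ultimately show ?thesis by simp
qed

text \<open>By additivity it suffices to look near zero, where the domination maps the ball of
  random radius \<open>f / l\<close> into the ball of radius \<open>f\<close>.\<close>

lemma continuous_map_of_dominated:
  assumes \<Phi>: "\<Phi> \<in> module_homs (L0 M) X (L0 M)" and F: "is_repr \<Phi> F"
    and Q: "finite Q" "Q \<subseteq> P"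
    and l [measurable]: "l \<in> borel_measurable M" and l0: "\<And>w. 0 < l w"
    and p: "\<And>z e. z \<in> carrier X \<Longrightarrow> e \<in> borel_measurable M \<Longrightarrow>
      z \<in> L0_ball M X Q (AE_class M e) \<longleftrightarrow> (AE w in M. p z w \<le> e w)"
    and dom: "\<And>z. z \<in> carrier X \<Longrightarrow> AE w in M. norm (F z w) \<le> l w * p z w"
  shows "continuous_map (Tc M X P) (Tc M (L0 M) {L0_abs M}) (restrict \<Phi> (carrier X))"
proof -
  let ?L = "L0 M :: (('w \<Rightarrow> 'k) set, ('w \<Rightarrow> 'k) set) module"
  have topX: "topspace (Tc M X P) = carrier X" by (rule topspace_Tc) unfold_locales
  have \<Phi>F: "\<Phi> z = AE_class M (F z)" "F z \<in> borel_measurable M" if "z \<in> carrier X" for z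
    using F that by (simp_all add: is_repr_def)
  have "openin (Tc M X P) {x \<in> carrier X. \<Phi> x \<in> U}" if U: "openin (Tc M ?L {L0_abs M}) U" for U
    unfolding openin_Tc
  proof (intro conjI ballI)
    fix x assume "x \<in> {x \<in> carrier X. \<Phi> x \<in> U}"
    then have x: "x \<in> carrier X" and xU: "\<Phi> x \<in> U" by auto
    obtain R \<epsilon> where R: "R \<subseteq> {L0_abs M}" and \<epsilon>: "\<epsilon> \<in> L0_plusplus M"
      and RU: "\<Phi> x <+\<^bsub>L0 M\<^esub> L0_ball M ?L R \<epsilon> \<subseteq> U"
      using U xU unfolding openin_Tc by blast
    obtain f where f [measurable]: "f \<in> borel_measurable M" and \<epsilon>f: "\<epsilon> = AE_class M f"
      and f0: "AE w in M. 0 < f w"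
      using \<epsilon> by (auto simp: L0_plusplus_iff)
    define d where "d w = f w / l w" for w
    have d [measurable]: "d \<in> borel_measurable M" unfolding d_def by measurable
    have "AE w in M. 0 < d w" using f0 by eventually_elim (simp add: d_def l0)
    then have dpp: "AE_class M d \<in> L0_plusplus M" using d by (auto simp: L0_plusplus_iff)
    have "x <+\<^bsub>X\<^esub> L0_ball M X Q (AE_class M d) \<subseteq> {x \<in> carrier X. \<Phi> x \<in> U}"
    proof
      fix y assume "y \<in> x <+\<^bsub>X\<^esub> L0_ball M X Q (AE_class M d)"
      then obtain z where z: "z \<in> L0_ball M X Q (AE_class M d)" and y: "y = x \<oplus>\<^bsub>X\<^esub> z"
        by (auto simp: a_l_coset_def')
      have zc: "z \<in> carrier X" using z by (simp add: L0_ball_def)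
      have "AE w in M. p z w \<le> d w" using z zc by (simp add: p)
      with dom[OF zc] have "AE w in M. norm (F z w) \<le> f w"
      proof eventually_elim
        case (elim w)
        have "l w * p z w \<le> l w * d w" using elim(2) l0[of w] by simp
        also have "\<dots> = f w" using l0[of w] by (simp add: d_def)
        finally show ?case using elim(1) by simp
      qed
      then have "\<Phi> z \<in> L0_ball M ?L {L0_abs M} \<epsilon>"
        using zc by (simp add: \<Phi>F \<epsilon>f L0_ball_abs_iff)
      \<comment> \<open>Basic neighbourhoods in the scalars may also come from the empty family,
        hence the passage from \<open>{L0_abs M}\<close> to \<open>R\<close>.\<close>
      moreover have "L0_ball M ?L {L0_abs M} \<epsilon> \<subseteq> L0_ball M ?L R \<epsilon>"
        using R by (intro L0_ball_mono) (auto simp: \<epsilon>f L0_le_class)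
      ultimately have "\<Phi> x \<oplus>\<^bsub>L0 M\<^esub> \<Phi> z \<in> \<Phi> x <+\<^bsub>L0 M\<^esub> L0_ball M ?L R \<epsilon>"
        by (auto simp: a_l_coset_def')
      moreover have "\<Phi> y = \<Phi> x \<oplus>\<^bsub>L0 M\<^esub> \<Phi> z" using \<Phi> x zc by (simp add: y module_homs_def)
      ultimately show "y \<in> {x \<in> carrier X. \<Phi> x \<in> U}" using RU x zc by (auto simp: y)
    qed
    then show "\<exists>Q \<epsilon>. finite Q \<and> Q \<subseteq> P \<and> \<epsilon> \<in> L0_plusplus M \<and>
        x <+\<^bsub>X\<^esub> L0_ball M X Q \<epsilon> \<subseteq> {x \<in> carrier X. \<Phi> x \<in> U}"
      using Q dpp by blast
  qed auto
  moreover have "{x \<in> carrier X. restrict \<Phi> (carrier X) x \<in> U} = {x \<in> carrier X. \<Phi> x \<in> U}" for U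
    by (intro Collect_cong conj_cong refl) simp
  moreover have "restrict \<Phi> (carrier X) \<in> carrier X \<rightarrow> carrier ?L"
    using \<Phi>F by (intro Pi_I) simp
  ultimately show ?thesis by (simp add: continuous_map_def topX topspace_Tc_L0)
qed

end


section \<open>The bipolar theorem\<close>

locale rc_random_module = random_module M X
  for M :: "'w measure" and X :: "(('w \<Rightarrow> 'k::real_or_complex) set, 'x, 'm) module_scheme"
begin

text \<open>The Hahn-Banach functional \<open>f\<close> is the real part of the functional
  \<open>F\<close> built from it by means of \<open>j\<close>. Domination of \<open>f\<close> by
  \<open>q\<close> yields that of \<open>norm F\<close> by rotating \<open>x\<close>, and attainment
  at \<open>x0\<close> passes from \<open>f\<close> to \<open>F\<close> because the real part is at
  most the norm.\<close>

lemma supporting_functional: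
  assumes q: "seminorm q" and x0: "x0 \<in> carrier X"
  obtains \<Phi> F where "\<Phi> \<in> module_homs (L0 M) X (L0 M)" "is_repr \<Phi> F"
    "\<And>x. x \<in> carrier X \<Longrightarrow> AE w in M. norm (F x w) \<le> q x w"
    "AE w in M. q x0 w \<le> norm (F x0 w)"
proof -
  obtain re :: "'k \<Rightarrow> real" and j :: 'k where re: "linear re" "\<And>z. \<bar>re z\<bar> \<le> norm z"
      "\<And>z. z = of_real (re z) - j * of_real (re (j * z))"
      "\<And>a. re (of_real a) = a" "\<And>a. re (j * of_real a) = 0" and j: "j * j = - 1 \<or> j = 0"
    using real_or_complex_real_part by blast
  have "bounded_linear re"
    by (rule bounded_linear_intro[where K = 1])
      (use re(1,2) in \<open>simp_all add: linear_add linear_scale\<close>)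
  then have "continuous_on UNIV re" by (simp add: linear_continuous_on)
  then have [measurable]: "re \<in> borel_measurable borel" by (rule borel_measurable_continuous_onI)
  obtain f where f: "\<And>x. x \<in> carrier X \<Longrightarrow> f x \<in> borel_measurable M"
    and f_add: "\<And>x y. x \<in> carrier X \<Longrightarrow> y \<in> carrier X \<Longrightarrow> AE w in M. f (x \<oplus>\<^bsub>X\<^esub> y) w = f x w + f y w"
    and f_scale: "\<And>t x. t \<in> borel_measurable M \<Longrightarrow> x \<in> carrier X \<Longrightarrow> AE w in M. f (t \<cdot>\<^sub>R x) w = t w * f x w"
    and f_le: "\<And>x. x \<in> carrier X \<Longrightarrow> AE w in M. f x w \<le> q x w"
    and f_x0: "AE w in M. q x0 w \<le> f x0 w"
    using Hahn_Banach[OF sublinear_seminorm[OF q] x0] by blast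
  define J where "J x = (\<lambda>_. j) \<cdot> x" for x
  have J [simp]: "J x \<in> carrier X" if "x \<in> carrier X" for x using that by (simp add: J_def)
  define F where "F x w = of_real (f x w) - j * of_real (f (J x) w)" for x w
  define \<Phi> where "\<Phi> x = AE_class M (F x)" for x
  have F_meas: "F x \<in> borel_measurable M" if "x \<in> carrier X" for x
  proof -
    note [measurable] = f[OF that] f[OF J[OF that]]
    show ?thesis unfolding F_def by measurable
  qed
  have repr: "is_repr \<Phi> F" by (simp add: is_repr_def \<Phi>_def F_meas)
  have F_add: "AE w in M. F (x \<oplus>\<^bsub>X\<^esub> y) w = F x w + F y w" if x: "x \<in> carrier X" and y: "y \<in> carrier X" for x y
  proof -
    have "J (x \<oplus>\<^bsub>X\<^esub> y) = J x \<oplus>\<^bsub>X\<^esub> J y" using x y by (simp add: J_def scale_add_right)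
    note J_add = this
    from f_add[OF x y] f_add[OF J[OF x] J[OF y]] show ?thesis
      by eventually_elim (simp add: F_def J_add algebra_simps)
  qed
  have F_scale: "AE w in M. F (\<eta> \<cdot> x) w = \<eta> w * F x w"
    if \<eta> [measurable]: "\<eta> \<in> borel_measurable M" and x: "x \<in> carrier X" for \<eta> x
  proof -
    \<comment> \<open>The real and imaginary parts of \<open>\<eta>\<close>. Over the reals
      \<open>j = 0\<close>, so \<open>b = 0\<close> and the same formula covers both scalar
      fields.\<close>
    define a b where "a w = re (\<eta> w)" and "b w = - re (j * \<eta> w)" for w
    have a [measurable]: "a \<in> borel_measurable M" and b [measurable]: "b \<in> borel_measurable M"
      unfolding a_def b_def by measurable
    have nb: "(\<lambda>w. - b w) \<in> borel_measurable M" by measurable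
    have \<eta>ab: "\<eta> w = of_real (a w) + j * of_real (b w)" for w
      using re(3)[of "\<eta> w"] by (simp add: a_def b_def)
    have \<eta>_eq: "\<eta> = (\<lambda>w. of_real (a w) + of_real (b w) * j)"
      by (rule ext) (metis \<eta>ab mult.commute)
    have "\<eta> \<cdot> x = (\<lambda>w. of_real (a w) + of_real (b w) * j) \<cdot> x"
      by (subst \<eta>_eq) (rule refl)
    also have "\<dots> = a \<cdot>\<^sub>R x \<oplus>\<^bsub>X\<^esub> b \<cdot>\<^sub>R J x"
      using x by (simp add: J_def scale_add_left scale_scale)
    finally have \<eta>x: "\<eta> \<cdot> x = a \<cdot>\<^sub>R x \<oplus>\<^bsub>X\<^esub> b \<cdot>\<^sub>R J x" .
    have ax: "a \<cdot>\<^sub>R y \<in> carrier X" "b \<cdot>\<^sub>R y \<in> carrier X" if "y \<in> carrier X" for y using that by simp_all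
    have 1: "AE w in M. f (\<eta> \<cdot> x) w = a w * f x w + b w * f (J x) w"
      using f_add[OF ax(1)[OF x] ax(2)[OF J[OF x]]] f_scale[OF a x] f_scale[OF b J[OF x]]
      unfolding \<eta>x by eventually_elim simp
    show ?thesis
    proof (cases "j = 0")
      case True
      then have "b w = 0" for w using linear_0[OF re(1)] by (simp add: b_def)
      note b0 = this
      from 1 show ?thesis by eventually_elim (simp add: F_def \<eta>ab True b0)
    next
      case False
      then have jj: "j * j = - 1" using j by simp
      have "J (\<eta> \<cdot> x) = (\<lambda>w. of_real (a w) * j + of_real (- b w)) \<cdot> x"
      proof -
        have "j * \<eta> w = of_real (a w) * j + of_real (- b w)" for w
          by (simp add: \<eta>ab distrib_left mult.commute jj flip: mult.assoc)
        then show ?thesis using x by (simp add: J_def scale_scale)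
      qed
      also have "\<dots> = (\<lambda>w. of_real (a w) * j) \<cdot> x \<oplus>\<^bsub>X\<^esub> (\<lambda>w. - b w) \<cdot>\<^sub>R x"
        using x by (intro scale_add_left) auto
      also have "(\<lambda>w. of_real (a w) * j) \<cdot> x = a \<cdot>\<^sub>R J x"
        using x by (simp add: J_def scale_scale)
      finally have J\<eta>x: "J (\<eta> \<cdot> x) = a \<cdot>\<^sub>R J x \<oplus>\<^bsub>X\<^esub> (\<lambda>w. - b w) \<cdot>\<^sub>R x" .
      have nbx: "(\<lambda>w. - b w) \<cdot>\<^sub>R x \<in> carrier X" using x by (intro scale_closed) auto
      have 2: "AE w in M. f (J (\<eta> \<cdot> x)) w = a w * f (J x) w - b w * f x w"
        using f_add[OF ax(1)[OF J[OF x]] nbx] f_scale[OF a J[OF x]] f_scale[OF nb x]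
        unfolding J\<eta>x by eventually_elim simp
      from 1 2 show ?thesis
      proof eventually_elim
        case (elim w)
        have "(of_real a + j * of_real b) * (of_real c - j * of_real d)
            = of_real (a * c) - (j * j) * of_real (b * d) - j * of_real (a * d - b * c)" for a b c d
          by (simp add: algebra_simps)
        then show ?case unfolding \<eta>ab F_def elim by (simp add: jj)
      qed
    qed
  qed
  have reF: "re (F x w) = f x w" for x w
    by (simp add: F_def linear_diff[OF re(1)] re(4,5))
  have F_le: "AE w in M. norm (F x w) \<le> q x w" if x: "x \<in> carrier X" for x
  proof -
    note [measurable] = F_meas[OF x]
    \<comment> \<open>The inverse phase of \<open>F x\<close>, equal to 0 where \<open>F x\<close>
      vanishes: it makes \<open>F (\<theta> x)\<close> the real number \<open>norm (F x)\<close>, to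
      which the bound on the real part applies.\<close>
    define \<theta> where "\<theta> w = of_real (norm (F x w)) / F x w" for w
    have \<theta> [measurable]: "\<theta> \<in> borel_measurable M" unfolding \<theta>_def by measurable
    have \<theta>x: "\<theta> \<cdot> x \<in> carrier X" using x by simp
    show ?thesis
      using F_scale[OF \<theta> x] f_le[OF \<theta>x] seminorm_scale_le[OF q \<theta> x] seminorm_nonneg[OF q x]
    proof eventually_elim
      case (elim w)
      have "\<theta> w * F x w = of_real (norm (F x w))" by (simp add: \<theta>_def)
      then have "norm (F x w) = re (F (\<theta> \<cdot> x) w)" using elim(1) re(4) by simp
      also have "\<dots> \<le> norm (\<theta> w) * q x w" using elim(2,3) by (simp add: reF)
      also have "\<dots> \<le> 1 * q x w"
        using elim(4) by (intro mult_right_mono) (auto simp: \<theta>_def norm_divide)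
      finally show ?case by simp
    qed
  qed
  have "AE w in M. q x0 w \<le> norm (F x0 w)"
    using f_x0
  proof eventually_elim
    case (elim w)
    then show ?case using re(2)[of "F x0 w"] by (simp add: reF)
  qed
  moreover have "\<Phi> \<in> module_homs (L0 M) X (L0 M)"
    unfolding module_hom_repr_iff[OF repr] using F_add F_scale by blast
  ultimately show ?thesis using that repr F_le by blast
qed

text \<open>Let \<open>p\<close> be the seminorm of a basic neighbourhood of \<open>x\<close> avoiding the concatenations of
  elements of \<open>G\<close>. If \<open>x\<close> could be approximated by elements of \<open>G\<close> almost everywhere, concatenating
  the approximants would produce a point of that neighbourhood. So the distance from \<open>x\<close> to \<open>G\<close> is
  bounded below on a nonnull event.\<close>

lemma separation:
  assumes ccp: "countable_concatenation_property M X"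
    and P: "\<And>r. r \<in> P \<Longrightarrow> L0_seminorm M X r"
    and G: "G \<subseteq> carrier X" "G \<noteq> {}" "balanced G" "convex_set G"
    and x: "x \<in> carrier X" and notin: "x \<notin> Tc M X P closure_of (Hcc M X G)"
  obtains \<Phi> where "\<Phi> \<in> module_homs (L0 M) X (L0 M)"
    "continuous_map (Tc M X P) (Tc M (L0 M) {L0_abs M}) (restrict \<Phi> (carrier X))"
    "G \<subseteq> unit_set \<Phi>" "x \<notin> unit_set \<Phi>"
proof -
  have "topspace (Tc M X P) = carrier X" by (rule topspace_Tc) unfold_locales
  then obtain U where U: "openin (Tc M X P) U" "x \<in> U" and disj: "U \<inter> Hcc M X G = {}"
    using notin x unfolding in_closure_of by auto
  obtain Q \<epsilon> where Q: "finite Q" "Q \<subseteq> P" and \<epsilon>: "\<epsilon> \<in> L0_plusplus M"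
    and QU: "x <+\<^bsub>X\<^esub> L0_ball M X Q \<epsilon> \<subseteq> U"
    using U unfolding openin_Tc by blast
  obtain f where f [measurable]: "f \<in> borel_measurable M" and \<epsilon>f: "\<epsilon> = AE_class M f"
    and f0: "AE w in M. 0 < f w"
    using \<epsilon> by (auto simp: L0_plusplus_iff)
  \<comment> \<open>A representative of the radius that is positive at every point, so that division
    by it is always harmless.\<close>
  define e where "e w = (if 0 < f w then f w else 1)" for w
  have e [measurable]: "e \<in> borel_measurable M" unfolding e_def by measurable
  have e0: "0 < e w" for w by (simp add: e_def)
  have "AE w in M. f w = e w" using f0 by eventually_elim (simp add: e_def)
  then have \<epsilon>e: "\<epsilon> = AE_class M e" by (simp add: \<epsilon>f AE_class_eq_iff)
  obtain p where p: "seminorm p"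
    and ball: "\<And>z e. z \<in> carrier X \<Longrightarrow> e \<in> borel_measurable M \<Longrightarrow>
      z \<in> L0_ball M X Q (AE_class M e) \<longleftrightarrow> (AE w in M. p z w \<le> e w)"
    using finite_Sup_seminorm[of Q] Q P by blast
  define m where "m h = x \<oplus>\<^bsub>X\<^esub> (\<lambda>_. - 1) \<cdot> h" for h
  have m [simp]: "m h \<in> carrier X" if "h \<in> carrier X" for h using that x by (simp add: m_def)
  have GX: "h \<in> carrier X" if "h \<in> G" for h using that G(1) by blast
  have pm: "(\<lambda>h. p (m h)) ` G \<subseteq> borel_measurable M"
    using seminorm_measurable[OF p] GX by auto
  have ne: "(\<lambda>h. p (m h)) ` G \<noteq> {}" using G(2) by simp
  \<comment> \<open>A countable family of distances that determines the distance from
    \<open>x\<close> to \<open>G\<close>. On \<open>D\<close>, where all of them are at least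
    \<open>e\<close>, the radius \<open>e\<close> is a lower bound and therefore bounds every
    distance from \<open>x\<close> to a point of \<open>G\<close>.\<close>
  obtain D0 where D0: "range D0 \<subseteq> (\<lambda>h. p (m h)) ` G"
    and inf: "\<And>d. d \<in> (\<lambda>h. p (m h)) ` G \<Longrightarrow> AE w in M. \<forall>u. (\<forall>n::nat. u \<le> D0 n w) \<longrightarrow> u \<le> d w"
    using ess_inf_sequence[OF ne pm] by blast
  have "\<exists>h. h \<in> G \<and> D0 n = p (m h)" for n using D0 by auto
  then obtain g where g: "\<And>n. g n \<in> G" "\<And>n. D0 n = p (m (g n))" by metis
  have [measurable]: "D0 n \<in> borel_measurable M" for n using D0 pm by blast
  define D where "D = {w. \<forall>n. e w \<le> D0 n w}"
  have far: "AE w in M. w \<in> D \<longrightarrow> e w \<le> p (m h) w" if "h \<in> G" for h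
    using inf[OF imageI[OF that]] by eventually_elim (simp add: D_def)
  have D_nonnull: "\<not> (AE w in M. w \<notin> D)"
  proof
    assume nD: "AE w in M. w \<notin> D"
    \<comment> \<open>The first index whose approximant is closer than \<open>e\<close>. Such an
      index exists off \<open>D\<close>, hence almost surely here; the arbitrary value of
      \<open>LEAST\<close> on \<open>D\<close> affects only a null set. The level sets of
      \<open>N\<close> are the partition along which the approximants are glued.\<close>
    define N where "N w = (LEAST n. D0 n w < e w)" for w
    have N [measurable]: "N \<in> measurable M (count_space UNIV)" unfolding N_def by measurable
    define C where "C n = N -` {n} \<inter> space M" for n
    have C [measurable]: "C n \<in> sets M" for n unfolding C_def by measurable
    have part: "countable_partition M C"
      by (auto simp: countable_partition_def disjoint_family_on_def C) (auto simp: C_def)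
    have "range g \<subseteq> carrier X" using g(1) GX by auto
    then obtain h where h: "is_concatenation M X C g h"
      using ccp part unfolding countable_concatenation_property_def by blast
    have hc: "h \<in> carrier X" using h by (simp add: is_concatenation_def)
    have "range g \<subseteq> G" using g(1) by auto
    then have hH: "h \<in> Hcc M X G" unfolding Hcc_def using part h by blast
    have "AE w in M. w \<in> C n \<longrightarrow> p (m h) w = D0 n w" for n
    proof -
      let ?i = "indicator (C n) :: 'w \<Rightarrow> real"
      have i: "?i \<in> borel_measurable M" by simp
      have iK: "(indicator (C n) :: 'w \<Rightarrow> 'k) \<in> borel_measurable M" by simp
      have ind: "(\<lambda>w. of_real (?i w) :: 'k) = indicator (C n)" by (auto simp: indicator_def)
      have gn: "g n \<in> carrier X" using g(1) GX by blast
      have "indicator (C n) \<cdot> h = indicator (C n) \<cdot> g n"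
        using h by (simp add: is_concatenation_def L0_indicator_def scale_def)
      moreover have "indicator (C n) \<cdot> (\<lambda>_. - 1) \<cdot> y = (\<lambda>_. - 1) \<cdot> indicator (C n) \<cdot> y"
        if "y \<in> carrier X" for y
        using that by (simp add: scale_scale)
      ultimately have eq: "?i \<cdot>\<^sub>R m h = ?i \<cdot>\<^sub>R m (g n)"
        unfolding ind m_def using x hc gn iK by (simp add: scale_add_right)
      have "AE w in M. p (?i \<cdot>\<^sub>R m (g n)) w = ?i w * p (m h) w"
        unfolding eq[symmetric] by (rule sublinear_scale[OF sublinear_seminorm[OF p] i m[OF hc]]) simp
      moreover have "AE w in M. p (?i \<cdot>\<^sub>R m (g n)) w = ?i w * p (m (g n)) w"
        by (rule sublinear_scale[OF sublinear_seminorm[OF p] i m[OF gn]]) simp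
      ultimately show ?thesis unfolding g(2) by eventually_elim (auto simp: indicator_def)
    qed
    then have "AE w in M. \<forall>n. w \<in> C n \<longrightarrow> p (m h) w = D0 n w" unfolding AE_all_countable by blast
    then have "AE w in M. p (m h) w \<le> e w"
      using nD AE_space[of M]
    proof eventually_elim
      case (elim w)
      obtain n where "D0 n w < e w" using elim(2) by (auto simp: D_def not_le)
      then have "D0 (N w) w < e w" unfolding N_def by (rule LeastI)
      moreover have "w \<in> C (N w)" using elim(3) by (simp add: C_def)
      ultimately show ?case using elim(1) by force
    qed
    \<comment> \<open>The neighbourhood consists of points \<open>x + z\<close> with small
      \<open>z\<close>, whereas \<open>m h\<close> is \<open>x - h\<close>. The sign is reversed so
      that \<open>x + z\<close> becomes \<open>h\<close>.\<close>
    moreover have "AE w in M. p ((\<lambda>_. - 1) \<cdot> m h) w \<le> norm (- 1 :: 'k) * p (m h) w"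
      using hc by (intro seminorm_scale_le[OF p]) auto
    ultimately have "AE w in M. p ((\<lambda>_. - 1) \<cdot> m h) w \<le> e w"
      by eventually_elim simp
    then have "(\<lambda>_. - 1) \<cdot> m h \<in> L0_ball M X Q \<epsilon>" using hc by (simp add: \<epsilon>e ball)
    then have "x \<oplus>\<^bsub>X\<^esub> (\<lambda>_. - 1) \<cdot> m h \<in> U" using QU by (auto simp: a_l_coset_def')
    moreover have "x \<oplus>\<^bsub>X\<^esub> (\<lambda>_. - 1) \<cdot> m h = h"
    proof -
      have "(\<lambda>_. - 1) \<cdot> m h = (\<lambda>_. - 1) \<cdot> x \<oplus>\<^bsub>X\<^esub> h"
        using x hc by (simp add: m_def scale_add_right scale_scale)
      then show ?thesis
        using x hc by (simp add: add_scale_minus_one flip: M.a_assoc)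
    qed
    ultimately show False using disj hH by auto
  qed
  let ?l = "\<lambda>w. 2 / e w"
  let ?q = "gauge p ?l G"
  have l: "?l \<in> borel_measurable M" by measurable
  have l0: "0 \<le> ?l w" for w using e0[of w] by simp
  note [simp] = less_imp_le[OF e0]
  have q: "seminorm ?q" by (rule seminorm_gauge[OF p l l0 G])
  obtain \<Phi> F where \<Phi>: "\<Phi> \<in> module_homs (L0 M) X (L0 M)" and F: "is_repr \<Phi> F"
    and F_le: "\<And>z. z \<in> carrier X \<Longrightarrow> AE w in M. norm (F z w) \<le> ?q z w"
    and F_x: "AE w in M. ?q x w \<le> norm (F x w)"
    using supporting_functional[OF q x] by blast
  show ?thesis
  proof (rule that[OF \<Phi>])
    show "continuous_map (Tc M X P) (Tc M (L0 M) {L0_abs M}) (restrict \<Phi> (carrier X))"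
    proof (rule continuous_map_of_dominated[OF \<Phi> F Q l _ ball])
      show "AE w in M. norm (F z w) \<le> ?l w * p z w" if "z \<in> carrier X" for z
        using F_le[OF that] gauge_le[OF p l l0 G that] by eventually_elim linarith
    qed (use e0 in simp_all)
    show "G \<subseteq> unit_set \<Phi>"
    proof
      fix h assume h: "h \<in> G"
      have "AE w in M. norm (F h w) \<le> 1"
        using F_le[OF GX[OF h]] gauge_le_one[OF p l l0 G h] by eventually_elim linarith
      then show "h \<in> unit_set \<Phi>" using unit_set_iff[OF F GX[OF h]] by blast
    qed
    show "x \<notin> unit_set \<Phi>"
    proof
      assume "x \<in> unit_set \<Phi>"
      then have "AE w in M. norm (F x w) \<le> 1" using unit_set_iff[OF F x] by blast
      moreover have "AE w in M. w \<in> D \<longrightarrow> 1 < ?q x w"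
        by (rule gauge_gt[OF p e e0 G x]) (use far in \<open>simp add: m_def\<close>)
      ultimately have "AE w in M. w \<notin> D" using F_x by eventually_elim linarith
      then show False using D_nonnull by blast
    qed
  qed
qed

end

text \<open>Compatibility enters in both directions: functionals given by \<open>Y\<close> are
  continuous, so their unit sets are closed; and every continuous functional comes from
  \<open>Y\<close>, so the separating one yields an element of the polar.\<close>

theorem theorem3p26:
  fixes M :: "'w measure"
    and X :: "(('w \<Rightarrow> 'k::real_or_complex) set, 'x, 'm) module_scheme"
    and Y :: "(('w \<Rightarrow> 'k) set, 'y, 'n) module_scheme"
    and pairing :: "'x \<Rightarrow> 'y \<Rightarrow> ('w \<Rightarrow> 'k) set"
    and A :: "'x set"
    and T :: "'x topology"
  assumes "prob_space M"
    and "random_duality_pair M X Y pairing"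
    and "countable_concatenation_property M X"
    and "A \<subseteq> carrier X"
    and "random_compatible M X Y pairing T"
  shows "bipolar M X Y pairing A = T closure_of (Hcc M X (L0_Gamma M X A))"
proof -
  have "Module.module (L0 M) X" using assms(2) unfolding random_duality_pair_def by blast
  then interpret rc_random_module M X
    using assms(1) by (intro rc_random_module.intro random_module.intro)
  obtain P where P: "random_locally_convex_module M X P" and T: "T = Tc M X P"
    and dual: "dual_c M X P = (\<lambda>y. \<lambda>x\<in>carrier X. pairing x y) ` carrier Y"
    using assms(5) by (auto simp: random_compatible_def)
  note \<Gamma> = L0_Gamma_properties[OF assms(4)]
  have topT: "topspace T = carrier X" unfolding T by (rule topspace_Tc) unfold_locales
  have hom: "(\<lambda>x. pairing x y) \<in> module_homs (L0 M) X (L0 M)" if "y \<in> carrier Y" for y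
    using assms(2) that unfolding random_duality_pair_def by blast
  have polar_iff: "y \<in> polar M Y pairing A \<longleftrightarrow> y \<in> carrier Y \<and> A \<subseteq> unit_set (\<lambda>x. pairing x y)" for y
    using assms(4) by (auto simp: polar_def unit_set_def)
  have bipolar_iff: "x \<in> bipolar M X Y pairing A \<longleftrightarrow>
      x \<in> carrier X \<and> (\<forall>y\<in>polar M Y pairing A. x \<in> unit_set (\<lambda>x. pairing x y))" for x
    unfolding bipolar_def polar_def[of M X] unit_set_def by blast
  show ?thesis
  proof (rule Set.set_eqI, rule iffI)
    fix x assume x: "x \<in> T closure_of Hcc M X (L0_Gamma M X A)"
    have "x \<in> carrier X" using subsetD[OF closure_of_subset_topspace x] by (simp only: topT)
    moreover have "x \<in> unit_set (\<lambda>x. pairing x y)" if "y \<in> polar M Y pairing A" for y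
    proof -
      let ?C = "unit_set (\<lambda>x. pairing x y)"
      have y: "y \<in> carrier Y" and AC: "A \<subseteq> ?C" using that by (simp_all add: polar_iff)
      have "(\<lambda>x\<in>carrier X. pairing x y) \<in> dual_c M X P" unfolding dual using y by (rule imageI)
      then have "closedin T ?C"
        unfolding T dual_c_def by (intro closedin_unit_set) blast
      moreover have "L0_Gamma M X A \<subseteq> ?C"
        unfolding L0_Gamma_def
      proof (intro hull_minimal AC conjI)
        show "?C \<subseteq> carrier X" by (auto simp: unit_set_def)
        show "?C \<noteq> {}" using zero_mem_unit_set[OF hom[OF y]] by blast
        show "L0_balanced M X ?C" unfolding balanced_iff by (rule balanced_unit_set[OF hom[OF y]])
        show "L0_convex M X ?C" unfolding convex_iff by (rule convex_unit_set[OF hom[OF y]])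
      qed
      then have "Hcc M X (L0_Gamma M X A) \<subseteq> Hcc M X ?C" unfolding Hcc_def by blast
      then have "Hcc M X (L0_Gamma M X A) \<subseteq> ?C" using Hcc_unit_set[OF hom[OF y]] by blast
      ultimately show ?thesis by (intro subsetD[OF closure_of_minimal x])
    qed
    ultimately show "x \<in> bipolar M X Y pairing A" by (simp add: bipolar_iff)
  next
    fix x assume x: "x \<in> bipolar M X Y pairing A"
    then have xc: "x \<in> carrier X" by (simp add: bipolar_iff)
    show "x \<in> T closure_of Hcc M X (L0_Gamma M X A)"
    proof (rule ccontr)
      assume "x \<notin> T closure_of Hcc M X (L0_Gamma M X A)"
      then have notin: "x \<notin> Tc M X P closure_of Hcc M X (L0_Gamma M X A)" unfolding T .
      have seminorms: "L0_seminorm M X r" if "r \<in> P" for r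
        using P that by (simp add: random_locally_convex_module_def)
      obtain \<Phi> where \<Phi>: "\<Phi> \<in> module_homs (L0 M) X (L0 M)"
        "continuous_map (Tc M X P) (Tc M (L0 M) {L0_abs M}) (restrict \<Phi> (carrier X))"
        "L0_Gamma M X A \<subseteq> unit_set \<Phi>" "x \<notin> unit_set \<Phi>"
        by (rule separation[OF assms(3) seminorms \<Gamma>(2-5) xc notin])
      \<comment> \<open>Members of \<open>dual_c\<close> are extensional, so the arbitrary values of
        \<open>\<Phi>\<close> outside the carrier have to be discarded first.\<close>
      have "restrict \<Phi> (carrier X) \<in> module_homs (L0 M) X (L0 M)"
        using \<Phi>(1) by (simp add: module_homs_def Pi_iff)
      then have "restrict \<Phi> (carrier X) \<in> dual_c M X P" using \<Phi>(2) by (simp add: dual_c_def)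
      then obtain y where y: "y \<in> carrier Y"
        and eq: "restrict \<Phi> (carrier X) = (\<lambda>x\<in>carrier X. pairing x y)"
        unfolding dual by blast
      have "\<Phi> z = pairing z y" if "z \<in> carrier X" for z
        using fun_cong[OF eq, of z] that by simp
      then have C: "unit_set \<Phi> = unit_set (\<lambda>x. pairing x y)"
        unfolding unit_set_def by (intro Collect_cong conj_cong refl) simp
      have "y \<in> polar M Y pairing A" using y \<Phi>(3) \<Gamma>(1) by (auto simp: polar_iff C)
      then show False using x \<Phi>(4) by (simp add: bipolar_iff C)
    qed
  qed
qed

end
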